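(* Suppose the Riemann hypothesis fails, let $B$ be the supremum of the real parts of the nontrivial zeros of $\zeta(s)$, and let $b\in(1-B,1/2)$. Then there is a constant $c=c(b)>0$, independent of $\kappa$, such that for every real $\kappa>1$ the inequality \[ \sigma^{[\kappa]}(n)>\frac{(e^{\gamma}n\log\log n)^{\kappa}}{\zeta(\kappa)}\left(1+\frac{c}{(\log n)^{b}}\right)^{\kappa} \] holds for infinitely many positive integers $n$.
   Context: For real $\kappa>0$ and a positive integer $n$, $\sigma^{[\kappa]}(n):=\sum_{d\mid n}\mu(n/d)\sigma(d)^{\kappa}$, where $\sigma$ is the sum-of-divisors function and $\mu$ the Möbius function. $\gamma$ is the Euler–Mascheroni constant and $\zeta$ the Riemann zeta function. *)

theory Defs
  imports
    "HOL-Complex_Analysis.Complex_Analysis"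
    "HOL-Computational_Algebra.Computational_Algebra"
begin

definition sigma :: "nat \<Rightarrow> nat" where
  "sigma n = (\<Sum>d | d dvd n. d)"

definition moebius :: "nat \<Rightarrow> int" where
  "moebius n = (if squarefree n then (-1) ^ card (prime_factors n) else 0)"

definition sigma_conv :: "real \<Rightarrow> nat \<Rightarrow> real" where
  "sigma_conv \<kappa> n = (\<Sum>d | d dvd n. of_int (moebius (n div d)) * real (sigma d) powr \<kappa>)"

(* The analytic continuation of the Dirichlet series to the complex plane without 1.
   It is unique there by the identity theorem; the value at the pole 1 is unspecified,
   which is why 1 is excluded explicitly from the zeros below. *)
definition zeta :: "complex \<Rightarrow> complex" where
  "zeta = (SOME f. f holomorphic_on (- {1}) \<and>
     (\<forall>s. Re s > 1 \<longrightarrow> (\<lambda>n. of_nat (Suc n) powr (- s)) sums f s))"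

(* The trivial zeros are -2, -4, -6, ... *)
definition nontrivial_zeta_zeros :: "complex set" where
  "nontrivial_zeta_zeros =
     {s. s \<noteq> 1 \<and> zeta s = 0 \<and> \<not> (\<exists>k::nat. k \<ge> 1 \<and> s = - of_nat (2 * k))}"

definition Riemann_hypothesis :: bool where
  "Riemann_hypothesis \<longleftrightarrow> (\<forall>s\<in>nontrivial_zeta_zeros. Re s = 1 / 2)"

end

(* The function sigma_conv k is multiplicative, and on prime powers it is at least
   sigma(p^a)^k (1 - p^(-k)); hence sigma_conv k n >= sigma(n)^k / zeta(k) by the Euler product,
   and it suffices to exceed e^gamma n log log n in Robin's inequality by a factor
   1 + 1 / (log n)^b.  Take n = lcm(1..x), so that log n = psi(x).  Up to O(x^(-1/2 + eps)),
   log (sigma(n)/n) is the sum of Lambda(m) / (m log m) over m <= x.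

   Let J(x) be this sum minus Ein(log x) minus (psi(x) - x + 1) / (x log x); it is a lower bound
   for log (sigma(n)/n) - gamma - log log log n up to the same error.  The Laplace transform V of
   t J(e^t) satisfies s^2 V(s) = l - log(s + 1) - s l'/(s + 1) + s/(s + 1) with
   l = log (s zeta(1 + s)), so it continues along the real axis to s > -1 (the constant gamma is
   absorbed by Ein).  If J(x) <= x^(-a) for all large x, where 1 - Re rho < a for a zero rho,
   Landau's theorem makes V holomorphic on Re s > -a, which contradicts the double pole of
   (s^2 V)' at rho - 1. *)
theory Submission
  imports Defs "HOL-Number_Theory.Prime_Powers" "HOL-Real_Asymp.Real_Asymp"
begin

section \<open>Analytic continuation of the zeta function\<close>

text \<open>The psi term of J comes from log log log n = log log psi(x): the concave function log
  log is replaced by its tangent at x, so that J is linear in psi and in the sum. The factor t = log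
  x cancels the denominator of the tangent, and every piece then has an elementary transform.
  Landau's theorem wants regularity on a real segment, where two obstacles lie: s = 0, where s^2
  V(s) has to vanish to second order, and possible zeros of zeta in (0, 1), excluded by a recurrence
  whose terms have one sign. Off the real axis s^2 V contains a logarithm that branches at each
  zero. Its derivative, multiplied by the square of s zeta(1 + s), involves only that entire
  function, its derivatives and rational functions, and this identity extends to the whole
  half-plane. The exponents satisfy 1 - Re \<rho> < a < b and a < \<theta> < 1/2: the oscillation
  has size x^(-a), truncating the prime powers costs x^(-\<theta>), and psi(x) >= x/4 bounds 1/(log
  n)^b by a multiple of x^(-b). The gaps between the exponents absorb all constants, so c = 1
  serves.\<close>

lemma sums_complex_of_realE:
  assumes "(\<lambda>n. complex_of_real (c n)) sums S"
  obtains y where "c sums y" "S = of_real y"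
proof -
  have "summable c" using sums_summable[OF assms] by (simp only: summable_of_real_iff)
  hence "c sums suminf c" by (rule summable_sums)
  moreover from this have "(\<lambda>n. complex_of_real (c n)) sums of_real (suminf c)" by (rule sums_of_real)
  ultimately show ?thesis using that assms sums_unique2 by blast
qed

section \<open>Dirichlet series with bounded coefficients\<close>

lemma norm_nat_powr: "n > 0 \<Longrightarrow> norm (of_nat n powr (s::complex)) = real n powr Re s"
  by (simp add: norm_powr_real_powr)

text \<open>Termwise differentiation under a locally uniform majorant. It is applied with all
  coefficients 1 and with \<open>mcoef\<close>, the coefficients of log zeta, so zeta and its
  logarithm get their derivatives from one statement.\<close>

lemma dirichlet_series_has_derivative:
  fixes a :: "nat \<Rightarrow> complex"
  assumes "\<And>n. norm (a n) \<le> 1"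
  obtains g g' where "\<And>s. Re s > 1 \<Longrightarrow> (\<lambda>n. a n * of_nat (Suc n) powr (-s)) sums g s"
    "\<And>s. Re s > 1 \<Longrightarrow> (\<lambda>n. - (a n * of_real (ln (real (Suc n))) * of_nat (Suc n) powr (-s))) sums g' s"
    "\<And>s. Re s > 1 \<Longrightarrow> (g has_field_derivative g' s) (at s)"
proof -
  have "\<exists>g g'. \<forall>s\<in>{s. Re s > 1}. ((\<lambda>n. a n * of_nat (Suc n) powr (-s)) sums g s) \<and>
      ((\<lambda>n. - (a n * of_real (ln (real (Suc n))) * of_nat (Suc n) powr (-s))) sums g' s) \<and>
      (g has_field_derivative g' s) (at s)"
  proof (rule series_and_derivative_comparison_complex)
    show "open {s. Re s > 1}" by (simp add: open_halfspace_Re_gt)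
  next
    fix n s assume "s \<in> {s. Re s > 1}"
    have "complex_of_real (ln (real (Suc n))) = Ln (of_nat (Suc n))"
      by (metis Ln_of_real of_nat_0_less_iff of_real_of_nat_eq zero_less_Suc)
    moreover have *: "((\<lambda>s. of_nat (Suc n) powr (-s)) has_field_derivative
        Ln (of_nat (Suc n)) * of_nat (Suc n) powr (-s) * (-1)) (at s)"
      by (rule DERIV_chain2[OF has_field_derivative_powr_right]) (auto intro!: derivative_eq_intros simp del: of_nat_Suc)
    ultimately show "((\<lambda>s. a n * of_nat (Suc n) powr (-s)) has_field_derivative
       - (a n * of_real (ln (real (Suc n))) * of_nat (Suc n) powr (-s))) (at s)"
      using DERIV_cmult[OF *, of "a n"] by (simp del: of_nat_Suc add: mult_ac)
  next
    fix x :: complex assume x: "x \<in> {s. Re s > 1}"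
    \<comment> \<open>Half the distance to the line Re s = 1: the ball of radius \<open>d\<close>
      about \<open>x\<close> stays in Re y > 1 + d.\<close>
    define d where "d = (Re x - 1) / 2"
    have d: "d > 0" using x by (simp add: d_def)
    define h where "h = (\<lambda>n. complex_of_real (real (Suc n) powr (-(1+d))))"
    have "summable (\<lambda>n. real n powr (-(1+d)))"
      using d by (subst summable_real_powr_iff) auto
    hence "summable (\<lambda>n. real (Suc n) powr (-(1+d)))" by (subst summable_Suc_iff)
    hence "summable h" unfolding h_def by (rule summable_of_real)
    moreover have "range h \<subseteq> \<real>\<^sub>\<ge>\<^sub>0" by (auto simp: h_def)
    moreover have "cmod (a n * of_nat (Suc n) powr (-y)) \<le> cmod (h n)" if "y \<in> ball x d" for n y
    proof -
      have "\<bar>Re (x - y)\<bar> < d" using that abs_Re_le_cmod[of "x - y"] by (simp add: dist_norm)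
      hence "Re x - Re y < d" by simp
      hence "Re y > 1 + d" by (simp add: d_def field_simps)
      hence "real (Suc n) powr (- Re y) \<le> real (Suc n) powr (-(1+d))"
        by (intro powr_mono) auto
      moreover have "cmod (a n * of_nat (Suc n) powr (-y)) = cmod (a n) * real (Suc n) powr (- Re y)"
        unfolding norm_mult by (subst norm_nat_powr) auto
      moreover have "\<dots> \<le> 1 * real (Suc n) powr (- Re y)" by (intro mult_right_mono assms) auto
      moreover have "cmod (h n) = real (Suc n) powr (-(1+d))" by (simp add: h_def)
      ultimately show ?thesis by linarith
    qed
    ultimately show "\<exists>d h. 0 < d \<and> summable h \<and> range h \<subseteq> \<real>\<^sub>\<ge>\<^sub>0 \<and>
      (\<forall>\<^sub>F n in sequentially. \<forall>y\<in>ball x d \<inter> {s. Re s > 1}. cmod (a n * of_nat (Suc n) powr (-y)) \<le> cmod (h n))"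
      using d by (intro exI[of _ d] exI[of _ h]) (auto intro!: always_eventually)
  qed
  thus ?thesis using that by blast
qed

text \<open>This is zeta s - 1 for Re s > 1. Without the term of 1 the function decays like
  \<open>2 powr (- Re s)\<close>, and this geometric decay outweighs the coefficients
  \<open>pochhammer / fact\<close> of the recurrence below.\<close>

definition zeta_tail :: "complex \<Rightarrow> complex" where
  "zeta_tail s = (\<Sum>n. of_nat (n + 2) powr (-s))"

lemma summable_powr_shift: "x > 1 \<Longrightarrow> summable (\<lambda>n. real (n+2) powr (-x))"
  by (subst summable_iff_shift[where f = "\<lambda>n. real n powr (-x)"], subst summable_real_powr_iff) simp

lemma zeta_tail_sums:
  assumes "Re s > 1"
  shows "(\<lambda>n. of_nat (n + 2) powr (-s)) sums zeta_tail s"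
    "(\<lambda>n. of_nat (Suc n) powr (-s)) sums (1 + zeta_tail s)"
proof -
  obtain g g' where "\<And>s::complex. Re s > 1 \<Longrightarrow> (\<lambda>n. 1 * of_nat (Suc n) powr (-s)) sums g s"
    by (rule dirichlet_series_has_derivative[of "\<lambda>n. 1"]) auto
  from this[OF assms] have *: "(\<lambda>n. of_nat (Suc n) powr (-s)) sums g s" by simp
  from sums_Suc_imp[of "\<lambda>n. of_nat (Suc n) powr (-s)", OF _ ] *
  have "(\<lambda>n. of_nat (Suc (Suc n)) powr (-s)) sums (g s - 1)"
    by (subst sums_Suc_iff) simp
  hence "(\<lambda>n. of_nat (n + 2) powr (-s)) sums (g s - 1)" by (simp add: add_ac)
  moreover from sums_unique[OF this] have "g s = 1 + zeta_tail s" unfolding zeta_tail_def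
    by (metis add.commute diff_add_cancel)
  ultimately show "(\<lambda>n. of_nat (n + 2) powr (-s)) sums zeta_tail s"
    "(\<lambda>n. of_nat (Suc n) powr (-s)) sums (1 + zeta_tail s)" using * by auto
qed

lemma zeta_tail_holomorphic: "zeta_tail holomorphic_on {s. Re s > 1}"
proof -
  obtain g g' where g: "\<And>s::complex. Re s > 1 \<Longrightarrow> (\<lambda>n. 1 * of_nat (Suc n) powr (-s)) sums g s"
    "\<And>s. Re s > 1 \<Longrightarrow> (g has_field_derivative g' s) (at s)"
    by (rule dirichlet_series_has_derivative[of "\<lambda>n. 1"]) auto
  have "g holomorphic_on {s. Re s > 1}"
  proof (rule holomorphic_onI)
    fix s assume "s \<in> {s. Re s > 1}"
    hence "(g has_field_derivative g' s) (at s)" using g(2) by simp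
    thus "g field_differentiable at s within {s. Re s > 1}"
      using field_differentiable_def has_field_derivative_at_within by blast
  qed
  hence "(\<lambda>s. g s - 1) holomorphic_on {s. Re s > 1}"
    by (intro holomorphic_on_diff) auto
  moreover have "g s - 1 = zeta_tail s" if "Re s > 1" for s
    using sums_unique2[OF g(1)[OF that]] zeta_tail_sums(2)[OF that] by simp
  ultimately show ?thesis by (subst holomorphic_cong[OF refl, of _ _ "\<lambda>s. g s - 1"]) auto
qed

section \<open>Binomial series and the recurrence for the tail\<close>

lemma norm_pochhammer_le: "norm (pochhammer (w::complex) j) \<le> pochhammer (norm w) j"
proof (induction j)
  case (Suc j)
  have "norm (w + of_nat j) \<le> norm w + real j"
    by (metis norm_of_nat norm_triangle_ineq)
  thus ?case using Suc by (auto simp: pochhammer_rec' norm_mult intro!: mult_mono pochhammer_nonneg)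
qed auto

lemma pochhammer_mono: "0 \<le> a \<Longrightarrow> a \<le> b \<Longrightarrow> pochhammer (a::real) j \<le> pochhammer b j"
  by (simp add: pochhammer_prod prod_mono)

lemma binomial_series_neg:
  assumes "0 \<le> x" "x < 1"
  shows "(\<lambda>j. pochhammer (w::complex) j / fact j * of_real x ^ j) sums (1 - of_real x) powr (-w)"
proof -
  have "(\<lambda>n. ((-w) gchoose n) * (- of_real x)^n) sums (1 + (- of_real x)) powr (-w)"
    by (rule gen_binomial_complex) (use assms in auto)
  also have "(\<lambda>n. ((-w) gchoose n) * (- of_real x)^n) = (\<lambda>j. pochhammer (w::complex) j / fact j * of_real x ^ j)"
  proof
    fix n show "((-w) gchoose n) * (- of_real x)^n = pochhammer (w::complex) n / fact n * of_real x ^ n"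
      by (subst power_minus) (simp add: gbinomial_pochhammer mult_ac flip: power_mult_distrib)
  qed
  finally show ?thesis by simp
qed

text \<open>These are the terms of the binomial series of (1 - 1/2) powr (-M). With \<open>M\<close>
  a bound for norm (s - 1) they majorise the recurrence and its continuation.\<close>

lemma summable_pochhammer_half:
  "summable (\<lambda>j. pochhammer (M::real) j / fact j * (1/2) ^ j)"
proof -
  have "summable (\<lambda>j. pochhammer (complex_of_real M) j / fact j * of_real (1/2) ^ j)"
    using binomial_series_neg[of "1/2" "of_real M"] by (simp add: sums_iff)
  also have "(\<lambda>j. pochhammer (complex_of_real M) j / fact j * of_real (1/2) ^ j) =
      (\<lambda>j. of_real (pochhammer M j / fact j * (1/2) ^ j))"
    by (simp add: pochhammer_of_real)
  finally show ?thesis by (simp only: summable_of_real_iff)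
qed

text \<open>The product majorant makes \<open>f\<close> absolutely summable over pairs, and both
  iterated sums equal that one unordered sum.\<close>

lemma sums_swap_dominated:
  fixes f :: "nat \<Rightarrow> nat \<Rightarrow> complex"
  assumes le: "\<And>m j. norm (f m j) \<le> u m * v j" and "summable u" "summable v"
    and u: "\<And>m. u m \<ge> 0" and v: "\<And>m. v m \<ge> 0"
  shows "(\<lambda>j. \<Sum>m. f m j) sums (\<Sum>m. \<Sum>j. f m j)"
proof -
  have us: "u summable_on UNIV" and vs: "v summable_on UNIV"
    using assms by (auto intro!: norm_summable_imp_summable_on)
  have "(\<lambda>(m,j). u m * v j) summable_on UNIV \<times> UNIV"
  proof (rule summable_on_SigmaI[where g = "\<lambda>m. u m * (\<Sum>\<^sub>\<infinity>j. v j)"])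
    fix m show "((\<lambda>j. case (m, j) of (m, j) \<Rightarrow> u m * v j) has_sum u m * infsum v UNIV) UNIV"
      using vs by (auto intro!: has_sum_cmult_right has_sum_infsum)
  qed (use us u v in \<open>auto intro!: summable_on_cmult_left\<close>)
  hence "(\<lambda>(m,j). norm (f m j)) summable_on UNIV \<times> UNIV"
    by (rule summable_on_comparison_test) (use le in auto)
  hence abs: "(\<lambda>p. norm (case p of (m,j) \<Rightarrow> f m j)) summable_on UNIV \<times> UNIV" by (simp add: case_prod_unfold)
  then obtain S where S: "((\<lambda>(m,j). f m j) has_sum S) (UNIV \<times> UNIV)"
    using abs_summable_summable[OF abs] by (auto simp: summable_on_def)
  have S': "((\<lambda>(j,m). f m j) has_sum S) (UNIV \<times> UNIV)"
    using S by (subst (asm) has_sum_swap) simp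
  have 1: "(f m has_sum (\<Sum>j. f m j)) UNIV" for m
  proof -
    have sm: "summable (\<lambda>j. norm (f m j))"
      by (rule summable_comparison_test'[where g = "\<lambda>j. u m * v j"]) (use le assms in \<open>auto intro!: summable_mult\<close>)
    show ?thesis by (rule norm_summable_imp_has_sum[OF sm summable_sums[OF summable_norm_cancel[OF sm]]])
  qed
  have 2: "((\<lambda>m. f m j) has_sum (\<Sum>m. f m j)) UNIV" for j
  proof -
    have sm: "summable (\<lambda>m. norm (f m j))"
      by (rule summable_comparison_test'[where g = "\<lambda>m. u m * v j"]) (use le assms in \<open>auto intro!: summable_mult2\<close>)
    show ?thesis by (rule norm_summable_imp_has_sum[OF sm summable_sums[OF summable_norm_cancel[OF sm]]])
  qed
  have "((\<lambda>m. \<Sum>j. f m j) has_sum S) UNIV" by (rule has_sum_SigmaD[OF S]) (simp add: 1)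
  hence "S = (\<Sum>m. \<Sum>j. f m j)" by (intro sums_unique has_sum_imp_sums)
  moreover have "((\<lambda>j. \<Sum>m. f m j) has_sum S) UNIV" by (rule has_sum_SigmaD[OF S']) (simp add: 2)
  ultimately show ?thesis using has_sum_imp_sums by blast
qed

text \<open>Two powers of each base are kept for convergence; the remaining exponent Re s - 2 is
  nonnegative, so in that factor every base may be lowered to 2.\<close>

lemma zeta_tail_bound:
  obtains C where "C \<ge> 0" "\<And>s. Re s \<ge> 2 \<Longrightarrow> norm (zeta_tail s) \<le> C * 2 powr (- Re s)"
proof -
  define C where "C = (\<Sum>n. 4 * real (n+2) powr (-2))"
  have sm: "summable (\<lambda>n. 4 * real (n+2) powr (-2))"
    by (intro summable_mult summable_powr_shift) simp
  show ?thesis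
  proof (rule that)
    show "C \<ge> 0" unfolding C_def by (rule suminf_nonneg[OF sm]) auto
    fix s :: complex assume s: "Re s \<ge> 2"
    have le: "norm (of_nat (n+2) powr (-s)) \<le> 4 * real (n+2) powr (-2) * 2 powr (-Re s)" for n
    proof -
      have "norm (of_nat (n+2) powr (-s)) = real (n+2) powr (-2) * real (n+2) powr (-(Re s - 2))"
        by (subst norm_nat_powr) (auto simp flip: powr_add)
      also have "\<dots> \<le> real (n+2) powr (-2) * 2 powr (-(Re s - 2))"
        using s by (intro mult_left_mono powr_mono2') auto
      also have "2 powr (-(Re s - 2)) = 4 * 2 powr (-Re s)"
        by (simp add: powr_diff powr_minus field_simps)
      finally show ?thesis by (simp add: mult_ac)
    qed
    have sn: "summable (\<lambda>n. norm (of_nat (n+2) powr (-s)))"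
      by (rule summable_comparison_test'[OF summable_mult2[OF sm]]) (use le in auto)
    have "norm (zeta_tail s) \<le> (\<Sum>n. norm (of_nat (n+2) powr (-s)))"
      unfolding zeta_tail_def by (rule summable_norm[OF sn])
    also have "\<dots> \<le> (\<Sum>n. 4 * real (n+2) powr (-2) * 2 powr (-Re s))"
      by (rule suminf_le[OF le sn summable_mult2[OF sm]])
    also have "\<dots> = C * 2 powr (-Re s)" unfolding C_def by (rule suminf_mult2[OF sm, symmetric])
    finally show "norm (zeta_tail s) \<le> C * 2 powr (- Re s)" .
  qed
qed


text \<open>Expand \<open>(m - 1) powr (1 - s)\<close> binomially in the telescoping series of
  \<open>(m - 1) powr (1 - s) - m powr (1 - s)\<close>, \<open>m \<ge> 2\<close>.\<close>

lemma zeta_tail_recurrence: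
  assumes s: "Re s > 1"
  shows "(\<lambda>j. pochhammer (s-1) (Suc j) / fact (Suc j) * zeta_tail (s + of_nat j)) sums 1"
proof -
  define M where "M = norm (s - 1)"
  define f where "f = (\<lambda>m j. pochhammer (s-1) (Suc j) / fact (Suc j) * of_nat (m+2) powr (-(s + of_nat j)))"
  define u where "u = (\<lambda>m. 2 * real (m+2) powr (- Re s))"
  define v where "v = (\<lambda>j. pochhammer M (Suc j) / fact (Suc j) * (1/2) ^ Suc j)"
  have M: "M > 0" using s by (auto simp: M_def)
  have le: "norm (f m j) \<le> u m * v j" for m j
  proof -
    have "real (m+2) powr (- (Re s + real j)) = real (m+2) powr (- Re s) * real (m+2) powr (- real j)"
      by (simp flip: powr_add)
    also have "\<dots> \<le> real (m+2) powr (- Re s) * 2 powr (- real j)"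
      by (intro mult_left_mono powr_mono2') auto
    also have "2 powr (- real j) = 2 * (1/2) ^ Suc j"
      by (simp add: powr_minus powr_realpow power_one_over field_simps)
    finally have "real (m+2) powr (- (Re s + real j)) \<le> u m * (1/2) ^ Suc j"
      by (simp add: u_def)
    moreover have "norm (pochhammer (s-1) (Suc j)) / fact (Suc j) \<le> pochhammer M (Suc j) / fact (Suc j)"
      unfolding M_def by (intro divide_right_mono norm_pochhammer_le) auto
    ultimately have "norm (pochhammer (s-1) (Suc j)) / fact (Suc j) * real (m+2) powr (- (Re s + real j))
       \<le> (pochhammer M (Suc j) / fact (Suc j)) * (u m * (1/2) ^ Suc j)"
      using M by (intro mult_mono) (auto intro!: divide_nonneg_nonneg pochhammer_nonneg)
    moreover have "norm (f m j) = norm (pochhammer (s-1) (Suc j)) / fact (Suc j) * real (m+2) powr (- (Re s + real j))"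
      unfolding f_def norm_mult norm_divide by (subst norm_nat_powr) (auto simp del: fact_Suc simp: norm_fact)
    ultimately show ?thesis by (simp add: v_def mult_ac)
  qed
  have su: "summable u"
    unfolding u_def by (intro summable_mult summable_powr_shift s)
  have sv: "summable v"
    using summable_pochhammer_half[of M] unfolding v_def by (subst summable_Suc_iff)
  have "(\<lambda>j. \<Sum>m. f m j) sums (\<Sum>m. \<Sum>j. f m j)"
    using le su sv M by (intro sums_swap_dominated[of f u v])
      (auto simp: u_def v_def intro!: mult_nonneg_nonneg divide_nonneg_nonneg pochhammer_nonneg)
  also have "(\<lambda>j. \<Sum>m. f m j) = (\<lambda>j. pochhammer (s-1) (Suc j) / fact (Suc j) * zeta_tail (s + of_nat j))"
  proof
    fix j
    have "Re (s + of_nat j) > 1" using s by simp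
    from zeta_tail_sums(1)[OF this]
    show "(\<Sum>m. f m j) = pochhammer (s-1) (Suc j) / fact (Suc j) * zeta_tail (s + of_nat j)"
      unfolding f_def by (intro sums_unique[symmetric] sums_mult)
  qed
  also have "(\<Sum>m. \<Sum>j. f m j) = 1"
  proof -
    have inner: "(\<Sum>j. f m j) = of_nat (Suc m) powr (1-s) - of_nat (Suc (Suc m)) powr (1-s)" for m
    proof -
      \<comment> \<open>The base of the telescoping series is \<open>m + 2\<close> here. Since (m +
        2) (1 - x) = m + 1, the binomial series for this \<open>x\<close> yields the difference of
        two consecutive terms.\<close>
      define x where "x = 1 / real (m+2)"
      have x: "0 \<le> x" "x < 1" by (auto simp: x_def)
      have "(\<lambda>j. pochhammer (s-1) (Suc j) / fact (Suc j) * of_real x ^ Suc j) sums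
              ((1 - of_real x) powr (-(s-1)) - 1)"
        using binomial_series_neg[OF x, of "s-1"] by (subst sums_Suc_iff) simp
      hence "(\<lambda>j. of_nat (m+2) powr (1-s) * (pochhammer (s-1) (Suc j) / fact (Suc j) * of_real x ^ Suc j)) sums
              (of_nat (m+2) powr (1-s) * ((1 - of_real x) powr (1-s) - 1))"
        by (intro sums_mult) simp
      also have "(\<lambda>j. of_nat (m+2) powr (1-s) * (pochhammer (s-1) (Suc j) / fact (Suc j) * of_real x ^ Suc j)) = f m"
      proof
        fix j
        have "of_nat (m+2) powr (-(s + of_nat j)) = of_nat (m+2) powr ((1 - s) - of_nat (Suc j))"
          by (simp add: algebra_simps)
        also have "\<dots> = of_nat (m+2) powr (1-s) / of_nat (m+2) powr (of_nat (Suc j))"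
          by (rule powr_diff)
        also have "of_nat (m+2) powr (of_nat (Suc j)) = (of_nat (m+2) :: complex) ^ Suc j"
          by (rule powr_nat') auto
        also have "of_nat (m+2) powr (1-s) / (of_nat (m+2) :: complex) ^ Suc j = of_nat (m+2) powr (1-s) * of_real x ^ Suc j"
          by (simp add: x_def power_divide del: of_nat_add)
        finally show "of_nat (m+2) powr (1-s) * (pochhammer (s-1) (Suc j) / fact (Suc j) * of_real x ^ Suc j) = f m j"
          unfolding f_def by (simp add: mult_ac)
      qed
      also have "of_nat (m+2) powr (1-s) * ((1 - of_real x) powr (1-s) - 1) =
         of_nat (Suc m) powr (1-s) - of_nat (Suc (Suc m)) powr (1-s)"
      proof -
        have "(1 - complex_of_real x) = of_real (1 - x)" by simp
        moreover have "of_nat (m+2) = complex_of_real (real (m+2))" by simp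
        ultimately have "of_nat (m+2) powr (1-s) * (1 - of_real x) powr (1-s) = of_real (real (m+2) * (1 - x)) powr (1-s)"
          by (simp only: of_real_mult powr_times_real_left Reals_of_real Re_complex_of_real of_nat_0_le_iff simp_thms)
        also have "real (m+2) * (1 - x) = real (Suc m)" by (simp add: x_def field_simps)
        finally show ?thesis by (simp add: ring_distribs)
      qed
      finally show ?thesis by (simp add: sums_iff)
    qed
    have "(\<lambda>m. of_nat (Suc m) powr (1-s)) \<longlonglongrightarrow> 0"
    proof (rule Lim_null_comparison)
      show "\<forall>\<^sub>F m in sequentially. norm (of_nat (Suc m) powr (1-s)) \<le> real (Suc m) powr (1 - Re s)"
        by (intro always_eventually allI, subst norm_nat_powr) auto
      show "(\<lambda>m. real (Suc m) powr (1 - Re s)) \<longlonglongrightarrow> 0"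
        using s by (intro tendsto_neg_powr filterlim_compose[OF filterlim_real_sequentially filterlim_Suc]) auto
    qed
    from telescope_sums'[OF this] have "(\<lambda>m. of_nat (Suc m) powr (1-s) - of_nat (Suc (Suc m)) powr (1-s)) sums 1"
      by simp
    thus ?thesis by (simp only: inner sums_iff)
  qed
  finally show ?thesis .
qed

section \<open>Continuation by successive half-planes\<close>

lemma halfplane_identity:
  assumes "f holomorphic_on {s. Re s > a}" "g holomorphic_on {s. Re s > a}"
    and "\<And>s. Re s > c \<Longrightarrow> f s = g s" and "Re s > a"
  shows "f s = g s"
proof (rule analytic_continuation_open[of "{s. Re s > max a c}" "{s. Re s > a}" f g])
  show "open {s. Re s > max a c}" by (rule open_halfspace_Re_gt)
  show "{s. Re s > max a c} \<noteq> {}"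
    by (auto intro!: exI[of _ "of_real (max a c + 1)"])
  show "connected {s. Re s > a}" by (rule convex_connected[OF convex_halfspace_Re_gt])
qed (use assms in \<open>auto intro!: open_halfspace_Re_gt\<close>)

text \<open>The first term of the recurrence is \<open>g s\<close> and the others involve \<open>g (s + 1), g (s + 2), \<dots>\<close>,
  so the recurrence moves the boundary of a half-plane by one.\<close>

lemma zeta_tail_step:
  assumes hol: "g holomorphic_on {s. Re s > a}" and "a \<le> 1"
    and eq: "\<And>s. Re s > 1 \<Longrightarrow> g s = (s - 1) * zeta_tail s"
  obtains h where "h holomorphic_on {s. Re s > a - 1}"
    "\<And>s. Re s > a - 1 \<Longrightarrow>
       (\<lambda>j. pochhammer (s-1) (Suc j) / fact (Suc (Suc j)) * g (s + of_nat (Suc j))) sums (1 - h s)"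
    "\<And>s. Re s > 1 \<Longrightarrow> h s = (s - 1) * zeta_tail s"
proof -
  define f where "f = (\<lambda>j s. pochhammer (s-1) (Suc j) / fact (Suc (Suc j)) * g (s + of_nat (Suc j)))"
  obtain C where C: "C \<ge> 0" "\<And>s. Re s \<ge> 2 \<Longrightarrow> norm (zeta_tail s) \<le> C * 2 powr (- Re s)"
    using zeta_tail_bound by blast
  \<comment> \<open>Where the Dirichlet series applies, \<open>g\<close> contributes the factor s +
    j, which is the next factor of the rising factorial. This restores the term of the original
    recurrence with index j + 1.\<close>
  have f_eq: "f j s = pochhammer (s-1) (Suc (Suc j)) / fact (Suc (Suc j)) * zeta_tail (s + of_nat (Suc j))"
    if "Re s + real j > 0" for s j
  proof -
    have "g (s + of_nat (Suc j)) = (s - 1 + of_nat (Suc j)) * zeta_tail (s + of_nat (Suc j))"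
      using that by (subst eq) (auto simp: algebra_simps)
    thus ?thesis unfolding f_def by (simp only: pochhammer_rec'[of _ "Suc j"]) simp
  qed
  have op: "open {s. Re s > b}" for b by (rule open_halfspace_Re_gt)
  have hol_f: "f j field_differentiable (at s)" if "s \<in> {s. Re s > a - 1}" for j s
  proof -
    have "(\<lambda>s. g (s + of_nat (Suc j))) holomorphic_on {s. Re s > a - 1}"
      by (rule holomorphic_on_compose_gen[OF _ hol, unfolded o_def]) (auto intro!: holomorphic_intros)
    hence "f j holomorphic_on {s. Re s > a - 1}"
      unfolding f_def pochhammer_prod by (auto intro!: holomorphic_intros simp del: fact_Suc)
    thus ?thesis using that op by (auto simp: holomorphic_on_open field_differentiable_def)
  qed
  obtain H where H: "\<forall>s \<in> {s. Re s > a - 1}. ((\<lambda>n. f n s) sums H s) \<and> H field_differentiable (at s)"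
  proof (rule series_differentiable_comparison_complex[OF op hol_f])
    fix x assume x: "x \<in> {s. Re s > a - 1}"
    define M where "M = norm (x - 1) + 1"
    have M: "M > 0" by (simp add: M_def add_nonneg_pos)
    \<comment> \<open>The factor \<open>2 powr (2 - Re x)\<close> aligns the geometric decay with
      the index \<open>Suc (Suc j)\<close> of the rising factorial.\<close>
    define K where "K = C * 2 powr (2 - Re x)"
    have K: "K \<ge> 0" using C by (auto simp: K_def)
    define h where "h = (\<lambda>j. K * (pochhammer M (Suc (Suc j)) / fact (Suc (Suc j)) * (1/2) ^ Suc (Suc j)))"
    have h_nn: "h j \<ge> 0" for j using K M by (auto simp: h_def intro!: mult_nonneg_nonneg divide_nonneg_nonneg pochhammer_nonneg)
    have "summable h"
      using summable_pochhammer_half[of M] unfolding h_def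
      by (intro summable_mult) (subst summable_Suc_iff, subst summable_Suc_iff)
    hence "summable (\<lambda>j. complex_of_real (h j))" by (rule summable_of_real)
    moreover have "range (\<lambda>j. complex_of_real (h j)) \<subseteq> \<real>\<^sub>\<ge>\<^sub>0" using h_nn by auto
    \<comment> \<open>The condition on \<open>j\<close> puts y + j + 1 into Re \<ge> 2 for every y
      in the unit ball about x, so that the bound on \<open>zeta_tail\<close> holds.\<close>
    moreover have "cmod (f j y) \<le> cmod (complex_of_real (h j))" if y: "y \<in> ball x 1" and j: "real j > 2 - Re x" for j y
    proof -
      have y1: "norm (x - y) < 1" using y by (simp add: dist_norm)
      have "\<bar>Re (x - y)\<bar> < 1" using abs_Re_le_cmod[of "x - y"] y1 by linarith
      hence Re: "Re y > Re x - 1" by simp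
      have "norm (y - 1) \<le> norm (y - x) + norm (x - 1)" using norm_triangle_ineq[of "y - x" "x - 1"] by simp
      hence ny: "norm (y - 1) \<le> M" using y1 by (simp add: M_def norm_minus_commute)
      have "norm (pochhammer (y-1) (Suc (Suc j))) \<le> pochhammer (norm (y - 1)) (Suc (Suc j))"
        by (rule norm_pochhammer_le)
      also have "\<dots> \<le> pochhammer M (Suc (Suc j))" by (rule pochhammer_mono) (use ny in auto)
      finally have p: "norm (pochhammer (y-1) (Suc (Suc j))) \<le> pochhammer M (Suc (Suc j))" .
      have "norm (zeta_tail (y + of_nat (Suc j))) \<le> C * 2 powr (- Re (y + of_nat (Suc j)))"
        by (rule C) (use Re j in auto)
      also have "\<dots> \<le> C * 2 powr (- (Re x + real j))"
        by (intro mult_left_mono powr_mono C) (use Re in auto)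
      also have "2 powr (- (Re x + real j)) = 2 powr (2 - Re x) * 2 powr (- real (Suc (Suc j)))"
        by (subst powr_add[symmetric]) (auto simp: algebra_simps)
      also have "2 powr (- real (Suc (Suc j))) = (1/2) ^ Suc (Suc j)"
        by (subst powr_minus, subst powr_realpow) (auto simp: power_one_over field_simps)
      finally have z: "norm (zeta_tail (y + of_nat (Suc j))) \<le> K * (1/2) ^ Suc (Suc j)" by (simp add: K_def mult_ac)
      have "norm (f j y) = norm (pochhammer (y-1) (Suc (Suc j))) / fact (Suc (Suc j)) * norm (zeta_tail (y + of_nat (Suc j)))"
        by (subst f_eq) (use Re j in \<open>auto simp: norm_mult norm_divide simp del: fact_Suc simp: norm_fact\<close>)
      also have "\<dots> \<le> pochhammer M (Suc (Suc j)) / fact (Suc (Suc j)) * (K * (1/2) ^ Suc (Suc j))"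
        using p z M by (intro mult_mono divide_right_mono) (auto intro!: divide_nonneg_nonneg pochhammer_nonneg)
      also have "\<dots> = h j" by (simp only: h_def mult_ac)
      finally show ?thesis using h_nn[of j] by simp
    qed
    moreover have "\<forall>\<^sub>F j in sequentially. real j > 2 - Re x"
      using filterlim_real_sequentially by (simp add: filterlim_at_top_dense)
    ultimately show "\<exists>d h. 0 < d \<and> summable h \<and> range h \<subseteq> \<real>\<^sub>\<ge>\<^sub>0 \<and>
      (\<forall>\<^sub>F n in sequentially. \<forall>y\<in>ball x d \<inter> {s. Re s > a - 1}. cmod (f n y) \<le> cmod (h n))"
      by (intro exI[of _ 1] exI[of _ "\<lambda>j. complex_of_real (h j)"]) (auto elim!: eventually_mono)
  qed
  show ?thesis
  proof (rule that[of "\<lambda>s. 1 - H s"])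
    have "H holomorphic_on {s. Re s > a - 1}"
      using H op by (auto simp: holomorphic_on_open field_differentiable_def)
    thus "(\<lambda>s. 1 - H s) holomorphic_on {s. Re s > a - 1}" by (intro holomorphic_intros)
    show "(\<lambda>j. pochhammer (s-1) (Suc j) / fact (Suc (Suc j)) * g (s + of_nat (Suc j))) sums (1 - (1 - H s))"
      if "Re s > a - 1" for s using H that unfolding f_def by simp
    show "1 - H s = (s - 1) * zeta_tail s" if s: "Re s > 1" for s
    proof -
      have "(\<lambda>n. f n s) sums H s" using H s \<open>a \<le> 1\<close> by auto
      also have "(\<lambda>n. f n s) = (\<lambda>j. pochhammer (s-1) (Suc (Suc j)) / fact (Suc (Suc j)) * zeta_tail (s + of_nat (Suc j)))"
        by (rule ext, rule f_eq) (use s in auto)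
      finally have "(\<lambda>j. pochhammer (s-1) (Suc j) / fact (Suc j) * zeta_tail (s + of_nat j)) sums
         (H s + pochhammer (s-1) (Suc 0) / fact (Suc 0) * zeta_tail (s + of_nat 0))"
        by (rule sums_Suc)
      with zeta_tail_recurrence[OF s] have "H s + pochhammer (s-1) (Suc 0) / fact (Suc 0) * zeta_tail (s + of_nat 0) = 1"
        using sums_unique2 by blast
      thus ?thesis by (simp add: algebra_simps)
    qed
  qed
qed

lemma zeta_tail_continuation_halfplane:
  "\<exists>g. g holomorphic_on {s. Re s > 1 - real k} \<and> (\<forall>s. Re s > 1 \<longrightarrow> g s = (s - 1) * zeta_tail s)"
proof (induction k)
  case 0
  show ?case
    by (intro exI[of _ "\<lambda>s. (s - 1) * zeta_tail s"]) (auto intro!: holomorphic_intros zeta_tail_holomorphic)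
next
  case (Suc k)
  then obtain g where g: "g holomorphic_on {s. Re s > 1 - real k}" "\<And>s. Re s > 1 \<Longrightarrow> g s = (s - 1) * zeta_tail s"
    by auto
  obtain h where "h holomorphic_on {s. Re s > 1 - real k - 1}" "\<And>s. Re s > 1 \<Longrightarrow> h s = (s - 1) * zeta_tail s"
    by (rule zeta_tail_step[OF g(1) _ g(2)]) auto
  moreover have "1 - real k - 1 = 1 - real (Suc k)" by simp
  ultimately show ?case by metis
qed

lemma zeta_tail_continuation:
  obtains g where "g holomorphic_on UNIV" "\<And>s. Re s > 1 \<Longrightarrow> g s = (s - 1) * zeta_tail s"
proof -
  obtain G where G: "\<And>k. G k holomorphic_on {s. Re s > 1 - real k}"
    "\<And>k s. Re s > 1 \<Longrightarrow> G k s = (s - 1) * zeta_tail s"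
    using zeta_tail_continuation_halfplane by metis
  have agree: "G k s = G l s" if "k \<le> l" "Re s > 1 - real k" for k l s
  proof (rule halfplane_identity[where c = 1 and f = "G k" and g = "G l" and a = "1 - real k"])
    show "G l holomorphic_on {s. Re s > 1 - real k}"
      by (rule holomorphic_on_subset[OF G(1)]) (use that in auto)
  qed (use G that in auto)
  \<comment> \<open>Any index whose half-plane contains \<open>s\<close> would do, because the
    continuations agree on overlaps; this one satisfies 1 - K s \<le> Re s - 1.\<close>
  define K where "K = (\<lambda>s. nat \<lceil>2 - Re s\<rceil>)"
  define g where "g = (\<lambda>s. G (K s) s)"
  have K: "Re s > 1 - real (K s)" for s unfolding K_def by linarith
  have geq: "g s = G l s" if "Re s > 1 - real l" for s l
    unfolding g_def
  proof (cases "K s \<le> l")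
    case True
    thus "G (K s) s = G l s" by (rule agree) (rule K)
  next
    case False
    hence "l \<le> K s" by simp
    from agree[OF this that] show "G (K s) s = G l s" by (rule sym)
  qed
  have "g holomorphic_on UNIV"
    unfolding holomorphic_on_open[OF open_UNIV]
  proof (intro ballI)
    fix s :: complex
    define l where "l = K s"
    have "(G l has_field_derivative deriv (G l) s) (at s)"
      using G(1)[of l] K[of s] by (intro holomorphic_derivI[OF G(1)]) (auto simp: l_def open_halfspace_Re_gt)
    hence "(g has_field_derivative deriv (G l) s) (at s)"
      by (rule has_field_derivative_transform_within_open[OF _ open_halfspace_Re_gt[of "1 - real l"]])
        (use K[of s] geq in \<open>auto simp: l_def\<close>)
    thus "\<exists>f'. (g has_field_derivative f') (at s)" by blast
  qed
  moreover have "g s = (s - 1) * zeta_tail s" if "Re s > 1" for s using G(2)[OF that] by (simp add: g_def)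
  ultimately show ?thesis using that by blast
qed

text \<open>The entire function (s - 1) (zeta s - 1). The choice is unique by the identity
  theorem.\<close>

definition zeta_tail_reg :: "complex \<Rightarrow> complex" where
  "zeta_tail_reg = (SOME g. g holomorphic_on UNIV \<and> (\<forall>s. Re s > 1 \<longrightarrow> g s = (s - 1) * zeta_tail s))"

lemma zeta_tail_reg: "zeta_tail_reg holomorphic_on UNIV" "Re s > 1 \<Longrightarrow> zeta_tail_reg s = (s - 1) * zeta_tail s"
proof -
  have "\<exists>g. g holomorphic_on UNIV \<and> (\<forall>s. Re s > 1 \<longrightarrow> g s = (s - 1) * zeta_tail s)"
    using zeta_tail_continuation by metis
  from someI_ex[OF this] show "zeta_tail_reg holomorphic_on UNIV" "Re s > 1 \<Longrightarrow> zeta_tail_reg s = (s - 1) * zeta_tail s"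
    unfolding zeta_tail_reg_def by auto
qed

text \<open>The function \<open>h\<close> produced by one continuation step obeys the recurrence on
  Re s > 0, and the identity theorem makes it \<open>zeta_tail_reg\<close>. This gives access to the
  point 1 and to signs on (0, 1], beyond the reach of the Dirichlet series.\<close>

lemma zeta_tail_reg_recurrence:
  assumes "Re s > 0"
  shows "(\<lambda>j. pochhammer (s-1) (Suc j) / fact (Suc (Suc j)) * zeta_tail_reg (s + of_nat (Suc j))) sums (1 - zeta_tail_reg s)"
proof -
  have hol: "zeta_tail_reg holomorphic_on S" for S by (rule holomorphic_on_subset[OF zeta_tail_reg(1)]) auto
  obtain h where h: "h holomorphic_on {s. Re s > 1 - 1}"
    "\<And>s. Re s > 1 - 1 \<Longrightarrow>
       (\<lambda>j. pochhammer (s-1) (Suc j) / fact (Suc (Suc j)) * zeta_tail_reg (s + of_nat (Suc j))) sums (1 - h s)"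
    "\<And>s. Re s > 1 \<Longrightarrow> h s = (s - 1) * zeta_tail s"
    by (rule zeta_tail_step[OF hol[of "{s. Re s > 1}"] order_refl zeta_tail_reg(2)]) auto
  have "h s = zeta_tail_reg s"
    by (rule halfplane_identity[where c = 1, OF h(1) hol]) (use h(3) zeta_tail_reg(2) assms in auto)
  thus ?thesis using h(2)[of s] assms by simp
qed

text \<open>The entire function (s - 1) zeta s: outside 1 it has the zeros of \<open>zeta\<close>,
  and no pole has to be treated apart.\<close>

definition zeta_reg :: "complex \<Rightarrow> complex" where
  "zeta_reg s = s - 1 + zeta_tail_reg s"

lemma zeta_reg_holomorphic: "zeta_reg holomorphic_on S"
  unfolding zeta_reg_def by (intro holomorphic_intros holomorphic_on_subset[OF zeta_tail_reg(1)]) auto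

lemma zeta_reg_eq: "Re s > 1 \<Longrightarrow> zeta_reg s = (s - 1) * (1 + zeta_tail s)"
  by (simp add: zeta_reg_def zeta_tail_reg algebra_simps)

text \<open>At s = 1 every rising factorial of s - 1 = 0 vanishes and the recurrence reads 1 -
  \<open>zeta_tail_reg 1\<close> = 0. The value is the residue of zeta at its pole.\<close>

lemma zeta_reg_1 [simp]: "zeta_reg 1 = 1"
proof -
  have "(\<lambda>j. 0) sums (1 - zeta_tail_reg 1)"
    using zeta_tail_reg_recurrence[of 1] by (simp add: pochhammer_0_left)
  thus ?thesis by (simp add: zeta_reg_def sums_iff)
qed

section \<open>Positivity on the positive real axis\<close>

lemma zeta_tail_real:
  assumes "x > (1::real)"
  obtains y where "zeta_tail (of_real x) = of_real y" "y > 0"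
proof -
  have sm: "(\<lambda>n. real (n+2) powr (-x)) sums (\<Sum>n. real (n+2) powr (-x))"
    by (intro summable_sums summable_powr_shift assms)
  have pos: "(\<Sum>n. real (n+2) powr (-x)) > 0"
    by (rule suminf_pos[OF sums_summable[OF sm]]) auto
  have eq: "(\<lambda>n. of_nat (n+2) powr (- complex_of_real x)) = (\<lambda>n. of_real (real (n+2) powr (-x)))"
    by (simp add: powr_Reals_eq)
  have "zeta_tail (of_real x) = of_real (\<Sum>n. real (n+2) powr (-x))"
    unfolding zeta_tail_def eq by (rule suminf_of_real[OF sums_summable[OF sm], symmetric])
  thus ?thesis using pos that by blast
qed

lemma zeta_tail_reg_real_gt_1:
  assumes "x > (1::real)"
  obtains y where "zeta_tail_reg (of_real x) = of_real y" "y > 0"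
proof -
  obtain y where y: "zeta_tail (of_real x) = of_real y" "y > 0" using zeta_tail_real[OF assms] .
  show ?thesis by (rule that[of "(x - 1) * y"]) (use y assms in \<open>auto simp: zeta_tail_reg\<close>)
qed

text \<open>For 0 < x \<le> 1 the rising factorials of x - 1 are at most 0, while
  \<open>zeta_tail_reg\<close> is positive to the right of 1. So the recurrence gives
  \<open>zeta_tail_reg\<close> \<ge> 1 and \<open>zeta_reg\<close> \<ge> x at x. Freedom from real
  zeros lets the logarithm be continued along the real segment.\<close>

lemma zeta_reg_real_pos:
  assumes "x > (0::real)"
  obtains y where "zeta_reg (of_real x) = of_real y" "y > 0"
proof (cases "x > 1")
  case True
  then obtain y where "zeta_tail_reg (of_real x) = of_real y" "y > 0" using zeta_tail_reg_real_gt_1 by blast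
  thus ?thesis using True that[of "x - 1 + y"] by (auto simp: zeta_reg_def)
next
  case False
  hence x1: "x \<le> 1" by simp
  define c where "c = (\<lambda>j. pochhammer (x-1) (Suc j) / fact (Suc (Suc j)) * Re (zeta_tail_reg (of_real (x + real (Suc j)))))"
  have t: "pochhammer (of_real x-1) (Suc j) / fact (Suc (Suc j)) * zeta_tail_reg (of_real x + of_nat (Suc j)) = of_real (c j)"
    and c: "c j \<le> 0" for j
  proof -
    have "x + real (Suc j) > 1" using assms by simp
    then obtain y where y: "zeta_tail_reg (of_real (x + real (Suc j))) = of_real y" "y > 0" using zeta_tail_reg_real_gt_1 by blast
    have "pochhammer (of_real x-1) (Suc j) = complex_of_real (pochhammer (x-1) (Suc j))"
      by (simp flip: pochhammer_of_real)
    thus "pochhammer (of_real x-1) (Suc j) / fact (Suc (Suc j)) * zeta_tail_reg (of_real x + of_nat (Suc j)) = of_real (c j)"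
      using y by (simp add: c_def del: fact_Suc)
    have "pochhammer (x-1) (Suc j) = (x - 1) * pochhammer x j" by (simp add: pochhammer_rec)
    also have "\<dots> \<le> 0" using x1 assms by (intro mult_nonpos_nonneg pochhammer_nonneg) auto
    finally show "c j \<le> 0" unfolding c_def using y by (intro mult_nonpos_nonneg divide_nonpos_nonneg) auto
  qed
  have "(\<lambda>j. of_real (c j)) sums (1 - zeta_tail_reg (of_real x))"
    using zeta_tail_reg_recurrence[of "of_real x"] assms t by (simp only: Re_complex_of_real)
  hence "c sums Re (1 - zeta_tail_reg (of_real x))" "(\<lambda>j. 0::real) sums Im (1 - zeta_tail_reg (of_real x))"
    by (auto simp: sums_complex_iff)
  hence s: "Re (1 - zeta_tail_reg (of_real x)) \<le> 0" "Im (zeta_tail_reg (of_real x)) = 0"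
    using c sums_le[of c "\<lambda>_. 0" _ 0] sums_zero by (auto simp: sums_iff)
  hence "zeta_tail_reg (of_real x) = of_real (Re (zeta_tail_reg (of_real x)))" by (simp add: complex_eq_iff)
  thus ?thesis using that[of "x - 1 + Re (zeta_tail_reg (of_real x))"] s assms by (simp add: zeta_reg_def)
qed

text \<open>The quotient of \<open>zeta_reg s\<close> by s - 1 is a witness for the description of
  \<open>zeta\<close>, so the choice operator returns a function with the described
  properties.\<close>

lemma zeta_spec: "zeta holomorphic_on (- {1})" "Re s > 1 \<Longrightarrow> (\<lambda>n. of_nat (Suc n) powr (- s)) sums zeta s"
proof -
  have "\<exists>f. f holomorphic_on (- {1}) \<and> (\<forall>s. Re s > 1 \<longrightarrow> (\<lambda>n. of_nat (Suc n) powr (- s)) sums f s)"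
  proof (intro exI[of _ "\<lambda>s. zeta_reg s / (s - 1)"] conjI allI impI)
    show "(\<lambda>s. zeta_reg s / (s - 1)) holomorphic_on - {1}"
      by (intro holomorphic_intros zeta_reg_holomorphic) auto
    fix s :: complex assume s: "Re s > 1"
    hence "s \<noteq> 1" by auto
    thus "(\<lambda>n. of_nat (Suc n) powr (- s)) sums (zeta_reg s / (s - 1))"
      using zeta_tail_sums(2)[OF s] zeta_reg_eq[OF s] by simp
  qed
  from someI_ex[OF this] show "zeta holomorphic_on (- {1})"
    "Re s > 1 \<Longrightarrow> (\<lambda>n. of_nat (Suc n) powr (- s)) sums zeta s"
    unfolding zeta_def by auto
qed

lemma zeta_eq_1_plus_tail: "Re s > 1 \<Longrightarrow> zeta s = 1 + zeta_tail s"
  using sums_unique2[OF zeta_spec(2) zeta_tail_sums(2)] by simp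

lemma zeta_reg_eq_zeta:
  assumes "s \<noteq> 1" shows "zeta_reg s = (s - 1) * zeta s"
proof (rule analytic_continuation_open[of "{s. Re s > 1}" "- {1}" zeta_reg "\<lambda>s. (s - 1) * zeta s"])
  show "{s. Re s > 1} \<noteq> {}" by (auto intro!: exI[of _ 2])
  show "connected (- {1::complex})" by (rule connected_punctured_universe) simp
  show "(\<lambda>s. (s - 1) * zeta s) holomorphic_on - {1}" by (intro holomorphic_intros zeta_spec(1))
  show "zeta_reg s = (s - 1) * zeta s" if "s \<in> {s. Re s > 1}" for s
    using that by (simp add: zeta_reg_eq zeta_eq_1_plus_tail)
qed (use assms in \<open>auto simp: open_halfspace_Re_gt intro!: zeta_reg_holomorphic\<close>)

section \<open>The logarithm of the zeta function\<close>

text \<open>The coefficients of log zeta: 1 / k at a prime power p ^ k with k > 0, and 0 elsewhere.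
  At 0 and 1 the numerator vanishes.\<close>

definition mcoef :: "nat \<Rightarrow> real" where
  "mcoef n = mangoldt n / ln (real n)"

lemma mcoef_0 [simp]: "mcoef 0 = 0" and mcoef_1 [simp]: "mcoef (Suc 0) = 0"
  by (simp_all add: mcoef_def)

lemma mcoef_nonneg: "mcoef n \<ge> 0"
  unfolding mcoef_def by (cases "n = 0") (auto intro!: divide_nonneg_nonneg mangoldt_nonneg)

lemma mcoef_le_1: "mcoef n \<le> 1"
proof (cases "n \<le> 1")
  case True
  hence "n = 0 \<or> n = Suc 0" by auto
  thus ?thesis by auto
next
  case False
  hence "ln (real n) > 0" by simp
  thus ?thesis using mangoldt_le[of n] False by (simp add: mcoef_def field_simps)
qed

lemma mcoef_mult_ln: "mcoef n * ln (real n) = mangoldt n"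
proof (cases "n \<le> 1")
  case True
  hence "n = 0 \<or> n = Suc 0" by auto
  thus ?thesis by auto
next
  case False
  hence "ln (real n) > 0" by simp
  thus ?thesis by (simp add: mcoef_def)
qed

lemma mcoef_prime_power:
  assumes "prime p" "k > 0" shows "mcoef (p ^ k) = 1 / real k"
proof -
  have "ln (real p) > 0" using prime_gt_1_nat[OF assms(1)] by simp
  thus ?thesis using assms prime_gt_0_nat[OF assms(1)]
    by (simp add: mcoef_def mangoldt_primepow ln_realpow field_simps)
qed

text \<open>Both sides are the unordered sum over pairs (d, e) of positive integers, taken by rows
  or grouped by the product d e. The index 0 is left out because every number divides 0.\<close>

lemma has_sum_dirichlet_product:
  fixes f g :: "nat \<Rightarrow> complex"
  assumes f: "summable (\<lambda>n. norm (f n))" "f sums F" "f 0 = 0"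
    and g: "summable (\<lambda>n. norm (g n))" "g sums G" "g 0 = 0"
  shows "((\<lambda>n. \<Sum>d | d dvd n. f d * g (n div d)) has_sum (F * G)) {0<..}"
proof -
  have fs: "(f has_sum F) {0<..}" and gs: "(g has_sum G) {0<..}"
    using norm_summable_imp_has_sum[OF f(1,2)] norm_summable_imp_has_sum[OF g(1,2)] f(3) g(3)
      has_sum_cong_neutral[of "{0<..}" UNIV f f F] has_sum_cong_neutral[of "{0<..}" UNIV g g G] by auto
  have nf: "(\<lambda>n. norm (f n)) summable_on {0<..}" and ng: "(\<lambda>n. norm (g n)) summable_on {0<..}"
    using f(1) g(1) by (auto intro!: summable_on_subset_banach[of _ UNIV] norm_summable_imp_summable_on)
  have "(\<lambda>(d,e). norm (f d) * norm (g e)) summable_on {0<..} \<times> {0<..}"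
  proof (rule summable_on_SigmaI[where g = "\<lambda>d. norm (f d) * infsum (\<lambda>e. norm (g e)) {0<..}"])
    fix d show "((\<lambda>e. case (d, e) of (d, e) \<Rightarrow> norm (f d) * norm (g e)) has_sum norm (f d) * infsum (\<lambda>e. norm (g e)) {0<..}) {0<..}"
      using ng by (auto intro!: has_sum_cmult_right has_sum_infsum)
  qed (use nf in \<open>auto intro!: summable_on_cmult_left\<close>)
  hence "(\<lambda>p. norm (case p of (d,e) \<Rightarrow> f d * g e)) summable_on {0<..} \<times> {0<..}"
    by (simp add: case_prod_unfold norm_mult)
  hence sm: "(\<lambda>(d,e). f d * g e) summable_on {0<..} \<times> {0<..}" by (rule abs_summable_summable)
  then obtain S where S: "((\<lambda>(d,e). f d * g e) has_sum S) ({0<..} \<times> {0<..})"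
    by (auto simp: summable_on_def)
  have "((\<lambda>d. f d * G) has_sum S) {0<..}"
    by (rule has_sum_SigmaD[OF S]) (auto intro!: has_sum_cmult_right gs)
  moreover have "((\<lambda>d. f d * G) has_sum (F * G)) {0<..}"
    by (rule has_sum_cmult_left[OF fs])
  ultimately have SFG: "S = F * G" by (rule has_sum_unique)
  have "((\<lambda>(n,d). f d * g (n div d)) has_sum S) (SIGMA n:{0<..}. {d. d dvd n}) \<longleftrightarrow>
        ((\<lambda>(d,e). f d * g e) has_sum S) ({0<..} \<times> {0<..})"
    by (rule has_sum_reindex_bij_witness[of _ "\<lambda>(d,e). (d*e,d)" "\<lambda>(n,d). (d, n div d)"])
       (auto intro!: Nat.gr0I simp: dvd_div_eq_0_iff dest: dvd_pos_nat)
  with S have "((\<lambda>(n,d). f d * g (n div d)) has_sum S) (SIGMA n:{0<..}. {d. d dvd n})" by simp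
  from has_sum_SigmaD[OF this, of "\<lambda>n. \<Sum>d | d dvd n. f d * g (n div d)"]
  show ?thesis unfolding SFG by (auto intro!: has_sum_finite)
qed

text \<open>Summing the von Mangoldt function over divisors gives ln, hence zeta' = L' zeta and zeta
  * exp (- L) is constant on the half-plane. Letting s run to infinity through the integers shows
  that the constant is 1.\<close>

lemma log_zeta:
  obtains L L' where
    "\<And>s. Re s > 1 \<Longrightarrow> (\<lambda>n. of_real (mcoef n) * of_nat n powr (-s)) sums L s"
    "\<And>s. Re s > 1 \<Longrightarrow> (\<lambda>n. of_real (mangoldt n) * of_nat n powr (-s)) sums (- L' s)"
    "\<And>s. Re s > 1 \<Longrightarrow> (L has_field_derivative L' s) (at s)"
    "\<And>s. Re s > 1 \<Longrightarrow> zeta s = exp (L s)"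
proof -
  have "\<And>n. norm (complex_of_real (mcoef (Suc n))) \<le> 1"
    using mcoef_nonneg mcoef_le_1 by simp
  note bound = this
  obtain L L' where L0: "\<And>s. Re s > 1 \<Longrightarrow> (\<lambda>n. complex_of_real (mcoef (Suc n)) * of_nat (Suc n) powr (-s)) sums L s"
    "\<And>s. Re s > 1 \<Longrightarrow> (\<lambda>n. - (complex_of_real (mcoef (Suc n)) * of_real (ln (real (Suc n))) * of_nat (Suc n) powr (-s))) sums L' s"
    "\<And>s. Re s > 1 \<Longrightarrow> (L has_field_derivative L' s) (at s)"
    by (rule dirichlet_series_has_derivative[of "\<lambda>n. of_real (mcoef (Suc n))", OF bound]) (rule that, assumption+)
  have L1: "(\<lambda>n. of_real (mcoef n) * of_nat n powr (-s)) sums L s" if "Re s > 1" for s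
    using L0(1)[OF that] by (subst (asm) sums_Suc_iff) simp
  have L2: "(\<lambda>n. of_real (mangoldt n) * of_nat n powr (-s)) sums (- L' s)" if "Re s > 1" for s
  proof -
    have "(\<lambda>n. complex_of_real (mcoef (Suc n) * ln (real (Suc n))) * of_nat (Suc n) powr (-s)) sums (- L' s)"
      using sums_minus[OF L0(2)[OF that]] by (simp del: of_nat_Suc)
    thus ?thesis unfolding mcoef_mult_ln by (subst (asm) sums_Suc_iff) simp
  qed
  obtain g g' where g0: "\<And>s. Re s > 1 \<Longrightarrow> (\<lambda>n. 1 * complex_of_nat (Suc n) powr (-s)) sums g s"
    "\<And>s. Re s > 1 \<Longrightarrow> (\<lambda>n. - (1 * of_real (ln (real (Suc n))) * complex_of_nat (Suc n) powr (-s))) sums g' s"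
    "\<And>s. Re s > 1 \<Longrightarrow> (g has_field_derivative g' s) (at s)"
    by (rule dirichlet_series_has_derivative[of "\<lambda>n. 1"], simp, rule that, assumption+)
  have gz: "g s = zeta s" if "Re s > 1" for s
    using sums_unique2[OF g0(1)[OF that]] zeta_spec(2)[OF that] by simp
  have g1: "(\<lambda>n. of_nat n powr (-s)) sums g s" if "Re s > 1" for s
    using g0(1)[OF that] by (simp del: of_nat_Suc) (subst (asm) sums_Suc_iff, simp)
  have g2: "(\<lambda>n. of_real (ln (real n)) * of_nat n powr (-s)) sums (- g' s)" if "Re s > 1" for s
    using sums_minus[OF g0(2)[OF that]] by (simp del: of_nat_Suc) (subst (asm) sums_Suc_iff, simp)
  have deriv_eq: "g' s = L' s * g s" if s: "Re s > 1" for s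
  proof -
    have s': "Re (of_real (Re s)) > 1" using s by simp
    have n1: "summable (\<lambda>n. norm (of_nat n powr (-s)))"
    proof -
      have "summable (\<lambda>n. real n powr (- Re s))" using s by (subst summable_real_powr_iff) auto
      moreover have "(\<lambda>n. norm (of_nat n powr (-s))) = (\<lambda>n. real n powr (- Re s))"
        by (auto simp: norm_powr_real_powr)
      ultimately show ?thesis by simp
    qed
    \<comment> \<open>The norms are the terms of the same series at the real point Re s, where all
      terms are nonnegative and convergence is absolute.\<close>
    have n2: "summable (\<lambda>n. norm (of_real (mangoldt n) * of_nat n powr (-s)))"
    proof -
      have "(\<lambda>n. of_real (mangoldt n) * of_nat n powr (- of_real (Re s))) sums (- L' (of_real (Re s)))"
        by (rule L2[OF s'])
      moreover have "of_real (mangoldt n) * of_nat n powr (- of_real (Re s)) = complex_of_real (mangoldt n * real n powr (- Re s))" for n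
        by (simp add: powr_Reals_eq)
      ultimately have "summable (\<lambda>n. complex_of_real (mangoldt n * real n powr (- Re s)))" by (simp only: sums_iff)
      hence "summable (\<lambda>n. mangoldt n * real n powr (- Re s))" by (simp only: summable_of_real_iff)
      moreover have "(\<lambda>n. norm (of_real (mangoldt n) * complex_of_nat n powr (-s))) = (\<lambda>n. mangoldt n * real n powr (- Re s))"
        by (auto simp: norm_mult norm_powr_real_powr mangoldt_nonneg)
      ultimately show ?thesis by simp
    qed
    let ?t = "\<lambda>n d. (of_real (mangoldt d) * of_nat d powr (-s)) * of_nat (n div d) powr (-s)"
    have "((\<lambda>n. \<Sum>d | d dvd n. ?t n d) has_sum (- L' s * g s)) {0<..}"
      by (rule has_sum_dirichlet_product[OF n2 L2[OF s] _ n1 g1[OF s]]) auto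
    also have "?this \<longleftrightarrow> ((\<lambda>n. of_real (ln (real n)) * of_nat n powr (-s)) has_sum (- L' s * g s)) {0<..}"
    proof (rule has_sum_cong)
      fix n :: nat assume n: "n \<in> {0<..}"
      have "(\<Sum>d | d dvd n. ?t n d) =
            (\<Sum>d | d dvd n. of_real (mangoldt d) * of_nat n powr (-s))"
      proof (rule sum.cong[OF refl])
        fix d assume "d \<in> {d. d dvd n}"
        then obtain e where e: "n = d * e" by auto
        have "of_nat n powr (-s) = (of_nat d powr (-s)) * (of_nat e powr (-s) :: complex)"
          unfolding e of_nat_mult by (rule powr_times_real_left) auto
        thus "?t n d = of_real (mangoldt d) * of_nat n powr (-s)"
          using e n by auto
      qed
      also have "\<dots> = of_real (\<Sum>d | d dvd n. mangoldt d) * of_nat n powr (-s)"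
        by (simp add: sum_distrib_right)
      also have "(\<Sum>d | d dvd n. mangoldt d :: real) = ln (real n)" using mangoldt_sum[of n, where ?'a = real] n by simp
      finally show "(\<Sum>d | d dvd n. ?t n d) =
         of_real (ln (real n)) * of_nat n powr (-s)" .
    qed
    also have "\<dots> \<longleftrightarrow> ((\<lambda>n. of_real (ln (real n)) * of_nat n powr (-s)) has_sum (- L' s * g s)) UNIV"
      by (rule has_sum_cong_neutral) auto
    finally have "(\<lambda>n. of_real (ln (real n)) * of_nat n powr (-s)) sums (- L' s * g s)"
      by (rule has_sum_imp_sums)
    with g2[OF s] have "- g' s = - L' s * g s" by (rule sums_unique2)
    thus ?thesis by simp
  qed
  have "\<exists>c. \<forall>s\<in>{s. Re s > 1}. g s * exp (- L s) = c"
  proof (rule has_field_derivative_zero_constant)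
    show "convex {s. Re s > 1}" by (rule convex_halfspace_Re_gt)
    fix s assume "s \<in> {s. Re s > 1}"
    hence s: "Re s > 1" by simp
    have "((\<lambda>s. g s * exp (- L s)) has_field_derivative 0) (at s)"
      by (rule derivative_eq_intros g0(3)[OF s] L0(3)[OF s] refl)+ (simp add: deriv_eq[OF s])
    thus "((\<lambda>s. g s * exp (- L s)) has_field_derivative 0) (at s within {s. Re s > 1})"
      by (rule has_field_derivative_at_within)
  qed
  then obtain c where c: "\<And>s. Re s > 1 \<Longrightarrow> g s * exp (- L s) = c" by auto
  obtain C where C: "C \<ge> 0" "\<And>s. Re s \<ge> 2 \<Longrightarrow> norm (zeta_tail s) \<le> C * 2 powr (- Re s)"
    using zeta_tail_bound by blast
  have C0: "(\<lambda>n. C * 2 powr (- real n)) \<longlonglongrightarrow> 0"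
    by (intro tendsto_mult_right_zero) real_asymp
  have "(\<lambda>n. zeta_tail (of_nat n)) \<longlonglongrightarrow> 0"
    by (rule Lim_null_comparison[OF _ C0]) (use C(2)[of "of_nat _"] in \<open>auto intro!: eventually_sequentiallyI[of 2]\<close>)
  moreover have "\<forall>\<^sub>F n in sequentially. g (of_nat n) = 1 + zeta_tail (of_nat n)"
    by (rule eventually_sequentiallyI[of 2]) (auto simp: gz zeta_eq_1_plus_tail)
  ultimately have lim1: "(\<lambda>n. g (of_nat n)) \<longlonglongrightarrow> 1"
    using tendsto_add[of "\<lambda>_. 1" 1 sequentially "\<lambda>n. zeta_tail (of_nat n)" 0] by (simp add: tendsto_cong)
  \<comment> \<open>\<open>mcoef\<close> is at most 1 and vanishes at 0 and 1, so \<open>L\<close>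
    is dominated by \<open>zeta_tail\<close> and tends to 0 with it.\<close>
  have Lb: "norm (L (of_nat n)) \<le> C * 2 powr (- real n)" if n: "n \<ge> 2" for n
  proof -
    have n1: "Re (of_nat n) > 1" using n by simp
    define x where "x = real n"
    have sl: "(\<lambda>k. of_real (mcoef k) * of_nat k powr (-of_nat n)) sums L (of_nat n)" by (rule L1[OF n1])
    have eq: "complex_of_nat k powr (- of_nat n) = of_real (real k powr (-x))" for k
      by (simp add: x_def powr_Reals_eq)
    have "(\<lambda>k. of_nat (k+2) powr (- of_nat n)) sums zeta_tail (of_nat n)" by (rule zeta_tail_sums(1)[OF n1])
    hence zt: "(\<lambda>k. of_real (real (k+2) powr (-x))) sums zeta_tail (of_nat n)" by (simp only: eq)
    have "(\<lambda>k. of_real (mcoef (k + 2)) * of_nat (k + 2) powr (- of_nat n)) sums L (of_nat n)"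
      using sl by (subst sums_iff_shift) (simp add: numeral_2_eq_2)
    hence l: "(\<lambda>k. of_real (mcoef (k + 2) * real (k+2) powr (-x))) sums L (of_nat n)" by (simp only: eq of_real_mult)
    have "summable (\<lambda>k. complex_of_real (real (k+2) powr (-x)))" using zt by (rule sums_summable)
    hence sm: "summable (\<lambda>k. (real (k+2) powr (-x)))" by (simp only: summable_of_real_iff)
    have zt': "zeta_tail (of_nat n) = of_real (\<Sum>k. real (k+2) powr (-x))"
      using sums_unique2[OF zt sums_of_real[OF summable_sums[OF sm]]] .
    have nn: "(\<Sum>k. real (k+2) powr (-x)) \<ge> 0" by (rule suminf_nonneg[OF sm]) simp
    have le: "norm (complex_of_real (mcoef (k + 2) * real (k+2) powr (-x))) \<le> real (k+2) powr (-x)" for k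
      using mcoef_nonneg[of "k+2"] mcoef_le_1[of "k+2"]
      by (simp only: norm_of_real abs_mult abs_of_nonneg powr_ge_zero mult_left_le_one_le)
    have "norm (L (of_nat n)) \<le> (\<Sum>k. real (k+2) powr (-x))"
      unfolding sums_unique[OF l] by (rule norm_suminf_le[OF le sm])
    also have "\<dots> = norm (zeta_tail (of_nat n))" unfolding zt' using nn by (simp only: norm_of_real abs_of_nonneg)
    also have "\<dots> \<le> C * 2 powr (- Re (of_nat n))" by (rule C(2)) (use n in auto)
    finally show ?thesis by simp
  qed
  have "(\<lambda>n. L (of_nat n)) \<longlonglongrightarrow> 0"
    by (rule Lim_null_comparison[OF _ C0]) (use Lb in \<open>auto intro!: eventually_sequentiallyI[of 2]\<close>)
  hence "(\<lambda>n. g (of_nat n) * exp (- L (of_nat n))) \<longlonglongrightarrow> 1 * exp (- 0)"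
    by (intro tendsto_intros lim1)
  moreover have "\<forall>\<^sub>F n in sequentially. g (of_nat n) * exp (- L (of_nat n)) = c"
    by (rule eventually_sequentiallyI[of 2]) (auto intro!: c)
  hence "(\<lambda>n. g (of_nat n) * exp (- L (of_nat n))) \<longlonglongrightarrow> c" by (rule tendsto_eventually)
  ultimately have "c = 1" using LIMSEQ_unique by fastforce
  hence "zeta s = exp (L s)" if "Re s > 1" for s
    using c[OF that] gz[OF that] by (simp add: exp_minus field_simps)
  thus ?thesis using that L1 L2 L0(3) by blast
qed

section \<open>Laplace transforms and Landau's theorem\<close>

text \<open>The expansion on the small disc determines the coefficients, which are then the Taylor
  coefficients of \<open>h\<close>, and the Taylor series converges on the whole disc of holomorphy.
  In Landau's theorem \<open>r\<close> comes from the transform and \<open>R\<close> from its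
  continuation.\<close>

lemma power_series_eq_taylor:
  fixes h :: "complex \<Rightarrow> complex"
  assumes hol: "h holomorphic_on ball 0 R" and r: "0 < r" "r \<le> R"
    and sums: "\<And>z. norm z < r \<Longrightarrow> (\<lambda>n. c n * z ^ n) sums h z"
    and w: "norm w < R"
  shows "(\<lambda>n. c n * w ^ n) sums h w"
proof -
  define F where "F = Abs_fps c"
  have "h has_fps_expansion F"
    unfolding has_fps_expansion_def
  proof
    have "conv_radius c \<ge> norm (complex_of_real (r/2))"
      by (rule conv_radius_geI) (use sums[of "of_real (r/2)"] r in \<open>auto simp: sums_iff\<close>)
    moreover have "norm (complex_of_real (r/2)) = r / 2" using r by simp
    ultimately have "conv_radius c \<ge> ereal (r/2)" by simp
    moreover have "ereal (r/2) > 0" using r by simp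
    ultimately have "conv_radius c > 0" by (rule order_less_le_trans[rotated])
    thus "fps_conv_radius F > 0" by (simp add: F_def fps_conv_radius_def)
    have "eventually (\<lambda>z. z \<in> ball 0 r) (nhds (0::complex))"
      using r by (intro eventually_nhds_in_open) auto
    thus "eventually (\<lambda>z. eval_fps F z = h z) (nhds 0)"
      by eventually_elim (use sums in \<open>auto simp: eval_fps_def F_def sums_iff\<close>)
  qed
  hence c: "c n = (deriv ^^ n) h 0 / fact n" for n
    using fps_nth_fps_expansion[of h F n] by (simp add: F_def)
  show ?thesis using holomorphic_power_series[OF hol, of w] w by (simp add: c)
qed

text \<open>Lebesgue integrability, hence absolute convergence. The integral runs over the whole
  line; functions in the locale below vanish for t < 0.\<close>

definition laplace_conv :: "(real \<Rightarrow> real) \<Rightarrow> real \<Rightarrow> bool" where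
  "laplace_conv g a \<longleftrightarrow> integrable lborel (\<lambda>t. g t * exp (- a * t))"

definition laplace :: "(real \<Rightarrow> real) \<Rightarrow> complex \<Rightarrow> complex" where
  "laplace g s = (\<integral>t. of_real (g t) * exp (- s * of_real t) \<partial>lborel)"

locale laplace_fun =
  fixes g :: "real \<Rightarrow> real"
  assumes meas [measurable]: "g \<in> borel_measurable borel"
    and supp: "t < 0 \<Longrightarrow> g t = 0"
begin

lemma laplace_conv_mono:
  assumes "laplace_conv g a" "a \<le> b"
  shows "laplace_conv g b"
  unfolding laplace_conv_def
proof (rule Bochner_Integration.integrable_bound)
  show "integrable lborel (\<lambda>t. g t * exp (- a * t))" using assms by (simp add: laplace_conv_def)
  show "AE t in lborel. norm (g t * exp (- b * t)) \<le> norm (g t * exp (- a * t))"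
  proof (rule AE_I2)
    fix t show "norm (g t * exp (- b * t)) \<le> norm (g t * exp (- a * t))"
      using supp[of t] assms(2) by (cases "t < 0") (auto simp: abs_mult intro!: mult_left_mono mult_right_mono)
  qed
qed measurable

text \<open>On the bounded part of the support any two exponential weights are comparable, so only
  large t decides convergence.\<close>

lemma laplace_conv_truncate:
  assumes "laplace_conv g a"
  shows "laplace_conv (\<lambda>t. indicator {..<T} t * g t) x"
  unfolding laplace_conv_def
proof (rule Bochner_Integration.integrable_bound)
  show "integrable lborel (\<lambda>t. exp (\<bar>a - x\<bar> * \<bar>T\<bar>) * (g t * exp (- a * t)))"
    using assms by (simp add: laplace_conv_def)
  show "AE t in lborel. norm (indicator {..<T} t * g t * exp (- x * t)) \<le> norm (exp (\<bar>a - x\<bar> * \<bar>T\<bar>) * (g t * exp (- a * t)))"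
  proof (rule AE_I2)
    fix t
    show "norm (indicator {..<T} t * g t * exp (- x * t)) \<le> norm (exp (\<bar>a - x\<bar> * \<bar>T\<bar>) * (g t * exp (- a * t)))"
    proof (cases "0 \<le> t \<and> t < T")
      case True
      have "(a - x) * t \<le> \<bar>a - x\<bar> * \<bar>T\<bar>" using True by (intro mult_mono) auto
      hence "exp (- x * t) \<le> exp (\<bar>a - x\<bar> * \<bar>T\<bar>) * exp (- a * t)" by (simp add: algebra_simps flip: exp_add)
      from mult_left_mono[OF this, of "\<bar>g t\<bar>"] show ?thesis using True by (simp add: abs_mult mult_ac)
    qed (use supp in auto)
  qed
qed measurable

text \<open>Expand exp (z t) with z = a - s under the integral. The majorant exp (- a t) exp (|z| t)
  is at most exp (- \<sigma> t) on the closed disc, which justifies the interchange. Powers of a - s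
  instead of s - a make the coefficients moments without alternating signs.\<close>

lemma laplace_power_series:
  fixes a \<sigma> :: real and s :: complex
  defines "c \<equiv> (\<lambda>k. \<integral>t. g t * exp (- a * t) * t ^ k / fact k \<partial>lborel)"
  assumes conv: "laplace_conv g \<sigma>" and s: "norm (of_real a - s) \<le> a - \<sigma>"
  shows "(\<lambda>k. of_real (c k) * (of_real a - s) ^ k) sums laplace g s"
proof -
  define z where "z = of_real a - s"
  define r where "r = norm z"
  have r: "r \<ge> 0" "r \<le> a - \<sigma>" using s by (auto simp: r_def z_def)
  define f where "f = (\<lambda>k t. (complex_of_real (g t * exp (- a * t) * t ^ k / fact k)) * z ^ k)"
  have nf: "norm (f k t) = \<bar>g t\<bar> * exp (- a * t) * ((\<bar>t\<bar> * r) ^ k / fact k)" for k t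
    unfolding f_def norm_mult norm_of_real by (simp add: abs_mult norm_power r_def power_mult_distrib power_abs)
  let ?d = "\<lambda>t. \<bar>g t\<bar> * exp (- a * t) * exp (\<bar>t\<bar> * r)"
  have exps: "(\<lambda>k. \<bar>g t\<bar> * exp (- a * t) * ((\<bar>t\<bar> * r) ^ k / fact k)) sums (?d t)" for t
    using sums_mult[OF exp_converges[of "\<bar>t\<bar> * r"], of "\<bar>g t\<bar> * exp (- a * t)"]
    by (simp add: scaleR_conv_of_real divide_inverse mult_ac)
  have int_s: "integrable lborel (\<lambda>t. ?d t)"
  proof (rule Bochner_Integration.integrable_bound)
    show "integrable lborel (\<lambda>t. g t * exp (- \<sigma> * t))" using conv by (simp add: laplace_conv_def)
    show "AE t in lborel. norm (?d t) \<le> norm (g t * exp (- \<sigma> * t))"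
    proof (rule AE_I2)
      fix t show "norm (?d t) \<le> norm (g t * exp (- \<sigma> * t))"
      proof (cases "t < 0")
        case False
        have "t * r \<le> t * (a - \<sigma>)" using r False by (intro mult_left_mono) auto
        hence "exp (- a * t) * exp (\<bar>t\<bar> * r) \<le> exp (- \<sigma> * t)"
          using False by (subst exp_add[symmetric]) (auto simp: algebra_simps)
        from mult_left_mono[OF this, of "\<bar>g t\<bar>"] show ?thesis by (simp add: abs_mult mult_ac)
      qed (use supp in auto)
    qed
  qed measurable
  have fm [measurable]: "f k \<in> borel_measurable borel" for k
    unfolding f_def by measurable
  have int_f: "integrable lborel (f k)" for k
  proof (rule Bochner_Integration.integrable_bound[OF int_s])
    show "AE t in lborel. norm (f k t) \<le> norm (?d t)"
    proof (rule AE_I2)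
      fix t
      have "\<bar>g t\<bar> * exp (- a * t) * ((\<bar>t\<bar> * r) ^ k / fact k) \<le> ?d t"
        using sum_le_suminf[OF sums_summable[OF exps[of t]], of "{k}"] sums_unique[OF exps[of t]] r by simp
      thus "norm (f k t) \<le> norm (?d t)" unfolding nf by simp
    qed
  qed measurable
  have sm_t: "summable (\<lambda>k. norm (f k t))" for t
    unfolding nf using exps[of t] by (rule sums_summable)
  have sm_i: "summable (\<lambda>k. \<integral>t. norm (f k t) \<partial>lborel)"
  proof (rule summableI_nonneg_bounded)
    fix n
    have "(\<Sum>k<n. \<integral>t. norm (f k t) \<partial>lborel) = (\<integral>t. (\<Sum>k<n. norm (f k t)) \<partial>lborel)"
      by (subst Bochner_Integration.integral_sum) (use int_f in auto)
    also have "\<dots> \<le> (\<integral>t. ?d t \<partial>lborel)"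
    proof (rule integral_mono[OF _ int_s])
      show "integrable lborel (\<lambda>t. \<Sum>k<n. norm (f k t))" using int_f by auto
      fix t
      show "(\<Sum>k<n. norm (f k t)) \<le> ?d t"
        using sum_le_suminf[OF sm_t[of t], of "{..<n}"] sums_unique[OF exps[of t]] r unfolding nf by simp
    qed
    finally show "(\<Sum>k<n. \<integral>t. norm (f k t) \<partial>lborel) \<le> (\<integral>t. ?d t \<partial>lborel)" .
  qed auto
  have "(\<lambda>k. integral\<^sup>L lborel (f k)) sums (\<integral>t. (\<Sum>k. f k t) \<partial>lborel)"
    by (rule sums_integral[OF int_f _ sm_i]) (use sm_t in auto)
  also have "(\<lambda>t. (\<Sum>k. f k t)) = (\<lambda>t. of_real (g t) * exp (- s * of_real t))"
  proof
    fix t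
    have "(\<lambda>k. complex_of_real (g t * exp (- a * t)) * ((of_real t * z) ^ k /\<^sub>R fact k)) sums
       (complex_of_real (g t * exp (- a * t)) * exp (of_real t * z))"
      by (intro sums_mult exp_converges)
    also have "(\<lambda>k. complex_of_real (g t * exp (- a * t)) * ((of_real t * z) ^ k /\<^sub>R fact k)) = (\<lambda>k. f k t)"
      by (auto simp: f_def power_mult_distrib scaleR_conv_of_real divide_inverse mult_ac)
    also have "complex_of_real (g t * exp (- a * t)) * exp (of_real t * z) = of_real (g t) * exp (- s * of_real t)"
    proof -
      have "complex_of_real (exp (- a * t)) * exp (of_real t * z) = exp (- s * of_real t)"
        by (subst exp_of_real[symmetric], subst exp_add[symmetric]) (simp add: z_def algebra_simps)
      thus ?thesis by simp
    qed
    finally show "(\<Sum>k. f k t) = of_real (g t) * exp (- s * of_real t)" by (simp add: sums_iff)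
  qed
  also have "(\<lambda>k. integral\<^sup>L lborel (f k)) = (\<lambda>k. of_real (c k) * z ^ k)"
    unfolding f_def c_def by (subst integral_mult_left_zero) (simp only: integral_complex_of_real)
  finally show ?thesis unfolding laplace_def z_def .
qed

text \<open>With r = a - \<sigma>, the single term (r t) ^ k / k! of the exponential series is at
  most exp (r t), so the power of t is paid for by the gap between \<sigma> and a.\<close>

lemma laplace_moment_integrable:
  assumes "laplace_conv g \<sigma>" "\<sigma> < a"
  shows "integrable lborel (\<lambda>t. g t * exp (- a * t) * t ^ k)"
proof (rule Bochner_Integration.integrable_bound)
  define r where "r = a - \<sigma>"
  have r: "r > 0" using assms by (simp add: r_def)
  show "integrable lborel (\<lambda>t. fact k / r ^ k * (g t * exp (- \<sigma> * t)))"
    using assms by (simp add: laplace_conv_def)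
  show "AE t in lborel. norm (g t * exp (- a * t) * t ^ k) \<le> norm (fact k / r ^ k * (g t * exp (- \<sigma> * t)))"
  proof (rule AE_I2)
    fix t show "norm (g t * exp (- a * t) * t ^ k) \<le> norm (fact k / r ^ k * (g t * exp (- \<sigma> * t)))"
    proof (cases "t < 0")
      case False
      have "(t * r) ^ k / fact k \<le> exp (t * r)"
        using False r sum_le_suminf[OF summable_exp_generic[of "t * r"], of "{k}"]
        by (simp add: exp_def divide_inverse mult_ac)
      hence "t ^ k \<le> fact k / r ^ k * exp (t * r)"
        using r by (simp add: power_mult_distrib field_simps)
      hence "exp (- a * t) * t ^ k \<le> exp (- a * t) * (fact k / r ^ k * exp (t * r))"
        by (intro mult_left_mono) auto
      also have "\<dots> = fact k / r ^ k * exp (- \<sigma> * t)"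
        by (simp add: r_def algebra_simps flip: exp_add)
      finally have "exp (- a * t) * t ^ k \<le> fact k / r ^ k * exp (- \<sigma> * t)" .
      from mult_left_mono[OF this, of "\<bar>g t\<bar>"] show ?thesis using False r by (simp add: abs_mult mult_ac)
    qed (use supp in auto)
  qed
qed measurable

text \<open>The half-plane is covered by discs centred on the real axis on which the transform is a
  power series: for large \<open>a\<close> the disc about \<open>a\<close> of radius a - \<tau>
  reaches a given s.\<close>

lemma laplace_holomorphic:
  assumes conv: "\<And>x. x > \<sigma> \<Longrightarrow> laplace_conv g x"
  shows "laplace g holomorphic_on {s. Re s > \<sigma>}"
proof -
  have "\<exists>e>0. laplace g holomorphic_on ball s e" if s: "Re s > \<sigma>" for s
  proof -
    define \<tau> where "\<tau> = (\<sigma> + Re s) / 2"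
    have \<tau>: "\<sigma> < \<tau>" "\<tau> < Re s" using s by (auto simp: \<tau>_def)
    \<comment> \<open>The point s lies in the disc exactly if (Im s)^2 < (Re s - \<tau>) (2 a -
      \<tau> - Re s); \<open>q\<close> serves to solve this for \<open>a\<close>.\<close>
    define q where "q = (Im s)\<^sup>2 / (Re s - \<tau>)"
    define a where "a = (q + \<tau> + Re s) / 2 + 1"
    have "q < 2 * a - \<tau> - Re s" by (simp add: a_def field_simps)
    hence im: "(Im s)\<^sup>2 < (Re s - \<tau>) * (2 * a - \<tau> - Re s)" using \<tau> by (simp add: q_def divide_less_eq mult_ac)
    have a: "a > \<tau>"
    proof -
      have "q \<ge> 0" unfolding q_def using \<tau> by simp
      thus ?thesis using \<tau> by (simp add: a_def field_simps)
    qed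
    have "(norm (of_real a - s))\<^sup>2 = (a - Re s)\<^sup>2 + (Im s)\<^sup>2" by (simp add: cmod_power2)
    also have "\<dots> < (a - \<tau>)\<^sup>2" using im by (simp add: power2_eq_square algebra_simps)
    finally have "norm (of_real a - s) < a - \<tau>" using a by (simp add: power2_less_imp_less)
    hence sb: "s \<in> ball (of_real a) (a - \<tau>)" by (simp add: dist_norm)
    have hb: "laplace g holomorphic_on ball (of_real a) (a - \<tau>)"
    proof (rule power_series_holomorphic)
      fix w :: complex assume "w \<in> ball (of_real a) (a - \<tau>)"
      hence w: "norm (of_real a - w) \<le> a - \<tau>" by (simp add: dist_norm)
      define c where "c = (\<lambda>k. \<integral>t. g t * exp (- a * t) * t ^ k / fact k \<partial>lborel)"
      have "(\<lambda>k. of_real (c k) * (of_real a - w) ^ k) sums laplace g w"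
        unfolding c_def by (rule laplace_power_series[OF conv[OF \<tau>(1)] w])
      moreover have "(of_real a - w) ^ k = (-1) ^ k * (w - of_real a) ^ k" for k
        by (subst power_mult_distrib[symmetric]) simp
      ultimately show "(\<lambda>k. (of_real (\<integral>t. g t * exp (- a * t) * t ^ k / fact k \<partial>lborel) * (-1) ^ k) * (w - of_real a) ^ k) sums laplace g w"
        by (simp add: c_def mult_ac)
    qed
    obtain e where "e > 0" "ball s e \<subseteq> ball (of_real a) (a - \<tau>)"
      using sb open_ball openE by blast
    thus ?thesis using hb holomorphic_on_subset by blast
  qed
  hence "laplace g field_differentiable (at s)" if "Re s > \<sigma>" for s
    using that by (meson centre_in_ball holomorphic_on_imp_differentiable_at open_ball)
  thus ?thesis by (intro holomorphic_onI) (auto intro: field_differentiable_at_within)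
qed

end

section \<open>Landau's theorem\<close>

lemma of_real_Ioc_islimpt:
  assumes "a < (b::real)"
  shows "(of_real b :: complex) islimpt of_real ` {a<..b}"
  unfolding islimpt_sequential
proof (intro exI conjI allI)
  let ?f = "\<lambda>n. complex_of_real (b - (b - a) / (real n + 2))"
  show "?f n \<in> of_real ` {a<..b} - {of_real b}" for n
  proof -
    have "(b - a) / (real n + 2) < (b - a) / 1"
      using assms by (intro divide_strict_left_mono) auto
    moreover have "(b - a) / (real n + 2) > 0" using assms by simp
    ultimately have "b - (b - a) / (real n + 2) \<in> {a<..b} - {b}" by simp
    thus ?thesis by (metis Diff_iff image_eqI of_real_eq_iff singletonD singletonI)
  qed
  have "(\<lambda>n. b - (b - a) / (real n + 2)) \<longlonglongrightarrow> b" by real_asymp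
  thus "?f \<longlonglongrightarrow> of_real b" by (rule tendsto_of_real)
qed

text \<open>Landau: at the abscissa of convergence \<open>\<sigma>\<close> of a nonnegative function, the Taylor series about a
  point slightly to the right has nonnegative moments as coefficients (up to sign); if it converges
  at a point to the left of \<open>\<sigma>\<close>, then so does the integral, by monotone convergence.\<close>

lemma Landau_laplace:
  fixes s0 T :: real
  assumes g: "laplace_fun g" and nonneg: "\<And>t. t \<ge> T \<Longrightarrow> g t \<ge> 0"
    and conv: "\<And>x. x > 0 \<Longrightarrow> laplace_conv g x"
    and C: "C holomorphic_on S" "open S" "convex S" "of_real ` {s0..1} \<subseteq> S"
    and eq: "\<And>x. 0 < x \<Longrightarrow> x \<le> 1 \<Longrightarrow> C (of_real x) = laplace g (of_real x)"
    and s0: "s0 \<le> 0"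
  shows "laplace_conv g s0"
proof (rule ccontr)
  assume not: "\<not> laplace_conv g s0"
  interpret laplace_fun g by fact
  \<comment> \<open>Nonnegativity is known from \<open>T\<close> on. The part before
    \<open>T\<close> has a transform converging everywhere, so it affects neither the abscissa nor
    the convergence of the series.\<close>
  define g1 where "g1 = (\<lambda>t. indicator {..<T} t * g t)"
  define g2 where "g2 = (\<lambda>t. indicator {T..} t * g t)"
  have [measurable]: "g1 \<in> borel_measurable borel" "g2 \<in> borel_measurable borel" unfolding g1_def g2_def by measurable
  interpret g1: laplace_fun g1 by unfold_locales (auto simp: g1_def supp)
  interpret g2: laplace_fun g2 by unfold_locales (auto simp: g2_def supp)
  have g2_nn: "g2 t \<ge> 0" for t using nonneg[of t] by (auto simp: g2_def indicator_def)
  have split: "g t = g1 t + g2 t" for t by (auto simp: g1_def g2_def indicator_def)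
  have g1_conv: "laplace_conv g1 x" for x
    unfolding g1_def by (rule laplace_conv_truncate[OF conv[of 1]]) simp
  have g2_conv_iff: "laplace_conv g2 x \<longleftrightarrow> laplace_conv g x" for x
  proof
    assume "laplace_conv g2 x"
    with g1_conv[of x] show "laplace_conv g x" unfolding laplace_conv_def split
      by (simp add: distrib_right Bochner_Integration.integrable_add)
  next
    assume "laplace_conv g x"
    with g1_conv[of x] have "integrable lborel (\<lambda>t. g t * exp (- x * t) - g1 t * exp (- x * t))"
      unfolding laplace_conv_def by (rule Bochner_Integration.integrable_diff[rotated])
    thus "laplace_conv g2 x" unfolding laplace_conv_def split by (simp add: algebra_simps)
  qed
  \<comment> \<open>Cutting off at \<open>s0\<close> makes the infimum exist and keeps it in the
    segment on which \<open>C\<close> is holomorphic.\<close>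
  define D where "D = {x. s0 \<le> x \<and> laplace_conv g x}"
  define \<sigma> where "\<sigma> = Inf D"
  have bdd: "bdd_below D" by (rule bdd_belowI[of _ s0]) (auto simp: D_def)
  have D1: "x \<in> D" if "x > 0" for x using that conv s0 by (auto simp: D_def)
  have \<sigma>_ge: "\<sigma> \<ge> s0" unfolding \<sigma>_def by (rule cInf_greatest) (use D1[of 1] in \<open>auto simp: D_def\<close>)
  have \<sigma>_le: "\<sigma> \<le> 0"
  proof (rule field_le_epsilon)
    fix e :: real assume "e > 0"
    thus "\<sigma> \<le> 0 + e" unfolding \<sigma>_def using cInf_lower[OF D1 bdd] by simp
  qed
  have conv_\<sigma>: "laplace_conv g x" if "x > \<sigma>" for x
  proof -
    have "D \<noteq> {}" "Inf D < x" using D1[of 1] that by (auto simp: \<sigma>_def)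
    from cInf_lessD[OF this] obtain y where "y \<in> D" "y < x" by blast
    thus ?thesis using laplace_conv_mono[of y x] by (auto simp: D_def)
  qed
  have "of_real \<sigma> \<in> S" using C(4) \<sigma>_ge \<sigma>_le by auto
  then obtain e where e: "e > 0" "ball (of_real \<sigma>) e \<subseteq> S" using C(2) openE by blast
  \<comment> \<open>With e = 4 \<delta>, the disc of radius 3 \<delta> about a = \<sigma> + \<delta>
    lies in S and contains \<sigma> - \<delta>, a point beyond the abscissa.\<close>
  define \<delta> where "\<delta> = e / 4"
  have \<delta>: "\<delta> > 0" using e by (simp add: \<delta>_def)
  define a where "a = \<sigma> + \<delta>"
  have sub: "ball (of_real a) (3 * \<delta>) \<subseteq> S"
  proof -
    have "ball (complex_of_real a) (3 * \<delta>) \<subseteq> ball (of_real \<sigma>) e"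
      using \<delta> by (intro ball_subset_ball_iff[THEN iffD2] disjI1)
        (auto simp: a_def dist_norm \<delta>_def simp flip: of_real_diff)
    thus ?thesis using e by blast
  qed
  have eqS: "C w = laplace g w" if "w \<in> S" "Re w > \<sigma>" for w
  proof -
    define U where "U = S \<inter> {s. Re s > \<sigma>}"
    have "C w - laplace g w = 0"
    proof (rule analytic_continuation[where f = "\<lambda>w. C w - laplace g w" and S = U and \<xi> = 1 and U = "of_real ` {0<..1}"])
      show "(\<lambda>w. C w - laplace g w) holomorphic_on U"
        by (intro holomorphic_on_diff holomorphic_on_subset[OF C(1)] holomorphic_on_subset[OF laplace_holomorphic[OF conv_\<sigma>]])
           (auto simp: U_def)
      show "open U" unfolding U_def by (intro open_Int C open_halfspace_Re_gt)
      show "connected U" unfolding U_def by (intro convex_connected convex_Int C convex_halfspace_Re_gt)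
      show "of_real ` {0<..1} \<subseteq> U" unfolding U_def using C(4) \<sigma>_le s0 by auto
      show "1 \<in> U" unfolding U_def using C(4) \<sigma>_le s0 by (auto simp: image_subset_iff dest!: bspec[of _ _ 1])
      show "(1::complex) islimpt of_real ` {0<..1}"
        using of_real_Ioc_islimpt[of 0 1] by simp
      show "C z - laplace g z = 0" if "z \<in> of_real ` {0<..1}" for z using that eq by auto
      show "w \<in> U" using that by (simp add: U_def)
    qed
    thus ?thesis by simp
  qed
  define c where "c = (\<lambda>f k. \<integral>t. f t * exp (- a * t) * t ^ k / fact k \<partial>lborel)"
  have mom: "integrable lborel (\<lambda>t. f t * exp (- a * t) * t ^ k / fact k)"
    if "laplace_fun f" "laplace_conv f (\<sigma> + \<delta> / 2)" for f k
    using laplace_fun.laplace_moment_integrable[OF that, of a k] \<delta> by (simp add: a_def)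
  have cs: "laplace_conv g (\<sigma> + \<delta> / 2)" "laplace_conv g1 (\<sigma> + \<delta> / 2)" "laplace_conv g2 (\<sigma> + \<delta> / 2)"
    using conv_\<sigma>[of "\<sigma> + \<delta> / 2"] \<delta> g1_conv g2_conv_iff by auto
  have c_split: "c g k = c g1 k + c g2 k" for k
    using Bochner_Integration.integral_add[OF mom[OF g1.laplace_fun_axioms cs(2), of k] mom[OF g2.laplace_fun_axioms cs(3), of k]]
    unfolding c_def split distrib_right add_divide_distrib .
  \<comment> \<open>The transform itself has this expansion for arguments up to \<delta> / 2, as it
    converges at \<sigma> + \<delta> / 2; the holomorphy of \<open>C\<close> carries the expansion
    on to 2 \<delta>.\<close>
  have "(\<lambda>k. of_real (c g k) * (complex_of_real (2 * \<delta>)) ^ k) sums C (of_real a - complex_of_real (2 * \<delta>))"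
  proof (rule power_series_eq_taylor[where h = "\<lambda>z. C (of_real a - z)" and R = "3 * \<delta>" and r = "\<delta> / 2"])
    show "(\<lambda>z. C (of_real a - z)) holomorphic_on ball 0 (3 * \<delta>)"
      by (rule holomorphic_on_compose_gen[OF _ C(1), unfolded o_def])
         (use sub in \<open>auto intro!: holomorphic_intros simp: dist_norm subset_iff\<close>)
    fix z :: complex assume z: "norm z < \<delta> / 2"
    have "(\<lambda>k. of_real (c g k) * (of_real a - (of_real a - z)) ^ k) sums laplace g (of_real a - z)"
      unfolding c_def by (rule laplace_power_series[OF cs(1)]) (use z in \<open>auto simp: a_def\<close>)
    moreover have "C (of_real a - z) = laplace g (of_real a - z)"
    proof (rule eqS)
      show "of_real a - z \<in> S" using sub z \<delta> by (auto simp: dist_norm subset_iff)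
      show "Re (of_real a - z) > \<sigma>" using abs_Re_le_cmod[of z] z \<delta> by (simp add: a_def)
    qed
    ultimately show "(\<lambda>k. of_real (c g k) * z ^ k) sums C (of_real a - z)" by simp
  qed (use \<delta> in auto)
  hence "summable (\<lambda>k. complex_of_real (c g k * (2 * \<delta>) ^ k))" by (simp add: sums_iff)
  hence sg: "summable (\<lambda>k. c g k * (2 * \<delta>) ^ k)" by (simp only: summable_of_real_iff)
  have "(\<lambda>k. of_real (c g1 k) * (of_real a - complex_of_real (a - 2 * \<delta>)) ^ k) sums laplace g1 (complex_of_real (a - 2 * \<delta>))"
    unfolding c_def by (rule g1.laplace_power_series[OF g1_conv[of "a - 2 * \<delta>"]]) (use \<delta> in auto)
  hence "summable (\<lambda>k. complex_of_real (c g1 k * (2 * \<delta>) ^ k))" by (simp add: sums_iff)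
  hence sg1: "summable (\<lambda>k. c g1 k * (2 * \<delta>) ^ k)" by (simp only: summable_of_real_iff)
  from summable_diff[OF sg sg1] have sg2: "summable (\<lambda>k. c g2 k * (2 * \<delta>) ^ k)"
    by (simp add: c_split algebra_simps)
  \<comment> \<open>The terms are nonnegative, so convergence of the moment series at 2 \<delta>
    makes their sum integrable; and that sum is g2 t * exp (- (\<sigma> - \<delta>) t).\<close>
  define f where "f = (\<lambda>k t. (g2 t * exp (- a * t) * t ^ k / fact k) * (2 * \<delta>) ^ k)"
  have f_nn: "f k t \<ge> 0" for k t
    using g2_nn[of t] g2.supp[of t] \<delta> by (cases "t < 0") (auto simp: f_def)
  have f_sums: "(\<lambda>k. f k t) sums (g2 t * exp (- (\<sigma> - \<delta>) * t))" for t
  proof -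
    have "(\<lambda>k. g2 t * exp (- a * t) * ((t * (2 * \<delta>)) ^ k /\<^sub>R fact k)) sums (g2 t * exp (- a * t) * exp (t * (2 * \<delta>)))"
      by (intro sums_mult exp_converges)
    also have "(\<lambda>k. g2 t * exp (- a * t) * ((t * (2 * \<delta>)) ^ k /\<^sub>R fact k)) = (\<lambda>k. f k t)"
      by (simp add: f_def power_mult_distrib divide_inverse mult_ac)
    also have "g2 t * exp (- a * t) * exp (t * (2 * \<delta>)) = g2 t * exp (- (\<sigma> - \<delta>) * t)"
      by (simp add: a_def algebra_simps flip: exp_add)
    finally show ?thesis .
  qed
  have "integrable lborel (\<lambda>t. \<Sum>k. f k t)"
  proof (rule integrable_suminf)
    show "integrable lborel (f k)" for k unfolding f_def
      by (intro integrable_mult_left mom cs g2.laplace_fun_axioms)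
    show "AE t in lborel. summable (\<lambda>k. norm (f k t))"
      using f_sums f_nn by (auto simp: sums_iff)
    have "(\<integral>t. norm (f k t) \<partial>lborel) = c g2 k * (2 * \<delta>) ^ k" for k
    proof -
      have "(\<integral>t. norm (f k t) \<partial>lborel) = (\<integral>t. f k t \<partial>lborel)" using f_nn by simp
      also have "\<dots> = c g2 k * (2 * \<delta>) ^ k" unfolding f_def c_def by simp
      finally show ?thesis .
    qed
    thus "summable (\<lambda>k. \<integral>t. norm (f k t) \<partial>lborel)" using sg2 by simp
  qed
  hence "laplace_conv g2 (\<sigma> - \<delta>)" unfolding laplace_conv_def using f_sums by (simp add: sums_iff)
  hence conv': "laplace_conv g (\<sigma> - \<delta>)" by (simp add: g2_conv_iff)
  \<comment> \<open>Either \<sigma> - \<delta> lies in \<open>D\<close> and undercuts its infimum,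
    or it lies to the left of \<open>s0\<close> and convergence passes to \<open>s0\<close> by
    monotonicity.\<close>
  show False
  proof (cases "s0 \<le> \<sigma> - \<delta>")
    case True
    hence "\<sigma> - \<delta> \<in> D" using conv' by (simp add: D_def)
    hence "\<sigma> \<le> \<sigma> - \<delta>" unfolding \<sigma>_def by (rule cInf_lower[OF _ bdd])
    thus False using \<delta> by simp
  next
    case False
    hence "laplace_conv g s0" using laplace_conv_mono[OF conv', of s0] by simp
    with not show False by simp
  qed
qed

section \<open>Multiplicative functions\<close>

lemma sum_divisors_coprime:
  fixes f :: "nat \<Rightarrow> 'a::comm_monoid_add"
  assumes "coprime a b"
  shows "(\<Sum>d | d dvd a * b. f d) = (\<Sum>d | d dvd a. \<Sum>e | e dvd b. f (d * e))"
proof -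
  have "(\<Sum>d | d dvd a. \<Sum>e | e dvd b. f (d * e)) = (\<Sum>(d,e)\<in>{d. d dvd a} \<times> {e. e dvd b}. f (d * e))"
    by (rule sum.cartesian_product)
  also have "\<dots> = (\<Sum>d\<in>(\<lambda>(d,e). d * e) ` ({d. d dvd a} \<times> {e. e dvd b}). f d)"
  proof (subst sum.reindex)
    show "inj_on (\<lambda>(d,e). d * e) ({d. d dvd a} \<times> {e. e dvd b})"
    proof (intro inj_onI, clarify)
      fix d e d' e' assume *: "d dvd a" "e dvd b" "d' dvd a" "e' dvd b" "d * e = d' * e'"
      have c: "coprime x y" if "x dvd a" "y dvd b" for x y
        using assms that by (meson coprime_divisors)
      have "d dvd d'" using c[of d e'] * by (metis coprime_dvd_mult_left_iff dvd_triv_left)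
      moreover have "d' dvd d" using c[of d' e] * by (metis coprime_dvd_mult_left_iff dvd_triv_left)
      moreover have "e dvd e'" using c[of d' e] * by (metis coprime_commute coprime_dvd_mult_right_iff dvd_triv_right)
      moreover have "e' dvd e" using c[of d e'] * by (metis coprime_commute coprime_dvd_mult_right_iff dvd_triv_right)
      ultimately show "d = d' \<and> e = e'" by (simp add: dvd_antisym)
    qed
  qed (auto simp: case_prod_unfold o_def)
  also have "(\<lambda>(d,e). d * e) ` ({d. d dvd a} \<times> {e. e dvd b}) = {d. d dvd a * b}"
    using division_decomp[of _ a b] by (fastforce intro: mult_dvd_mono)
  finally show ?thesis by simp
qed

text \<open>Induction splits off the full power of one prime, so multiplicativity is asked for only
  when one factor is a prime power. The type is general enough for \<open>sigma\<close>, its real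
  powers and \<open>sigma_conv\<close>.\<close>

lemma multiplicative_eq_prod_prime_powers:
  fixes f :: "nat \<Rightarrow> 'a::comm_monoid_mult"
  assumes "f 1 = 1"
    and mult: "\<And>p k m. prime p \<Longrightarrow> m > 0 \<Longrightarrow> \<not> p dvd m \<Longrightarrow> f (p ^ k * m) = f (p ^ k) * f m"
    and "n > 0"
  shows "f n = (\<Prod>p\<in>prime_factors n. f (p ^ multiplicity p n))"
  using \<open>n > 0\<close>
proof (induction n rule: less_induct)
  case (less n)
  show ?case
  proof (cases "n = 1")
    case False
    then obtain p where p: "prime p" "p dvd n" using prime_factor_nat by blast
    define k where "k = multiplicity p n"
    obtain m where m: "n = p ^ k * m" "\<not> p dvd m" 
      using multiplicity_decompose'[of n p] less.prems p(1) not_prime_unit unfolding k_def by blast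
    have m0: "m > 0" using m less.prems by (auto intro: Nat.gr0I)
    have k: "k > 0" using p less.prems unfolding k_def by (simp add: prime_multiplicity_gt_zero_iff)
    have "p ^ k > 1" using p k by (intro one_less_power prime_gt_1_nat)
    hence "m < n" using m m0 by simp
    from less.IH[OF this m0] have IH: "f m = (\<Prod>p\<in>prime_factors m. f (p ^ multiplicity p m))" .
    have pf: "prime_factors n = insert p (prime_factors m)"
      using p k m0 less.prems primes_dvd_imp_eq[of _ p]
      by (auto simp: in_prime_factors_iff m(1) prime_dvd_mult_iff prime_dvd_power_iff)
    have mu: "multiplicity q n = multiplicity q m" if "q \<in> prime_factors m" for q
    proof -
      have q: "prime q" "q \<noteq> p" using that m(2) by (auto simp: in_prime_factors_iff)
      have "multiplicity q (p ^ k) = 0" using q p by (simp add: prime_elem_multiplicity_power_distrib prime_multiplicity_other)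
      thus ?thesis using q p m0 unfolding m(1) by (subst prime_elem_multiplicity_mult_distrib) auto
    qed
    have "f n = f (p ^ k) * f m" unfolding m(1) by (rule mult) (use p m m0 in auto)
    also have "\<dots> = (\<Prod>p\<in>prime_factors n. f (p ^ multiplicity p n))"
      unfolding pf IH using m(2) mu by (subst prod.insert) (auto simp: k_def in_prime_factors_iff)
    finally show ?thesis .
  qed (use assms in auto)
qed

lemma coprime_prime_power: "prime (p::nat) \<Longrightarrow> \<not> p dvd m \<Longrightarrow> coprime (p ^ k) m"
  by (simp add: prime_imp_coprime)

lemma sigma_mult_coprime: "coprime a b \<Longrightarrow> sigma (a * b) = sigma a * sigma b"
  unfolding sigma_def by (simp add: sum_divisors_coprime sum_product)

lemma divisors_prime_power: "prime (p::nat) \<Longrightarrow> {d. d dvd p ^ k} = (\<lambda>i. p ^ i) ` {..k}"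
  by (auto simp: divides_primepow_nat)

lemma sum_divisors_prime_power:
  "prime (p::nat) \<Longrightarrow> (\<Sum>d | d dvd p ^ k. f d) = (\<Sum>i\<le>k. f (p ^ i))"
  unfolding divisors_prime_power by (subst sum.reindex) (auto simp: inj_on_def prime_power_inj o_def dest: prime_gt_1_nat)

lemma sigma_prime_power: "prime p \<Longrightarrow> sigma (p ^ k) = (\<Sum>i\<le>k. p ^ i)"
  unfolding sigma_def by (rule sum_divisors_prime_power)

lemma moebius_mult_coprime:
  assumes "coprime a b" shows "moebius (a * b) = moebius a * moebius b"
proof (cases "squarefree (a * b)")
  case True
  hence nz: "a \<noteq> 0" "b \<noteq> 0" by (metis mult_zero_left mult_zero_right not_squarefree_0)+
  have sq: "squarefree a" "squarefree b" using True squarefree_mono by (meson dvd_triv_left dvd_triv_right)+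
  have "prime_factors a \<inter> prime_factors b = {}"
    using assms by (auto simp: in_prime_factors_iff) (metis coprime_common_divisor not_prime_unit)
  hence "card (prime_factors (a * b)) = card (prime_factors a) + card (prime_factors b)"
    using nz by (simp add: prime_factors_product card_Un_disjoint)
  thus ?thesis using True sq by (simp add: moebius_def power_add)
next
  case False
  hence "\<not> squarefree a \<or> \<not> squarefree b" using squarefree_mult_coprime[OF assms] by blast
  thus ?thesis using False by (auto simp: moebius_def)
qed

lemma moebius_prime_power:
  assumes "prime p"
  shows "moebius (p ^ k) = (if k = 0 then 1 else if k = 1 then -1 else 0)"
  using assms by (auto simp: moebius_def squarefree_power_iff squarefree_prime prime_prime_factors)

lemma sigma_conv_mult_coprime:
  assumes "coprime a b" "a > 0" "b > 0"
  shows "sigma_conv \<kappa> (a * b) = sigma_conv \<kappa> a * sigma_conv \<kappa> b"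
proof -
  have "sigma_conv \<kappa> (a * b) = (\<Sum>d | d dvd a. \<Sum>e | e dvd b.
     of_int (moebius (a * b div (d * e))) * real (sigma (d * e)) powr \<kappa>)"
    unfolding sigma_conv_def by (rule sum_divisors_coprime[OF assms(1)])
  also have "\<dots> = (\<Sum>d | d dvd a. \<Sum>e | e dvd b. (of_int (moebius (a div d)) * real (sigma d) powr \<kappa>) *
      (of_int (moebius (b div e)) * real (sigma e) powr \<kappa>))"
  proof (intro sum.cong refl)
    fix d e assume "d \<in> {d. d dvd a}" "e \<in> {e. e dvd b}"
    then obtain a' b' where ab: "a = d * a'" "b = e * b'" by (auto elim!: dvdE)
    have nz: "d > 0" "e > 0" using assms ab by (auto intro: Nat.gr0I)
    have "coprime d e" "coprime a' b'" using assms(1) unfolding ab by auto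
    moreover have "a * b div (d * e) = a' * b'" using nz unfolding ab by (simp add: mult_ac)
    ultimately show "of_int (moebius (a * b div (d * e))) * real (sigma (d * e)) powr \<kappa> =
      (of_int (moebius (a div d)) * real (sigma d) powr \<kappa>) * (of_int (moebius (b div e)) * real (sigma e) powr \<kappa>)"
      using nz ab by (simp add: moebius_mult_coprime sigma_mult_coprime powr_mult)
  qed
  also have "\<dots> = sigma_conv \<kappa> a * sigma_conv \<kappa> b"
    unfolding sigma_conv_def by (simp add: sum_product)
  finally show ?thesis .
qed

lemma sigma_1 [simp]: "sigma (Suc 0) = 1"
  by (simp add: sigma_def)

lemma sigma_conv_1 [simp]: "sigma_conv \<kappa> (Suc 0) = 1"
  by (simp add: sigma_conv_def moebius_def)

lemma sigma_conv_prime_power: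
  assumes "prime p" "k > 0"
  shows "sigma_conv \<kappa> (p ^ k) = real (sigma (p ^ k)) powr \<kappa> - real (sigma (p ^ (k-1))) powr \<kappa>"
proof -
  have p: "p > 0" using assms prime_gt_0_nat by blast
  have "sigma_conv \<kappa> (p ^ k) = (\<Sum>i\<le>k. of_int (moebius (p ^ k div p ^ i)) * real (sigma (p ^ i)) powr \<kappa>)"
    unfolding sigma_conv_def by (rule sum_divisors_prime_power[OF assms(1)])
  also have "\<dots> = (\<Sum>i\<le>k. of_int (moebius (p ^ (k - i))) * real (sigma (p ^ i)) powr \<kappa>)"
    using p by (intro sum.cong refl) (auto simp: power_diff)
  also have "\<dots> = (\<Sum>i\<in>{k-1,k}. of_int (moebius (p ^ (k - i))) * real (sigma (p ^ i)) powr \<kappa>)"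
    using assms by (intro sum.mono_neutral_right) (auto simp: moebius_prime_power)
  also have "\<dots> = real (sigma (p ^ k)) powr \<kappa> - real (sigma (p ^ (k-1))) powr \<kappa>"
    using assms by (simp add: moebius_prime_power moebius_prime_power[of p "Suc 0", simplified])
  finally show ?thesis .
qed

lemma sigma_pos: "n > 0 \<Longrightarrow> sigma n > 0"
  unfolding sigma_def by (rule sum_pos) (auto intro: Nat.gr0I)

text \<open>\<open>p * sigma (p ^ (k - 1))\<close> is p + ... + p ^ k, the divisor sum of p ^ k
  without the term 1; this is raised to the power \<kappa>.\<close>

lemma sigma_conv_prime_power_ge:
  assumes "prime p" "k > 0" "\<kappa> > 0"
  shows "sigma_conv \<kappa> (p ^ k) \<ge> real (sigma (p ^ k)) powr \<kappa> * (1 - real p powr (-\<kappa>))"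
proof -
  obtain j where j: "k = Suc j" using assms by (cases k) auto
  have p: "p > 0" using assms prime_gt_0_nat by blast
  have "p * sigma (p ^ j) = (\<Sum>i\<in>{1..k}. p ^ i)"
    unfolding sigma_prime_power[OF assms(1)] sum_distrib_left j
    by (rule sum.reindex_bij_witness[of _ "\<lambda>i. i - 1" Suc]) auto
  also have "\<dots> \<le> sigma (p ^ k)"
    unfolding sigma_prime_power[OF assms(1)] by (rule sum_mono2) auto
  finally have "real p * real (sigma (p ^ j)) \<le> real (sigma (p ^ k))"
    by (metis of_nat_le_iff of_nat_mult)
  hence "(real p * real (sigma (p ^ j))) powr \<kappa> \<le> real (sigma (p ^ k)) powr \<kappa>"
    using assms by (intro powr_mono2) auto
  hence "real (sigma (p ^ j)) powr \<kappa> \<le> real (sigma (p ^ k)) powr \<kappa> * real p powr (-\<kappa>)"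
    using p by (simp add: powr_mult powr_minus field_simps)
  thus ?thesis using sigma_conv_prime_power[OF assms(1,2), of \<kappa>] j by (simp add: algebra_simps)
qed

section \<open>Comparison of zeta with finite Euler products\<close>

lemma minus_ln_one_minus_sums:
  "0 \<le> (y::real) \<Longrightarrow> y < 1 \<Longrightarrow> (\<lambda>k. y ^ k / real k) sums (- ln (1 - y))"
  using ln_series'[of "- y"] sums_minus by (fastforce simp: power_minus')

text \<open>Each - ln (1 - p powr (- \<kappa>)) is a limit of partial sums over the powers of p.
  Together these are sums over distinct prime powers of terms of log zeta, a series with nonnegative
  terms.\<close>

lemma zeta_real_ge_euler_product:
  assumes "\<kappa> > 1" "finite P" "\<And>p. p \<in> P \<Longrightarrow> prime p"
  shows "1 \<le> Re (zeta (of_real \<kappa>)) * (\<Prod>p\<in>P. 1 - real p powr (-\<kappa>))"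
proof -
  obtain L L' where L: "\<And>s. Re s > 1 \<Longrightarrow> (\<lambda>n. of_real (mcoef n) * of_nat n powr (-s)) sums L s"
    "\<And>s. Re s > 1 \<Longrightarrow> zeta s = exp (L s)"
    by (rule log_zeta) blast
  have k1: "Re (complex_of_real \<kappa>) > 1" using assms by simp
  define f where "f = (\<lambda>n. mcoef n * real n powr (-\<kappa>))"
  have eq: "(\<lambda>n. of_real (mcoef n) * of_nat n powr (-complex_of_real \<kappa>)) = (\<lambda>n. complex_of_real (f n))"
    by (simp add: f_def powr_Reals_eq)
  have cs: "(\<lambda>n. complex_of_real (f n)) sums L (of_real \<kappa>)" using L(1)[OF k1] unfolding eq .
  then obtain l where l: "f sums l" "L (of_real \<kappa>) = of_real l" by (rule sums_complex_of_realE)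
  hence z: "Re (zeta (of_real \<kappa>)) = exp l" using L(2)[OF k1] by (simp add: exp_of_real)
  have f_nn: "f n \<ge> 0" for n unfolding f_def using mcoef_nonneg by simp
  define q where "q = (\<lambda>p::nat. real p powr (-\<kappa>))"
  have q: "0 < q p" "q p < 1" if "p \<in> P" for p
    using prime_gt_1_nat[OF assms(3)[OF that]] assms(1) by (auto simp: q_def powr_less_one)
  have part: "(\<Sum>p\<in>P. \<Sum>k\<in>{1..K}. q p ^ k / real k) \<le> l" for K
  proof -
    have "(\<Sum>p\<in>P. \<Sum>k\<in>{1..K}. q p ^ k / real k) = (\<Sum>p\<in>P. \<Sum>k\<in>{1..K}. f (p ^ k))"
    proof (intro sum.cong refl)
      fix p k assume pk: "p \<in> P" "k \<in> {1..K}"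
      have pr: "prime p" using assms pk by auto
      have "mcoef (p ^ k) = 1 / real k" by (rule mcoef_prime_power) (use pr pk in auto)
      moreover have "real (p ^ k) powr (-\<kappa>) = q p ^ k"
        unfolding q_def of_nat_power using prime_gt_0_nat[OF pr]
        by (subst powr_realpow[symmetric], simp)+ (simp add: powr_powr mult_ac)
      ultimately show "q p ^ k / real k = f (p ^ k)" by (simp add: f_def)
    qed
    also have "\<dots> = (\<Sum>(p,k)\<in>P \<times> {1..K}. f (p ^ k))" by (rule sum.cartesian_product)
    also have "\<dots> = (\<Sum>n\<in>(\<lambda>(p,k). p ^ k) ` (P \<times> {1..K}). f n)"
    proof (subst sum.reindex)
      show "inj_on (\<lambda>(p,k). p ^ k) (P \<times> {1..K})"
        using assms(3) by (auto simp: inj_on_def prime_power_inj'')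
    qed (auto simp: case_prod_unfold o_def)
    also have "\<dots> \<le> l" unfolding sums_unique[OF l(1)]
      by (rule sum_le_suminf[OF sums_summable[OF l(1)]]) (use assms f_nn in auto)
    finally show ?thesis .
  qed
  have lim: "(\<lambda>K. \<Sum>k\<in>{1..K}. q p ^ k / real k) \<longlonglongrightarrow> - ln (1 - q p)" if "p \<in> P" for p
  proof -
    have "(\<lambda>k. (q p) ^ k / real k) sums (- ln (1 - q p))"
      by (rule minus_ln_one_minus_sums) (use q[OF that] in auto)
    hence "(\<lambda>K. \<Sum>k\<le>K. q p ^ k / real k) \<longlonglongrightarrow> - ln (1 - q p)"
      by (simp add: sums_def_le)
    moreover have "(\<Sum>k\<le>K. q p ^ k / real k) = (\<Sum>k\<in>{1..K}. q p ^ k / real k)" for K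
      by (intro sum.mono_neutral_right) auto
    ultimately show ?thesis by simp
  qed
  have "(\<Sum>p\<in>P. - ln (1 - q p)) \<le> l"
    by (rule LIMSEQ_le_const2[OF tendsto_sum[OF lim]]) (use part in auto)
  hence "exp (- (\<Sum>p\<in>P. ln (1 - q p))) \<le> exp l" by (simp add: sum_negf)
  also have "exp (- (\<Sum>p\<in>P. ln (1 - q p))) = inverse (\<Prod>p\<in>P. 1 - q p)"
    using q assms(2) by (simp add: exp_minus exp_sum)
  finally have "inverse (\<Prod>p\<in>P. 1 - q p) \<le> exp l" .
  moreover have "(\<Prod>p\<in>P. 1 - q p) > 0" using q by (intro prod_pos) auto
  ultimately show ?thesis by (simp add: z q_def field_simps)
qed

lemma zeta_real_pos:
  assumes "\<kappa> > 1" shows "Re (zeta (of_real \<kappa>)) > 0"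
  using zeta_real_ge_euler_product[OF assms, of "{}"] by simp

lemma sigma_conv_ge:
  assumes "\<kappa> > 1" "n > 0"
  shows "sigma_conv \<kappa> n \<ge> real (sigma n) powr \<kappa> / Re (zeta (of_real \<kappa>))"
proof -
  let ?P = "prime_factors n"
  have "real (sigma n) powr \<kappa> * (\<Prod>p\<in>?P. 1 - real p powr (-\<kappa>)) =
      (\<Prod>p\<in>?P. real (sigma (p ^ multiplicity p n)) powr \<kappa>) * (\<Prod>p\<in>?P. 1 - real p powr (-\<kappa>))"
    by (subst multiplicative_eq_prod_prime_powers[of "\<lambda>n. real (sigma n) powr \<kappa>" n])
       (use assms in \<open>auto simp: sigma_mult_coprime[OF coprime_prime_power] powr_mult\<close>)
  also have "\<dots> = (\<Prod>p\<in>?P. real (sigma (p ^ multiplicity p n)) powr \<kappa> * (1 - real p powr (-\<kappa>)))"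
    by (simp add: prod.distrib)
  also have "\<dots> \<le> (\<Prod>p\<in>?P. sigma_conv \<kappa> (p ^ multiplicity p n))"
  proof (rule prod_mono)
    fix p assume p: "p \<in> ?P"
    hence pr: "prime p" "multiplicity p n > 0" by (auto simp: prime_factors_multiplicity)
    have "real p powr (-\<kappa>) < 1" using prime_gt_1_nat[OF pr(1)] assms by (simp add: powr_less_one)
    thus "0 \<le> real (sigma (p ^ multiplicity p n)) powr \<kappa> * (1 - real p powr (-\<kappa>)) \<and>
        real (sigma (p ^ multiplicity p n)) powr \<kappa> * (1 - real p powr (-\<kappa>)) \<le> sigma_conv \<kappa> (p ^ multiplicity p n)"
      using sigma_conv_prime_power_ge[OF pr, of \<kappa>] assms by auto
  qed
  also have "\<dots> = sigma_conv \<kappa> n"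
    by (rule multiplicative_eq_prod_prime_powers[symmetric])
       (use assms in \<open>auto simp: sigma_conv_mult_coprime[OF coprime_prime_power] prime_gt_0_nat\<close>)
  finally have le: "real (sigma n) powr \<kappa> * (\<Prod>p\<in>?P. 1 - real p powr (-\<kappa>)) \<le> sigma_conv \<kappa> n" .
  have "real (sigma n) powr \<kappa> * 1 \<le> real (sigma n) powr \<kappa> * (Re (zeta (of_real \<kappa>)) * (\<Prod>p\<in>?P. 1 - real p powr (-\<kappa>)))"
    by (intro mult_left_mono zeta_real_ge_euler_product assms) auto
  also have "\<dots> \<le> Re (zeta (of_real \<kappa>)) * sigma_conv \<kappa> n"
    using mult_left_mono[OF le, of "Re (zeta (of_real \<kappa>))"] zeta_real_pos[OF assms(1)] by (simp add: mult_ac)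
  finally show ?thesis using zeta_real_pos[OF assms(1)] by (simp add: field_simps)
qed

section \<open>The least common multiple of an initial segment\<close>

definition prime_exp :: "nat \<Rightarrow> nat \<Rightarrow> nat" where
  "prime_exp x p = nat \<lfloor>log (real p) (real x)\<rfloor>"

lemma prime_power_le_iff:
  assumes "prime p" "x > 0"
  shows "p ^ k \<le> x \<longleftrightarrow> k \<le> prime_exp x p"
proof -
  have p: "real p > 1" using prime_gt_1_nat[OF assms(1)] by simp
  have "log (real p) (real x) \<ge> 0" using p assms by (subst zero_le_log_cancel_iff) auto
  hence "k \<le> prime_exp x p \<longleftrightarrow> real k \<le> log (real p) (real x)"
    unfolding prime_exp_def by (simp add: le_nat_iff le_floor_iff)
  also have "\<dots> \<longleftrightarrow> real p powr real k \<le> real x" by (rule le_log_iff) (use p assms in auto)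
  also have "\<dots> \<longleftrightarrow> real (p ^ k) \<le> real x" using p by (simp add: powr_realpow)
  finally show ?thesis by (simp only: of_nat_le_iff)
qed

abbreviation primes_upto :: "nat \<Rightarrow> nat set" where
  "primes_upto x \<equiv> {p. prime p \<and> p \<le> x}"

lemma prime_exp_pos:
  assumes "p \<in> primes_upto x" shows "prime_exp x p > 0"
proof -
  have "prime p" "x > 0" "p ^ 1 \<le> x" using assms by (auto simp: prime_gt_0_nat intro: Nat.gr0I)
  hence "1 \<le> prime_exp x p" using prime_power_le_iff[of p x 1] by blast
  thus ?thesis by simp
qed

text \<open>lcm(1..x) is encoded by its factorisation, from which \<open>sigma\<close> and the
  logarithm can be read off; that every positive j \<le> x divides it is proved afterwards.\<close>

definition lcm_upto :: "nat \<Rightarrow> nat" where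
  "lcm_upto x = (\<Prod>p\<in>primes_upto x. p ^ prime_exp x p)"

lemma finite_primes_upto [simp]: "finite (primes_upto x)"
  by (rule finite_subset[of _ "{..x}"]) auto

lemma lcm_upto_pos: "lcm_upto x > 0"
  unfolding lcm_upto_def by (intro prod_pos) (auto intro: prime_gt_0_nat)

lemma multiplicity_lcm_upto:
  "prime p \<Longrightarrow> multiplicity p (lcm_upto x) = (if p \<le> x then prime_exp x p else 0)"
  unfolding lcm_upto_def by (subst multiplicity_prod_prime_powers) auto

lemma dvd_lcm_upto:
  assumes "0 < j" "j \<le> x" shows "j dvd lcm_upto x"
proof (rule multiplicity_le_imp_dvd)
  fix p :: nat assume p: "prime p"
  show "multiplicity p j \<le> multiplicity p (lcm_upto x)"
  proof (cases "multiplicity p j = 0")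
    case False
    have "p ^ multiplicity p j dvd j" by (rule multiplicity_dvd)
    hence le: "p ^ multiplicity p j \<le> x" using assms by (meson dvd_imp_le le_trans)
    have "p ^ 1 \<le> p ^ multiplicity p j" using False prime_gt_0_nat[OF p] by (intro power_increasing) auto
    hence "p \<le> x" using le by simp
    thus ?thesis using le p assms by (simp add: multiplicity_lcm_upto prime_power_le_iff)
  qed simp
qed (use assms in auto)

text \<open>The Leibniz harmonic triangle: its entries \<open>1 / (m * (n choose m))\<close> are integer
  combinations of the reciprocals \<open>1 / j\<close> with \<open>j \<le> n\<close>.\<close>

lemma lcm_upto_leibniz_triangle:
  assumes "n \<le> x" "0 < m" "m \<le> n"
  shows "real (lcm_upto x) / (real m * real (n choose m)) \<in> \<int>"
  using assms(2,1,3)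
proof (induction m arbitrary: n rule: nat_induct_non_zero)
  case 1
  obtain k where "lcm_upto x = n * k" using dvd_lcm_upto[of n x] 1 by auto
  thus ?case using 1 by simp
next
  case (Suc m)
  then obtain n' where n': "n = Suc n'" "m \<le> n'" by (cases n) auto
  have "real (lcm_upto x) / (real m * real (n' choose m)) \<in> \<int>"
    "real (lcm_upto x) / (real m * real (n choose m)) \<in> \<int>"
    using Suc n' by (auto intro!: Suc.IH)
  hence int: "real (lcm_upto x) / (real m * real (n' choose m)) - real (lcm_upto x) / (real m * real (n choose m)) \<in> \<int>"
    by (rule Ints_diff)
  have le: "m \<le> n'" "m \<le> n" "Suc m \<le> n" using n' by auto
  have pos: "real (n' choose m) > 0" "real (n choose m) > 0" "real (n choose Suc m) > 0" "real m > 0"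
    using le Suc.hyps by (simp_all only: of_nat_0_less_iff zero_less_binomial)
  have "(n - m) * (n choose m) = n * (n' choose m)" using binomial_absorb_comp[of n m] unfolding n'(1) by (simp only: diff_Suc_1)
  hence e1: "(real n - real m) * real (n choose m) = real n * real (n' choose m)"
    using le(2) by (metis of_nat_diff of_nat_mult)
  have e2: "real (Suc m) * real (n choose Suc m) = real n * real (n' choose m)"
    using Suc_times_binomial[of m n'] unfolding n'(1) of_nat_mult[symmetric] of_nat_eq_iff by simp
  have nm: "real n - real m > 0" "real n > 0" using n' by auto
  \<comment> \<open>The rule of the triangle: two entries with index m, in neighbouring rows,
    determine the entry with index m + 1.\<close>
  have "1 / (real m * real (n' choose m)) - 1 / (real m * real (n choose m)) = 1 / (real (Suc m) * real (n choose Suc m))"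
  proof -
    have c: "real (n' choose m) = (real n - real m) * real (n choose m) / real n" using e1 nm by (simp add: field_simps)
    have d: "real (Suc m) * real (n choose Suc m) = (real n - real m) * real (n choose m)" using e1 e2 by simp
    show ?thesis unfolding d unfolding c using pos nm by (simp add: field_simps)
  qed
  hence "real (lcm_upto x) / (real m * real (n' choose m)) - real (lcm_upto x) / (real m * real (n choose m)) =
      real (lcm_upto x) / (real (Suc m) * real (n choose Suc m))"
    by (metis (no_types, opaque_lifting) mult.right_neutral right_diff_distrib times_divide_eq_right)
  with int show ?case by simp
qed

text \<open>By the triangle, lcm(1..x) is a positive integer multiple of m * (2 * m choose m) for m
  = x div 2, and the central binomial coefficient is at least 4 ^ m / (2 m). The constant 1/4 leaves
  room for the parity of x and the factor 1/2.\<close>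

lemma ln_lcm_upto_ge:
  assumes "x \<ge> 4"
  shows "ln (real (lcm_upto x)) \<ge> real x / 4"
proof -
  define m where "m = x div 2"
  have m: "m > 0" "2 * m \<le> x" "x \<le> 2 * m + 1" using assms unfolding m_def by auto
  define r where "r = real (lcm_upto x) / (real m * real (2 * m choose m))"
  have b: "real (2 * m choose m) > 0" by (simp add: zero_less_binomial_iff)
  have "r \<in> \<int>" unfolding r_def by (rule lcm_upto_leibniz_triangle) (use m in auto)
  moreover have "r > 0" unfolding r_def using lcm_upto_pos m b by simp
  ultimately have "r \<ge> 1" by (auto elim!: Ints_cases)
  hence "real m * real (2 * m choose m) \<le> real (lcm_upto x)" unfolding r_def using m b by (simp add: field_simps)
  moreover have "4 ^ m / 2 \<le> real m * real (2 * m choose m)"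
    using central_binomial_lower_bound[OF m(1)] m by (simp add: field_simps)
  ultimately have "4 ^ m / 2 \<le> real (lcm_upto x)" by linarith
  hence "ln (4 ^ m / 2) \<le> ln (real (lcm_upto x))" using lcm_upto_pos by (subst ln_le_cancel_iff) auto
  moreover have "ln (4 ^ m / 2 :: real) = (2 * real m - 1) * ln 2"
  proof -
    have "(4::real) = 2 ^ 2" by simp
    hence "ln (4::real) = 2 * ln 2" by (metis ln_realpow of_nat_numeral zero_less_numeral)
    thus ?thesis by (simp add: ln_div ln_realpow algebra_simps)
  qed
  moreover have "(2 * real m - 1) * ln 2 \<ge> (real x - 2) * (1/2)"
  proof (rule mult_mono)
    show "ln (2::real) \<ge> 1 / 2" using ln2_ge_two_thirds by simp
  qed (use m assms in auto)
  moreover have "(real x - 2) * (1/2) \<ge> real x / 4" using assms by simp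
  ultimately show ?thesis by linarith
qed

section \<open>Chebyshev's psi and sums over prime powers\<close>

lemma sum_primepow_upto:
  fixes f :: "nat \<Rightarrow> real"
  assumes "\<And>n. \<not> primepow n \<Longrightarrow> f n = 0"
  shows "(\<Sum>n\<le>x. f n) = (\<Sum>p\<in>primes_upto x. \<Sum>k\<in>{1..prime_exp x p}. f (p ^ k))"
proof -
  let ?A = "(\<lambda>(p,k). p ^ k) ` (SIGMA p:primes_upto x. {1..prime_exp x p})"
  have "(\<Sum>p\<in>primes_upto x. \<Sum>k\<in>{1..prime_exp x p}. f (p ^ k)) =
      (\<Sum>(p,k)\<in>(SIGMA p:primes_upto x. {1..prime_exp x p}). f (p ^ k))"
    by (rule sum.Sigma) auto
  also have "\<dots> = (\<Sum>n\<in>?A. f n)"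
    by (subst sum.reindex) (auto simp: inj_on_def prime_power_inj'' case_prod_unfold o_def)
  also have "?A = {n. n \<le> x \<and> primepow n}"
  proof (intro equalityI subsetI)
    fix n assume "n \<in> ?A"
    then obtain p k where pk: "prime p" "p \<le> x" "1 \<le> k" "k \<le> prime_exp x p" "n = p ^ k" by auto
    have "x > 0" using pk prime_gt_0_nat[of p] by linarith
    thus "n \<in> {n. n \<le> x \<and> primepow n}" using pk prime_power_le_iff[of p x k] by auto
  next
    fix n assume n: "n \<in> {n. n \<le> x \<and> primepow n}"
    then obtain p k where pk: "prime p" "k > 0" "n = p ^ k" unfolding primepow_def by auto
    have "x > 0" using n primepow_gt_0_nat[of n] by auto
    hence k: "k \<le> prime_exp x p" using prime_power_le_iff[of p x k] n pk by auto
    have "p ^ 1 \<le> p ^ k" using pk prime_ge_1_nat by (intro power_increasing) auto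
    hence "p \<le> x" using n pk by simp
    thus "n \<in> ?A"
      using pk k by (auto intro!: image_eqI[of _ _ "(p,k)"])
  qed
  also have "(\<Sum>n | n \<le> x \<and> primepow n. f n) = (\<Sum>n\<le>x. f n)"
    by (rule sum.mono_neutral_left) (use assms in auto)
  finally show ?thesis by simp
qed

definition psi :: "nat \<Rightarrow> real" where
  "psi x = (\<Sum>n\<le>x. mangoldt n)"

definition msum :: "nat \<Rightarrow> real" where
  "msum x = (\<Sum>n\<le>x. mcoef n / real n)"

lemma ln_lcm_upto: "ln (real (lcm_upto x)) = psi x"
proof -
  have "ln (real (lcm_upto x)) = (\<Sum>p\<in>primes_upto x. ln (real p ^ prime_exp x p))"
    unfolding lcm_upto_def of_nat_prod by (subst ln_prod) (auto simp: prime_gt_0_nat)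
  also have "\<dots> = (\<Sum>p\<in>primes_upto x. \<Sum>k\<in>{1..prime_exp x p}. mangoldt (p ^ k))"
    by (intro sum.cong refl) (auto simp: ln_realpow mangoldt_primepow prime_gt_0_nat)
  also have "\<dots> = psi x" unfolding psi_def
    by (rule sum_primepow_upto[symmetric]) (simp add: mangoldt_def)
  finally show ?thesis .
qed

lemma msum_eq: "msum x = (\<Sum>p\<in>primes_upto x. \<Sum>k\<in>{1..prime_exp x p}. (1 / real p) ^ k / real k)"
proof -
  have "msum x = (\<Sum>p\<in>primes_upto x. \<Sum>k\<in>{1..prime_exp x p}. mcoef (p ^ k) / real (p ^ k))"
    unfolding msum_def by (rule sum_primepow_upto) (simp add: mcoef_def mangoldt_def)
  also have "\<dots> = (\<Sum>p\<in>primes_upto x. \<Sum>k\<in>{1..prime_exp x p}. (1 / real p) ^ k / real k)"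
    by (intro sum.cong refl) (auto simp: mcoef_prime_power power_one_over field_simps)
  finally show ?thesis .
qed

lemma sum_power_div_le_ln:
  assumes "0 \<le> (y::real)" "y < 1"
  shows "(\<Sum>k\<in>{1..a}. y ^ k / real k) \<le> - ln (1 - y)"
proof -
  note s = minus_ln_one_minus_sums[OF assms]
  have "(\<Sum>k\<in>{1..a}. y ^ k / real k) \<le> (\<Sum>k. y ^ k / real k)"
    by (rule sum_le_suminf) (use s assms in \<open>auto simp: sums_iff\<close>)
  thus ?thesis using s by (simp add: sums_iff)
qed

text \<open>The sum is (1 - q) / (1 - y) with q = y ^ (a + 1) \<le> 1/2, and the numerator costs at
  most 2 q. For y = 1 / p the sum is sigma (p ^ a) / p ^ a.\<close>

lemma ln_geometric_ge:
  assumes "0 < (y::real)" "y \<le> 1 / 2"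
  shows "ln (\<Sum>i\<le>a. y ^ i) \<ge> (\<Sum>k\<in>{1..a}. y ^ k / real k) - 2 * y ^ Suc a"
proof -
  define q where "q = y ^ Suc a"
  have q: "0 \<le> q" "q \<le> 1/2"
  proof -
    have "q \<le> y ^ 1" unfolding q_def using assms by (intro power_decreasing) auto
    thus "q \<le> 1/2" using assms by simp
  qed (use assms in \<open>auto simp: q_def\<close>)
  have "(\<Sum>i\<le>a. y ^ i) = (1 - q) / (1 - y)"
    using assms sum_gp_strict[of y "Suc a"] by (simp add: q_def lessThan_Suc_atMost)
  hence "ln (\<Sum>i\<le>a. y ^ i) = ln (1 - q) - ln (1 - y)" using q assms by (simp add: ln_div)
  moreover have "ln (1 - q) \<ge> - q - 2 * q\<^sup>2" using q by (intro ln_one_minus_pos_lower_bound) auto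
  moreover have "2 * q\<^sup>2 \<le> q" using q mult_left_mono[of "2 * q" 1 q] by (simp add: power2_eq_square)
  ultimately show ?thesis using sum_power_div_le_ln[of y a] assms unfolding q_def by linarith
qed

lemma ln_sigma_lcm_upto:
  "ln (real (sigma (lcm_upto x))) - ln (real (lcm_upto x)) \<ge>
     msum x - 2 * (\<Sum>p\<in>primes_upto x. (1 / real p) ^ Suc (prime_exp x p))"
proof -
  have pf: "prime_factors (lcm_upto x) = primes_upto x"
    by (auto simp: prime_factors_multiplicity multiplicity_lcm_upto prime_exp_pos split: if_splits)
  have "real (sigma (lcm_upto x)) = (\<Prod>p\<in>prime_factors (lcm_upto x). real (sigma (p ^ multiplicity p (lcm_upto x))))"
    by (rule multiplicative_eq_prod_prime_powers)
       (auto simp: sigma_mult_coprime[OF coprime_prime_power] lcm_upto_pos)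
  also have "\<dots> = (\<Prod>p\<in>primes_upto x. real (sigma (p ^ prime_exp x p)))"
    unfolding pf by (intro prod.cong) (auto simp: multiplicity_lcm_upto)
  finally have s: "real (sigma (lcm_upto x)) = (\<Prod>p\<in>primes_upto x. real (sigma (p ^ prime_exp x p)))" .
  have "ln (real (sigma (lcm_upto x))) - ln (real (lcm_upto x)) =
     (\<Sum>p\<in>primes_upto x. ln (real (sigma (p ^ prime_exp x p))) - ln (real (p ^ prime_exp x p)))"
  proof -
    have "ln (real (lcm_upto x)) = (\<Sum>p\<in>primes_upto x. ln (real (p ^ prime_exp x p)))"
      unfolding lcm_upto_def of_nat_prod by (subst ln_prod) (auto simp: prime_gt_0_nat)
    moreover have "ln (real (sigma (lcm_upto x))) = (\<Sum>p\<in>primes_upto x. ln (real (sigma (p ^ prime_exp x p))))"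
      unfolding s by (subst ln_prod) (auto simp: sigma_pos prime_gt_0_nat)
    ultimately show ?thesis by (simp add: sum_subtractf)
  qed
  also have "\<dots> \<ge> (\<Sum>p\<in>primes_upto x. (\<Sum>k\<in>{1..prime_exp x p}. (1 / real p) ^ k / real k) - 2 * (1 / real p) ^ Suc (prime_exp x p))"
  proof (rule sum_mono)
    fix p assume "p \<in> primes_upto x"
    hence p: "prime p" by simp
    define a where "a = prime_exp x p"
    have p2: "real p \<ge> 2" using prime_ge_2_nat[OF p] by simp
    have "real (sigma (p ^ a)) = (\<Sum>i\<le>a. real p ^ i)" by (simp add: sigma_prime_power[OF p])
    also have "\<dots> = real (p ^ a) * (\<Sum>i\<le>a. (1 / real p) ^ i)"
    proof -
      have "(\<Sum>i\<le>a. real p ^ i) = (\<Sum>i\<le>a. real p ^ (a - i))"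
        by (rule sum.reindex_bij_witness[of _ "\<lambda>i. a - i" "\<lambda>i. a - i"]) auto
      also have "\<dots> = (\<Sum>i\<le>a. real (p ^ a) * (1 / real p) ^ i)"
        using p2 by (intro sum.cong refl) (auto simp: power_diff power_one_over field_simps)
      finally show ?thesis by (simp add: sum_distrib_left)
    qed
    finally have eq: "real (sigma (p ^ a)) = real (p ^ a) * (\<Sum>i\<le>a. (1 / real p) ^ i)" .
    have "(\<Sum>i\<le>a. (1 / real p) ^ i) > 0" using p2 by (intro sum_pos) auto
    moreover have "real (p ^ a) > 0" using p2 by simp
    ultimately have "ln (real (sigma (p ^ a))) - ln (real (p ^ a)) = ln (\<Sum>i\<le>a. (1 / real p) ^ i)"
      unfolding eq by (subst ln_mult) auto
    thus "(\<Sum>k\<in>{1..prime_exp x p}. (1 / real p) ^ k / real k) - 2 * (1 / real p) ^ Suc (prime_exp x p) \<le>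
       ln (real (sigma (p ^ prime_exp x p))) - ln (real (p ^ prime_exp x p))"
      using ln_geometric_ge[of "1 / real p" a] p2 by (simp add: a_def)
  qed
  finally show ?thesis by (simp add: msum_eq sum_subtractf sum_distrib_left)
qed

text \<open>P = p ^ (k + 1) with k = \<open>prime_exp x p\<close> exceeds x and is at least p ^ 2;
  interpolating, P \<ge> x powr \<theta> * p powr (2 (1 - \<theta>)). The sum over p converges
  because 2 (1 - \<theta>) > 1, that is, \<theta> < 1/2. This is where the condition b < 1/2 has its
  origin.\<close>

lemma prime_power_loss:
  assumes "0 < \<theta>" "\<theta> < 1 / 2"
  obtains C where "C \<ge> 0" "\<And>x. x > 0 \<Longrightarrow>
    (\<Sum>p\<in>primes_upto x. (1 / real p) ^ Suc (prime_exp x p)) \<le> C * real x powr (-\<theta>)"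
proof -
  define C where "C = (\<Sum>n. real n powr (- (2 * (1 - \<theta>))))"
  have sm: "summable (\<lambda>n. real n powr (- (2 * (1 - \<theta>))))" using assms by (subst summable_real_powr_iff) auto
  show ?thesis
  proof (rule that)
    show "C \<ge> 0" unfolding C_def by (rule suminf_nonneg[OF sm]) auto
    fix x :: nat assume x: "x > 0"
    have "(1 / real p) ^ Suc (prime_exp x p) \<le> real x powr (-\<theta>) * real p powr (- (2 * (1 - \<theta>)))"
      if "p \<in> primes_upto x" for p
    proof -
      define a where "a = prime_exp x p"
      have p: "prime p" and p1: "real p > 1" using that prime_gt_1_nat[of p] by auto
      have "a > 0" using prime_exp_pos[OF that] by (simp add: a_def)
      have "p ^ Suc a > x" using prime_power_le_iff[OF p x, of "Suc a"] by (simp add: a_def)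
      hence 1: "real x \<le> real p ^ Suc a" by (metis less_imp_le of_nat_le_iff of_nat_power)
      have 2: "real p ^ 2 \<le> real p ^ Suc a" using p1 \<open>a > 0\<close> by (intro power_increasing) auto
      define P where "P = real p ^ Suc a"
      have P: "P > 0" using p1 by (simp add: P_def)
      have "P = P powr \<theta> * P powr (1 - \<theta>)" using P by (simp flip: powr_add)
      also have "\<dots> \<ge> real x powr \<theta> * (real p ^ 2) powr (1 - \<theta>)"
        using 1 2 assms unfolding P_def by (intro mult_mono powr_mono2) auto
      also have "(real p ^ 2) powr (1 - \<theta>) = real p powr (2 * (1 - \<theta>))"
        using p1 powr_powr[of "real p" 2 "1 - \<theta>"] by simp
      finally have "real x powr \<theta> * real p powr (2 * (1 - \<theta>)) \<le> P" .
      moreover have "real x powr \<theta> * real p powr (2 * (1 - \<theta>)) > 0" using x p1 by simp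
      ultimately have "1 / P \<le> 1 / (real x powr \<theta> * real p powr (2 * (1 - \<theta>)))" by (simp add: frac_le)
      moreover have "(1 / real p) ^ Suc (prime_exp x p) = 1 / P"
        unfolding P_def a_def by (rule power_one_over)
      moreover have "real x powr (-\<theta>) * real p powr (- (2 * (1 - \<theta>))) = 1 / (real x powr \<theta> * real p powr (2 * (1 - \<theta>)))"
        by (simp only: powr_minus_divide times_divide_times_eq mult_1)
      ultimately show ?thesis by simp
    qed
    hence "(\<Sum>p\<in>primes_upto x. (1 / real p) ^ Suc (prime_exp x p)) \<le>
       (\<Sum>p\<in>primes_upto x. real x powr (-\<theta>) * real p powr (- (2 * (1 - \<theta>))))" by (rule sum_mono)
    also have "\<dots> = real x powr (-\<theta>) * (\<Sum>p\<in>primes_upto x. real p powr (- (2 * (1 - \<theta>))))"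
      by (rule sum_distrib_left[symmetric])
    also have "\<dots> \<le> real x powr (-\<theta>) * C"
      unfolding C_def by (intro mult_left_mono sum_le_suminf[OF sm]) auto
    finally show "(\<Sum>p\<in>primes_upto x. (1 / real p) ^ Suc (prime_exp x p)) \<le> C * real x powr (-\<theta>)"
      by (simp add: mult_ac)
  qed
qed

section \<open>The exponential integral\<close>

definition ein_kernel :: "real \<Rightarrow> real" where
  "ein_kernel u = (if u = 0 then 1 else (1 - exp (-u)) / u)"

lemma isCont_ein_kernel: "isCont ein_kernel x"
proof (cases "x = 0")
  case True
  have "((\<lambda>u::real. (1 - exp (-u)) / u) \<longlongrightarrow> 1) (at 0)" by real_asymp
  moreover have "\<forall>\<^sub>F u in at 0. ein_kernel u = (1 - exp (-u)) / u"
    by (auto simp: ein_kernel_def eventually_at_filter)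
  ultimately have "(ein_kernel \<longlongrightarrow> 1) (at 0)" by (simp add: tendsto_cong)
  thus ?thesis by (simp add: isCont_def True ein_kernel_def)
next
  case False
  have "isCont (\<lambda>u. (1 - exp (-u)) / u) x" using False by (intro continuous_intros) auto
  moreover have "\<forall>\<^sub>F u in nhds x. ein_kernel u = (1 - exp (-u)) / u"
    using t1_space_nhds[OF False] by eventually_elim (auto simp: ein_kernel_def)
  ultimately show ?thesis using isCont_cong by fastforce
qed

lemma continuous_on_ein_kernel: "continuous_on S ein_kernel"
  using isCont_ein_kernel by (simp add: continuous_at_imp_continuous_on)

lemma ein_kernel_bounds: "u \<ge> 0 \<Longrightarrow> 0 \<le> ein_kernel u \<and> ein_kernel u \<le> 1"
proof (cases "u = 0")
  case False
  assume "u \<ge> 0"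
  moreover have "1 - u \<le> exp (-u)" using exp_ge_add_one_self[of "-u"] by simp
  ultimately show ?thesis using False by (auto simp: ein_kernel_def field_simps)
qed (simp add: ein_kernel_def)

text \<open>The entire exponential integral \<open>Ein\<close>; it equals \<open>ln t + \<gamma> + E\<^sub>1 t\<close> for \<open>t > 0\<close>.\<close>

definition Ein :: "real \<Rightarrow> real" where
  "Ein t = integral {0..t} ein_kernel"

lemma Ein_0 [simp]: "Ein 0 = 0" by (simp add: Ein_def)

lemma Ein_derivative_within:
  "t \<in> {0..b} \<Longrightarrow> (Ein has_real_derivative ein_kernel t) (at t within {0..b})"
  unfolding Ein_def by (rule integral_has_real_derivative[OF continuous_on_ein_kernel])

lemma Ein_derivative: "t > 0 \<Longrightarrow> (Ein has_real_derivative ein_kernel t) (at t)"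
  using Ein_derivative_within[of t "t + 1"] by (simp add: at_within_Icc_at)

lemma continuous_on_Ein: "continuous_on {0..b} Ein"
  using Ein_derivative_within DERIV_continuous_on by blast

lemma Ein_bounds: assumes "t \<ge> 0" shows "0 \<le> Ein t \<and> Ein t \<le> t"
proof -
  have int: "ein_kernel integrable_on {0..t}" by (intro integrable_continuous_interval continuous_on_ein_kernel)
  have "0 \<le> Ein t" unfolding Ein_def by (rule integral_nonneg[OF int]) (use ein_kernel_bounds in auto)
  moreover have "Ein t \<le> integral {0..t} (\<lambda>_. 1)" unfolding Ein_def
    by (rule integral_le[OF int]) (use ein_kernel_bounds in auto)
  ultimately show ?thesis using assms by simp
qed

text \<open>The derivative is - exp (- x) / x. This passes a lower bound at large arguments on to
  all smaller ones.\<close>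

lemma Ein_minus_ln_antimono:
  assumes "0 < s" "s \<le> t" shows "Ein t - ln t \<le> Ein s - ln s"
proof (rule DERIV_nonpos_imp_nonincreasing[OF assms(2)])
  fix x assume "s \<le> x" "x \<le> t"
  hence x: "x > 0" using assms by simp
  show "\<exists>y. ((\<lambda>t. Ein t - ln t) has_real_derivative y) (at x) \<and> y \<le> 0"
  proof (intro exI conjI)
    show "((\<lambda>t. Ein t - ln t) has_real_derivative (ein_kernel x - 1 / x)) (at x)"
      using x by (auto intro!: derivative_eq_intros Ein_derivative)
    show "ein_kernel x - 1 / x \<le> 0" using x by (simp add: ein_kernel_def field_simps)
  qed
qed

text \<open>Replacing exp (- u) by the larger (1 + u / n) powr (- n) makes the kernel rational with
  an elementary primitive \<open>G\<close>; the right-hand side is G v - G 0, the harmonic sum being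
  - G 0.\<close>

lemma Ein_ge_aux:
  assumes n: "n > 0" and v: "v > 0"
  shows "Ein v \<ge> ln (1 + v / real n) + (\<Sum>j\<in>{1..<n}. 1 / real j) - (\<Sum>j\<in>{1..<n}. (1 / (1 + v / real n)) ^ j / real j)"
proof -
  define G where "G = (\<lambda>v. ln (1 + v / real n) - (\<Sum>j\<in>{1..<n}. (1 / (1 + v / real n)) ^ j / real j))"
  have G_deriv: "(G has_real_derivative (1 - (1 / (1 + x / real n)) ^ n) / x) (at x)" if x: "x > 0" for x
  proof -
    define w where "w = 1 / (1 + x / real n)"
    have pos: "1 + x / real n > 0" using x n by (simp add: add_pos_nonneg)
    have w: "w > 0" "w < 1" using x n pos by (auto simp: w_def field_simps)
    have winv: "1 + x / real n = 1 / w" by (simp add: w_def)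
    have dinv: "((\<lambda>x. 1 / (1 + x / real n)) has_real_derivative (- (w ^ 2) / real n)) (at x)"
      using pos n by (auto intro!: derivative_eq_intros simp: w_def power2_eq_square divide_simps)
    have dj: "((\<lambda>x. (1 / (1 + x / real n)) ^ j / real j) has_real_derivative (- (w ^ (j + 1)) / real n)) (at x)"
      if j: "j \<in> {1..<n}" for j
    proof -
      have "((\<lambda>x. (1 / (1 + x / real n)) ^ j / real j) has_real_derivative
          (real j * (1 / (1 + x / real n)) ^ (j - 1) * (- (w ^ 2) / real n)) / real j) (at x)"
        by (rule DERIV_cdivide[OF DERIV_cong[OF DERIV_power[OF dinv]]]) (simp add: w_def mult_ac)
      also have "(real j * (1 / (1 + x / real n)) ^ (j - 1) * (- (w ^ 2) / real n)) / real j = - (w ^ (j + 1)) / real n"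
      proof -
        obtain i where i: "j = Suc i" using j by (cases j) auto
        show ?thesis unfolding i by (simp add: w_def[symmetric] power2_eq_square)
      qed
      finally show ?thesis .
    qed
    have dl: "((\<lambda>x. ln (1 + x / real n)) has_real_derivative (w / real n)) (at x)"
      using pos n by (auto intro!: derivative_eq_intros simp: w_def)
    have "(G has_real_derivative (w / real n - (\<Sum>j\<in>{1..<n}. - (w ^ (j + 1)) / real n))) (at x)"
      unfolding G_def by (intro DERIV_diff dl DERIV_sum dj)
    also have "w / real n - (\<Sum>j\<in>{1..<n}. - (w ^ (j + 1)) / real n) = (w / real n) * (\<Sum>j<n. w ^ j)"
    proof -
      have "(\<Sum>j<n. w ^ j) = 1 + (\<Sum>j\<in>{1..<n}. w ^ j)"
        using n by (simp add: lessThan_atLeast0 sum.atLeast_Suc_lessThan)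
      thus ?thesis by (simp add: ring_distribs sum_distrib_left sum_negf sum_divide_distrib)
    qed
    also have "(\<Sum>j<n. w ^ j) = (1 - w ^ n) / (1 - w)" using w by (simp add: sum_gp_strict)
    also have "(w / real n) * ((1 - w ^ n) / (1 - w)) = (1 - w ^ n) / x"
    proof -
      have "1 - w = w * x / real n" using pos n by (simp add: w_def divide_simps)
      thus ?thesis using w x n by simp
    qed
    finally show ?thesis by (simp add: w_def)
  qed
  have cont: "continuous_on {0..v} (\<lambda>v. Ein v - G v)"
  proof -
    have "1 + x / real n > 0" if "x \<in> {0..v}" for x using that by (auto intro: add_pos_nonneg)
    hence "\<forall>x\<in>{0..v}. 1 + x / real n > 0" by blast
    moreover from this have "\<forall>x\<in>{0..v}. 1 + x / real n \<noteq> 0" by (metis less_irrefl)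
    ultimately show ?thesis unfolding G_def using n
      by (intro continuous_intros continuous_on_Ein) auto
  qed
  have deriv: "((\<lambda>v. Ein v - G v) has_real_derivative (ein_kernel x - (1 - (1 / (1 + x / real n)) ^ n) / x)) (at x)" if "x > 0" for x
    by (intro DERIV_diff Ein_derivative G_deriv that)
  obtain l z where z: "0 < z" "((\<lambda>v. Ein v - G v) has_real_derivative l) (at z)"
    "(Ein v - G v) - (Ein 0 - G 0) = (v - 0) * l"
    using MVT[OF v cont] deriv by (auto simp: real_differentiable_def)
  have l: "l = ein_kernel z - (1 - (1 / (1 + z / real n)) ^ n) / z"
    by (rule DERIV_unique[OF z(2) deriv[OF z(1)]])
  have pos: "1 + z / real n > 0" using z n by (simp add: add_pos_nonneg)
  have "1 + z / real n \<le> exp (z / real n)" by (rule exp_ge_add_one_self)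
  hence "(1 + z / real n) ^ n \<le> exp (z / real n) ^ n" using pos by (intro power_mono) auto
  also have "\<dots> = exp z" using n by (simp flip: exp_of_nat_mult)
  finally have "1 / exp z \<le> 1 / (1 + z / real n) ^ n" using pos by (intro divide_left_mono) auto
  hence "exp (-z) \<le> (1 / (1 + z / real n)) ^ n" by (simp add: exp_minus power_one_over field_simps)
  hence "l \<ge> 0" using z(1) by (simp add: l ein_kernel_def divide_right_mono)
  hence "0 \<le> (Ein v - G v) - (Ein 0 - G 0)" unfolding z(3) using v by simp
  thus ?thesis by (simp add: G_def)
qed

text \<open>At v = n^2 the auxiliary bound gives at least ln v + (harm n - ln n) - 2 / n.
  Monotonicity of Ein - ln brings this down to t, and n tends to infinity.\<close>

lemma Ein_ge: assumes t: "t > 0" shows "Ein t \<ge> ln t + euler_mascheroni"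
proof -
  have ev: "\<forall>\<^sub>F n in sequentially. (harm n - ln (real n)) - 2 / real n \<le> Ein t - ln t"
  proof -
    have "\<forall>\<^sub>F n in sequentially. real n \<ge> t" using filterlim_real_sequentially by (simp add: filterlim_at_top)
    moreover have "\<forall>\<^sub>F n in sequentially. n > (0::nat)" by (rule eventually_gt_at_top)
    ultimately show ?thesis
    proof eventually_elim
      case (elim n)
      \<comment> \<open>With v = n^2 the quotient v / n = n still tends to infinity: the sum of
        powers of w = 1 / (1 + n) is at most 1 / n, and ln (1 + v / n) is at least ln v - ln
        n.\<close>
      define v where "v = real n * real n"
      have n1: "real n \<ge> 1" using elim by simp
      have v: "v > 0" using elim by (simp add: v_def)
      have "real n \<le> v" using n1 mult_left_mono[of 1 "real n" "real n"] by (simp add: v_def)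
      hence tv: "t \<le> v" using elim by simp
      have vn: "v / real n = real n" using elim by (simp add: v_def)
      define w where "w = 1 / (1 + real n)"
      have w: "0 < w" "w < 1" using n1 by (auto simp: w_def)
      have sw: "(\<Sum>j\<in>{1..<n}. w ^ j / real j) \<le> 1 / real n"
      proof -
        have "(\<Sum>j\<in>{1..<n}. w ^ j / real j) \<le> (\<Sum>j\<in>{1..<n}. w ^ j)"
          using w by (intro sum_mono) (auto simp: field_simps mult_le_cancel_left1)
        also have "\<dots> = (\<Sum>j<n. w ^ j) - 1"
          using elim by (simp add: lessThan_atLeast0 sum.atLeast_Suc_lessThan)
        also have "(\<Sum>j<n. w ^ j) = (1 - w ^ n) / (1 - w)" using w by (simp add: sum_gp_strict)
        also have "\<dots> \<le> 1 / (1 - w)" using w by (intro divide_right_mono) auto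
        also have "1 / (1 - w) - 1 = 1 / real n" using n1 by (simp add: w_def field_simps)
        finally show ?thesis by simp
      qed
      have h: "(\<Sum>j\<in>{1..<n}. 1 / real j) = harm n - 1 / real n"
      proof -
        have "harm n = (\<Sum>j\<in>insert n {1..<n}. 1 / real j)"
          unfolding harm_def using elim by (intro sum.cong) (auto simp: divide_inverse)
        thus ?thesis by simp
      qed
      have "ln v = 2 * ln (real n)" using elim by (simp add: v_def ln_mult)
      moreover have "ln (real n) \<le> ln (1 + real n)" using n1 by simp
      moreover have "ln (1 + real n) + (harm n - 1 / real n) - (\<Sum>j\<in>{1..<n}. w ^ j / real j) \<le> Ein v"
        using Ein_ge_aux[OF elim(2) v] unfolding vn h w_def[symmetric] .
      moreover have "2 / real n = 1 / real n + 1 / real n" by simp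
      ultimately have "(harm n - ln (real n)) - 2 / real n \<le> Ein v - ln v"
        using sw by linarith
      also have "\<dots> \<le> Ein t - ln t" by (rule Ein_minus_ln_antimono[OF t tv])
      finally show ?case .
    qed
  qed
  have "(\<lambda>n. (harm n - ln (real n)) - 2 / real n) \<longlonglongrightarrow> euler_mascheroni - 0"
    by (intro tendsto_diff euler_mascheroni_LIMSEQ) real_asymp
  from tendsto_upperbound[OF this ev] show ?thesis by simp
qed

text \<open>Puts \<open>Ein t\<close> on a fixed interval of integration, so that the integrations
  can be exchanged in its transform.\<close>

lemma Ein_stretch:
  assumes "t \<ge> 0"
  shows "((\<lambda>y. t * ein_kernel (t * y)) has_integral Ein t) {0..1}"
proof -
  have "((\<lambda>y. t * ein_kernel (t * y)) has_integral (Ein (t * 1) - Ein (t * 0))) {0..1}"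
  proof (rule fundamental_theorem_of_calculus)
    fix y :: real assume y: "y \<in> {0..1}"
    have ty: "t * y \<in> {0..t}" using y assms by (auto simp: mult_left_le)
    have "((\<lambda>y. Ein (t * y)) has_real_derivative (ein_kernel (t * y) * t)) (at y within {0..1})"
    proof (rule DERIV_image_chain[where g = "\<lambda>y. t * y" and f = Ein, unfolded o_def])
      show "(Ein has_real_derivative ein_kernel (t * y)) (at (t * y) within (\<lambda>y. t * y) ` {0..1})"
        by (rule has_field_derivative_subset[OF Ein_derivative_within[OF ty]]) (use assms in \<open>auto simp: mult_left_le\<close>)
    qed (auto intro!: derivative_eq_intros)
    thus "((\<lambda>y. Ein (t * y)) has_vector_derivative (t * ein_kernel (t * y))) (at y within {0..1})"
      by (simp add: has_real_derivative_iff_has_vector_derivative mult_ac)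
  qed simp
  thus ?thesis by simp
qed

section \<open>The Laplace transform of t * Ein t\<close>

lemma nn_integral_mult_exp:
  assumes "s > (0::real)" "0 \<le> a"
  shows "(\<integral>\<^sup>+t. ennreal (t * exp (- s * t)) * indicator {a..} t \<partial>lborel) = ennreal ((a / s + 1 / s\<^sup>2) * exp (- s * a))"
proof -
  have "(\<integral>\<^sup>+t. ennreal (t * exp (- s * t)) * indicator {a..} t \<partial>lborel) = ennreal (0 - (- ((a / s + 1 / s\<^sup>2) * exp (- s * a))))"
  proof (rule nn_integral_FTC_atLeast)
    show "((\<lambda>t. - ((t / s + 1 / s\<^sup>2) * exp (- s * t))) has_real_derivative x * exp (- s * x)) (at x)" for x
      using assms by (auto intro!: derivative_eq_intros simp: field_simps power2_eq_square)
    show "((\<lambda>t. - ((t / s + 1 / s\<^sup>2) * exp (- s * t))) \<longlongrightarrow> 0) at_top"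
      using assms by real_asymp
  qed (use assms in auto)
  thus ?thesis by simp
qed

text \<open>By Tonelli the t-integral may come first, and it is (1 / s^2 - 1 / (s + y)^2) / y. The
  result is minus the s-derivative of ln ((s + 1) / s) / s, the transform of Ein.\<close>

lemma Ein_laplace:
  assumes s: "s > 0"
  shows "has_bochner_integral lborel (\<lambda>t. indicator {0..} t * (t * Ein t) * exp (- s * t))
           (ln ((s + 1) / s) / s\<^sup>2 + 1 / (s\<^sup>2 * (s + 1)))"
proof -
  have [measurable]: "ein_kernel \<in> borel_measurable borel"
    by (rule borel_measurable_continuous_onI[OF continuous_on_ein_kernel])
  define w where "w = (\<lambda>t y. t * exp (- s * t) * (t * ein_kernel (t * y)))"
  have w_nn: "w t y \<ge> 0" if "t \<ge> 0" "y \<ge> 0" for t y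
    using that ein_kernel_bounds[of "t * y"] by (simp add: w_def)
  have [measurable]: "(\<lambda>(t,y). w t y) \<in> borel_measurable (borel \<Otimes>\<^sub>M borel)" unfolding w_def by measurable
  let ?h = "\<lambda>t y. ennreal (w t y) * indicator {0..1} y * indicator {0..} t"
  have inner: "(\<integral>\<^sup>+y. ennreal (w t y) * indicator {0..1} y \<partial>lborel) = ennreal (t * Ein t * exp (- s * t))" if t: "t \<ge> 0" for t
  proof -
    have "((\<lambda>y. w t y) has_integral (t * exp (- s * t) * Ein t)) {0..1}"
      unfolding w_def by (rule has_integral_mult_right[OF Ein_stretch[OF t]])
    from nn_integral_has_integral_lebesgue'[OF _ this] w_nn t show ?thesis by (simp add: mult_ac)
  qed
  have outer: "(\<integral>\<^sup>+t. ennreal (w t y) * indicator {0..} t \<partial>lborel) = ennreal ((2 * s + y) / (s\<^sup>2 * (s + y)\<^sup>2))" if y: "y > 0" for y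
  proof -
    define A where "A = (\<lambda>c t::real. - ((t / c + 1 / c\<^sup>2) * exp (- c * t)))"
    have A_deriv: "(A c has_real_derivative t * exp (- c * t)) (at t)" if "c > 0" for c t
      unfolding A_def using that by (auto intro!: derivative_eq_intros simp: field_simps power2_eq_square)
    have A_lim: "(A c \<longlongrightarrow> 0) at_top" if "c > 0" for c
      unfolding A_def using that by real_asymp
    define F where "F = (\<lambda>t. (A s t - A (s + y) t) / y)"
    have "(\<integral>\<^sup>+t. ennreal (w t y) * indicator {0..} t \<partial>lborel) = ennreal (0 - F 0)"
    proof (rule nn_integral_FTC_atLeast)
      fix t :: real assume t: "0 \<le> t"
      have "w t y = (t * exp (- s * t) - t * exp (- (s + y) * t)) / y"
      proof (cases "t = 0")
        case False
        hence k: "t * ein_kernel (t * y) = (1 - exp (- (t * y))) / y" using y by (simp add: ein_kernel_def)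
        have "exp (- (s + y) * t) = exp (- s * t) * exp (- (t * y))" by (simp add: algebra_simps flip: exp_add)
        thus ?thesis unfolding w_def k by (simp add: algebra_simps)
      qed (auto simp: w_def)
      moreover have "(F has_real_derivative (t * exp (- s * t) - t * exp (- (s + y) * t)) / y) (at t)"
        unfolding F_def by (intro DERIV_cdivide DERIV_diff A_deriv) (use s y in auto)
      ultimately show "(F has_real_derivative w t y) (at t)" by simp
      show "0 \<le> w t y" using w_nn t y by simp
    next
      have "(F \<longlongrightarrow> (0 - 0) / y) at_top"
        unfolding F_def by (intro tendsto_divide tendsto_diff A_lim tendsto_const) (use s y in auto)
      thus "(F \<longlongrightarrow> 0) at_top" by simp
    qed (auto simp: w_def)
    also have "0 - F 0 = (2 * s + y) / (s\<^sup>2 * (s + y)\<^sup>2)"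
    proof -
      have "0 - F 0 = (1 / s\<^sup>2 - 1 / (s + y)\<^sup>2) / y" by (simp add: F_def A_def minus_divide_left)
      also have "1 / s\<^sup>2 - 1 / (s + y)\<^sup>2 = ((s + y)\<^sup>2 - s\<^sup>2) / (s\<^sup>2 * (s + y)\<^sup>2)"
        using s y by (simp add: diff_frac_eq)
      also have "(s + y)\<^sup>2 - s\<^sup>2 = y * (2 * s + y)" by (simp add: power2_eq_square algebra_simps)
      finally show ?thesis using y by simp
    qed
    finally show ?thesis .
  qed
  have "(\<integral>\<^sup>+t. ennreal (indicator {0..} t * (t * Ein t) * exp (- s * t)) \<partial>lborel) =
        (\<integral>\<^sup>+t. (\<integral>\<^sup>+y. ?h t y \<partial>lborel) \<partial>lborel)"
  proof (rule nn_integral_cong)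
    fix t :: real
    show "ennreal (indicator {0..} t * (t * Ein t) * exp (- s * t)) = (\<integral>\<^sup>+y. ?h t y \<partial>lborel)"
      using inner[of t] by (cases "t \<ge> 0") auto
  qed
  also have "\<dots> = (\<integral>\<^sup>+y. (\<integral>\<^sup>+t. ?h t y \<partial>lborel) \<partial>lborel)"
    by (rule lborel_pair.Fubini') measurable
  also have "\<dots> = (\<integral>\<^sup>+y. ennreal ((2 * s + y) / (s\<^sup>2 * (s + y)\<^sup>2)) * indicator {0..1} y \<partial>lborel)"
  proof (rule nn_integral_cong_AE)
    \<comment> \<open>The inner integral was computed with a division by y, so the null set y = 0 is
      discarded.\<close>
    have "AE y in lborel. y \<noteq> (0::real)" by (rule AE_lborel_singleton)
    thus "AE y in lborel. (\<integral>\<^sup>+t. ?h t y \<partial>lborel) =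
      ennreal ((2 * s + y) / (s\<^sup>2 * (s + y)\<^sup>2)) * indicator {0..1} y"
    proof eventually_elim
      case (elim y)
      show ?case using outer[of y] elim by (cases "y \<in> {0..1}") auto
    qed
  qed
  also have "\<dots> = ennreal (ln ((s + 1) / s) / s\<^sup>2 + 1 / (s\<^sup>2 * (s + 1)))"
  proof -
    define F where "F = (\<lambda>y. (ln (s + y) - s / (s + y)) / s\<^sup>2)"
    have "((\<lambda>y. (2 * s + y) / (s\<^sup>2 * (s + y)\<^sup>2)) has_integral (F 1 - F 0)) {0..1}"
    proof (rule fundamental_theorem_of_calculus)
      fix y :: real assume "y \<in> {0..1}"
      hence y: "y \<ge> 0" by simp
      have "(F has_real_derivative (1 / (s + y) + s / (s + y)\<^sup>2) / s\<^sup>2) (at y within {0..1})"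
        unfolding F_def using s y by (auto intro!: derivative_eq_intros simp: power2_eq_square)
      also have "(1 / (s + y) + s / (s + y)\<^sup>2) / s\<^sup>2 = (2 * s + y) / (s\<^sup>2 * (s + y)\<^sup>2)"
        using s y by (simp add: divide_simps power2_eq_square) (simp add: algebra_simps)?
      finally show "(F has_vector_derivative (2 * s + y) / (s\<^sup>2 * (s + y)\<^sup>2)) (at y within {0..1})"
        by (simp add: has_real_derivative_iff_has_vector_derivative)
    qed simp
    from nn_integral_has_integral_lebesgue'[OF _ this] s
    have "(\<integral>\<^sup>+y. ennreal ((2 * s + y) / (s\<^sup>2 * (s + y)\<^sup>2)) * indicator {0..1} y \<partial>lborel) = ennreal (F 1 - F 0)" by simp
    also have "F 1 - F 0 = ln ((s + 1) / s) / s\<^sup>2 + 1 / (s\<^sup>2 * (s + 1))"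
      using s by (simp add: F_def ln_div divide_simps power2_eq_square) (simp add: algebra_simps)?
    finally show ?thesis .
  qed
  finally have nn: "(\<integral>\<^sup>+t. ennreal (indicator {0..} t * (t * Ein t) * exp (- s * t)) \<partial>lborel) = ennreal (ln ((s + 1) / s) / s\<^sup>2 + 1 / (s\<^sup>2 * (s + 1)))" .
  have cont: "continuous_on {0..} Ein"
    unfolding continuous_on_eq_continuous_within
  proof
    fix t :: real assume t: "t \<in> {0..}"
    have "continuous (at t within {0..t+1}) Ein"
      using continuous_on_Ein[of "t+1"] t by (auto simp: continuous_on_eq_continuous_within)
    moreover have "at t within {0..t+1} = at t within {0..}"
      by (rule at_within_nhd[of _ "{t-1<..<t+1}"]) auto
    ultimately show "continuous (at t within {0..}) Ein" by (simp add: continuous_within)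
  qed
  have "(\<lambda>t. indicator {0..} t *\<^sub>R (t * Ein t * exp (- s * t))) \<in> borel_measurable borel"
    by (rule borel_measurable_continuous_on_indicator) (auto intro!: continuous_intros cont)
  hence "(\<lambda>t. indicator {0..} t * (t * Ein t) * exp (- s * t)) \<in> borel_measurable borel"
    by (simp add: mult_ac)
  thus ?thesis
    by (intro has_bochner_integral_nn_integral nn)
       (use s Ein_bounds in \<open>auto simp: indicator_def intro!: add_nonneg_nonneg divide_nonneg_nonneg mult_nonneg_nonneg\<close>)
qed

section \<open>The error term in Mertens' theorem\<close>

lemma le_nat_floor_exp_iff: "0 \<le> t \<Longrightarrow> n \<le> nat \<lfloor>exp t\<rfloor> \<longleftrightarrow> n = 0 \<or> ln (real n) \<le> t"
proof (cases "n = 0")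
  case False
  hence "n \<le> nat \<lfloor>exp t\<rfloor> \<longleftrightarrow> real n \<le> exp t" by (simp add: le_nat_iff le_floor_iff)
  also have "\<dots> \<longleftrightarrow> ln (real n) \<le> t" using False exp_le_cancel_iff[of "ln (real n)" t] by simp
  finally show ?thesis using False by simp
qed auto

text \<open>By Tonelli the n-th summand, present from t = ln n on, contributes c n times the tail
  integral \<open>W (ln n)\<close> of the weight. Nonnegativity yields integrability together with
  the value.\<close>

lemma summatory_laplace:
  fixes c :: "nat \<Rightarrow> real" and w W :: "real \<Rightarrow> real"
  assumes c: "\<And>n. c n \<ge> 0" "c 0 = 0" and [measurable]: "w \<in> borel_measurable borel"
    and w: "\<And>t. t \<ge> 0 \<Longrightarrow> w t \<ge> 0"
    and W: "\<And>a. a \<ge> 0 \<Longrightarrow> (\<integral>\<^sup>+t. ennreal (w t) * indicator {a..} t \<partial>lborel) = ennreal (W a)"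
    and W_nn: "\<And>a. a \<ge> 0 \<Longrightarrow> W a \<ge> 0"
    and sums: "(\<lambda>n. c n * W (ln (real n))) sums S"
  shows "has_bochner_integral lborel (\<lambda>t. indicator {0..} t * (\<Sum>n\<le>nat \<lfloor>exp t\<rfloor>. c n) * w t) S"
proof -
  let ?g = "\<lambda>n t. ennreal (c n) * (ennreal (w t) * indicator {ln (real n)..} t)"
  let ?F = "\<lambda>t. indicator {0..} t * (\<Sum>n\<le>nat \<lfloor>exp t\<rfloor>. c n) * w t"
  have cW: "c n * W (ln (real n)) \<ge> 0" for n
    using c W_nn by (cases "n = 0") auto
  have S: "S \<ge> 0" using sums_le[OF _ sums_zero sums] cW by simp
  have "(\<integral>\<^sup>+t. ennreal (?F t) \<partial>lborel) =
        (\<integral>\<^sup>+t. (\<Sum>n. ?g n t) \<partial>lborel)"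
  proof (rule nn_integral_cong)
    fix t :: real
    show "ennreal (?F t) = (\<Sum>n. ?g n t)"
    proof (cases "t \<ge> 0")
      case True
      have "(\<Sum>n. ?g n t) =
            (\<Sum>n\<le>nat \<lfloor>exp t\<rfloor>. ?g n t)"
        by (rule suminf_finite) (use True c le_nat_floor_exp_iff[of t] in \<open>auto simp: indicator_def\<close>)
      also have "\<dots> = (\<Sum>n\<le>nat \<lfloor>exp t\<rfloor>. ennreal (c n * w t))"
      proof (rule sum.cong[OF refl])
        fix n assume "n \<in> {..nat \<lfloor>exp t\<rfloor>}"
        thus "?g n t = ennreal (c n * w t)"
          using True c w le_nat_floor_exp_iff[of t n] by (cases "n = 0") (auto simp: ennreal_mult)
      qed
      also have "\<dots> = ennreal (\<Sum>n\<le>nat \<lfloor>exp t\<rfloor>. c n * w t)"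
        using True c w by (intro sum_ennreal) auto
      finally show ?thesis using True by (simp add: sum_distrib_right)
    next
      case False
      have "?g n t = 0" for n
      proof (cases "n = 0")
        case n: False
        hence "ln (real n) \<ge> 0" by simp
        thus ?thesis using False by (auto simp: indicator_def)
      qed (use c in auto)
      hence "(\<lambda>n. ?g n t) = (\<lambda>n. 0)" by blast
      thus ?thesis using False by (simp only:) simp
    qed
  qed
  also have "\<dots> = (\<Sum>n. \<integral>\<^sup>+t. ?g n t \<partial>lborel)"
    by (rule nn_integral_suminf) measurable
  also have "\<dots> = (\<Sum>n. ennreal (c n * W (ln (real n))))"
  proof (rule suminf_cong)
    fix n
    have "(\<integral>\<^sup>+t. ?g n t \<partial>lborel) =
       ennreal (c n) * (\<integral>\<^sup>+t. ennreal (w t) * indicator {ln (real n)..} t \<partial>lborel)"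
      by (rule nn_integral_cmult) measurable
    also have "\<dots> = ennreal (c n * W (ln (real n)))"
      using c W W_nn by (cases "n = 0") (auto simp: ennreal_mult)
    finally show "(\<integral>\<^sup>+t. ?g n t \<partial>lborel) = ennreal (c n * W (ln (real n)))" .
  qed
  also have "\<dots> = ennreal S" using suminf_ennreal_eq[OF cW sums] .
  finally have nn: "(\<integral>\<^sup>+t. ennreal (?F t) \<partial>lborel) = ennreal S" .
  have [measurable]: "(\<lambda>t::real. \<Sum>n\<le>nat \<lfloor>exp t\<rfloor>. c n) \<in> borel_measurable borel"
  proof (rule measurable_compose[of "\<lambda>t::real. \<lfloor>exp t\<rfloor>" borel "count_space UNIV" "\<lambda>N. \<Sum>n\<le>nat N. c n"])
    have "(exp :: real \<Rightarrow> real) \<in> borel_measurable borel" by measurable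
    thus "(\<lambda>t::real. \<lfloor>exp t\<rfloor>) \<in> borel \<rightarrow>\<^sub>M count_space UNIV"
      by (rule measurable_compose[OF _ measurable_real_floor])
  qed simp
  show ?thesis
    by (rule has_bochner_integral_nn_integral[OF _ _ S nn])
       (use w c in \<open>auto simp: indicator_def intro!: mult_nonneg_nonneg sum_nonneg\<close>)
qed

lemma nn_integral_exp_atLeast:
  assumes "s > (0::real)"
  shows "(\<integral>\<^sup>+t. ennreal (exp (- s * t)) * indicator {a..} t \<partial>lborel) = ennreal (exp (- s * a) / s)"
proof -
  have "(\<integral>\<^sup>+t. ennreal (exp (- s * t)) * indicator {a..} t \<partial>lborel) = ennreal (0 - (- exp (- s * a) / s))"
  proof (rule nn_integral_FTC_atLeast)
    show "((\<lambda>t. - exp (- s * t) / s) has_real_derivative exp (- s * x)) (at x)" for x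
      using assms by (auto intro!: derivative_eq_intros)
    show "((\<lambda>t. - exp (- s * t) / s) \<longlongrightarrow> 0) at_top" using assms by real_asymp
  qed auto
  thus ?thesis by simp
qed

lemma exp_laplace:
  assumes "s > (0::real)"
  shows "has_bochner_integral lborel (\<lambda>t. indicator {0..} t * exp (- s * t)) (1 / s)"
proof (rule has_bochner_integral_nn_integral)
  have "(\<integral>\<^sup>+t. ennreal (indicator {0..} t * exp (- s * t)) \<partial>lborel) =
        (\<integral>\<^sup>+t. ennreal (exp (- s * t)) * indicator {0..} t \<partial>lborel)"
    by (intro nn_integral_cong) (auto simp: indicator_def)
  thus "(\<integral>\<^sup>+t. ennreal (indicator {0..} t * exp (- s * t)) \<partial>lborel) = ennreal (1 / s)"
    using nn_integral_exp_atLeast[OF assms, of 0] by simp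
qed (use assms in auto)

lemma mult_exp_laplace:
  assumes "s > (0::real)"
  shows "has_bochner_integral lborel (\<lambda>t. indicator {0..} t * t * exp (- s * t)) (1 / s\<^sup>2)"
proof (rule has_bochner_integral_nn_integral)
  have "(\<integral>\<^sup>+t. ennreal (indicator {0..} t * t * exp (- s * t)) \<partial>lborel) =
        (\<integral>\<^sup>+t. ennreal (t * exp (- s * t)) * indicator {0..} t \<partial>lborel)"
    by (intro nn_integral_cong) (auto simp: indicator_def)
  thus "(\<integral>\<^sup>+t. ennreal (indicator {0..} t * t * exp (- s * t)) \<partial>lborel) = ennreal (1 / s\<^sup>2)"
    using nn_integral_mult_exp[OF assms, of 0] by simp
qed (use assms in \<open>auto simp: indicator_def\<close>)

text \<open>This is \<open>ln x * (msum x - Ein (ln x) - (psi x - x + 1) / (x * ln x))\<close> at \<open>x = exp t\<close>. By \<open>Ein_ge\<close> and the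
  tangent of \<open>ln \<circ> ln\<close> at \<open>x\<close>, the second factor is at most \<open>msum x - \<gamma> - ln (ln (psi x))\<close>; the
  \<open>+ 1\<close> removes the singularity at \<open>x = 1\<close>.\<close>

definition mertens_error :: "real \<Rightarrow> real" where
  "mertens_error t = indicator {0..} t * (t * msum (nat \<lfloor>exp t\<rfloor>) - t * Ein t
     - psi (nat \<lfloor>exp t\<rfloor>) * exp (- t) + 1 - exp (- t))"

text \<open>\<open>l\<close> and \<open>G\<close> are log zeta and - zeta' / zeta at 1 + s, and the
  factor exp (- t) at psi moves its transform to s + 1. The computation stays on the real axis; the
  complex variable enters later through the identity theorem.\<close>

lemma mertens_error_laplace:
  assumes s: "s > 0"
    and l: "(\<lambda>n. mcoef n * real n powr (-(1+s))) sums l"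
    and G: "(\<lambda>n. mangoldt n * real n powr (-(1+s))) sums G"
  shows "has_bochner_integral lborel (\<lambda>t. mertens_error t * exp (- s * t))
    ((ln s + l - ln (s + 1) + (G * s + s - 1) / (s + 1)) / s\<^sup>2)"
proof -
  have pw: "exp (- s * ln (real n)) / real n = real n powr (-(1+s))" if "n > 0" for n
    using that by (simp add: powr_def exp_add exp_diff exp_minus field_simps)
  have 1: "has_bochner_integral lborel (\<lambda>t. indicator {0..} t * (\<Sum>n\<le>nat \<lfloor>exp t\<rfloor>. mcoef n / real n) * (t * exp (- s * t))) (G / s + l / s\<^sup>2)"
  proof (rule summatory_laplace)
    fix a :: real assume "a \<ge> 0"
    thus "(\<integral>\<^sup>+t. ennreal (t * exp (- s * t)) * indicator {a..} t \<partial>lborel) = ennreal ((a / s + 1 / s\<^sup>2) * exp (- s * a))"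
      by (rule nn_integral_mult_exp[OF s])
  next
    have "(\<lambda>n. (mangoldt n * real n powr (-(1+s))) / s + (mcoef n * real n powr (-(1+s))) / s\<^sup>2) sums (G / s + l / s\<^sup>2)"
      by (intro sums_add sums_divide l G)
    also have "(\<lambda>n. (mangoldt n * real n powr (-(1+s))) / s + (mcoef n * real n powr (-(1+s))) / s\<^sup>2) =
       (\<lambda>n. mcoef n / real n * ((ln (real n) / s + 1 / s\<^sup>2) * exp (- s * ln (real n))))"
    proof
      fix n show "(mangoldt n * real n powr (-(1+s))) / s + (mcoef n * real n powr (-(1+s))) / s\<^sup>2 =
         mcoef n / real n * ((ln (real n) / s + 1 / s\<^sup>2) * exp (- s * ln (real n)))"
      proof (cases "n = 0")
        case False
        hence n: "n > 0" by simp
        show ?thesis unfolding pw[OF n, symmetric] mcoef_mult_ln[symmetric] by (simp add: algebra_simps)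
      qed simp
    qed
    finally show "(\<lambda>n. mcoef n / real n * ((ln (real n) / s + 1 / s\<^sup>2) * exp (- s * ln (real n)))) sums (G / s + l / s\<^sup>2)" .
  qed (use s mcoef_nonneg in auto)
  have 3: "has_bochner_integral lborel (\<lambda>t. indicator {0..} t * (\<Sum>n\<le>nat \<lfloor>exp t\<rfloor>. mangoldt n) * exp (- (s + 1) * t)) (G / (s + 1))"
  proof (rule summatory_laplace)
    fix a :: real assume "a \<ge> 0"
    show "(\<integral>\<^sup>+t. ennreal (exp (- (s + 1) * t)) * indicator {a..} t \<partial>lborel) = ennreal (exp (- (s + 1) * a) / (s + 1))"
      by (rule nn_integral_exp_atLeast) (use s in auto)
  next
    have "(\<lambda>n. (mangoldt n * real n powr (-(1+s))) / (s + 1)) sums (G / (s + 1))"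
      by (intro sums_divide G)
    also have "(\<lambda>n. (mangoldt n * real n powr (-(1+s))) / (s + 1)) = (\<lambda>n. mangoldt n * (exp (- (s + 1) * ln (real n)) / (s + 1)))"
    proof
      fix n show "(mangoldt n * real n powr (-(1+s))) / (s + 1) = mangoldt n * (exp (- (s + 1) * ln (real n)) / (s + 1))"
        by (cases "n = 0") (auto simp: powr_def algebra_simps)
    qed
    finally show "(\<lambda>n. mangoldt n * (exp (- (s + 1) * ln (real n)) / (s + 1))) sums (G / (s + 1))" .
  qed (use s mangoldt_nonneg in auto)
  have 4: "has_bochner_integral lborel (\<lambda>t. indicator {0..} t * exp (- (s + 1) * t)) (1 / (s + 1))"
    by (rule exp_laplace) (use s in auto)
  let ?f = "\<lambda>t. indicator {0..} t * (\<Sum>n\<le>nat \<lfloor>exp t\<rfloor>. mcoef n / real n) * (t * exp (- s * t))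
      - indicator {0..} t * (t * Ein t) * exp (- s * t)
      - indicator {0..} t * (\<Sum>n\<le>nat \<lfloor>exp t\<rfloor>. mangoldt n) * exp (- (s + 1) * t)
      + indicator {0..} t * exp (- s * t) - indicator {0..} t * exp (- (s + 1) * t)"
  have "has_bochner_integral lborel ?f
    (G / s + l / s\<^sup>2 - (ln ((s + 1) / s) / s\<^sup>2 + 1 / (s\<^sup>2 * (s + 1))) - G / (s + 1) + 1 / s - 1 / (s + 1))"
    by (intro has_bochner_integral_diff has_bochner_integral_add 1 3 4 Ein_laplace exp_laplace s)
  also have "?f = (\<lambda>t. mertens_error t * exp (- s * t))"
  proof
    fix t
    have "exp (- (s + 1) * t) = exp (- t) * exp (- s * t)" by (simp add: algebra_simps flip: exp_add)
    thus "?f t = mertens_error t * exp (- s * t)"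
      unfolding mertens_error_def msum_def psi_def by (simp only:) (simp add: algebra_simps)
  qed
  also have "G / s + l / s\<^sup>2 - (ln ((s + 1) / s) / s\<^sup>2 + 1 / (s\<^sup>2 * (s + 1))) - G / (s + 1) + 1 / s - 1 / (s + 1) =
      (ln s + l - ln (s + 1) + (G * s + s - 1) / (s + 1)) / s\<^sup>2"
    using s by (simp add: ln_div divide_simps power2_eq_square) (simp add: algebra_simps)
  finally show ?thesis .
qed

section \<open>The transform in a complex variable and its continuation past 0\<close>

lemma laplace_of_real: "laplace g (of_real x) = of_real (\<integral>t. g t * exp (- x * t) \<partial>lborel)"
proof -
  have "laplace g (of_real x) = (\<integral>t. complex_of_real (g t * exp (- x * t)) \<partial>lborel)"
    unfolding laplace_def by (intro Bochner_Integration.integral_cong) (auto simp: exp_of_real[symmetric])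
  thus ?thesis by (simp only: integral_complex_of_real)
qed

text \<open>The logarithmic derivative of s zeta (1 + s), hence regular at s = 0.\<close>

definition zeta_logd :: "complex \<Rightarrow> complex" where
  "zeta_logd s = deriv zeta_reg (1 + s) / zeta_reg (1 + s)"

text \<open>s^2 times the transform. The logarithm is a parameter because only its existence and
  some of its properties are exported below.\<close>

definition laplace_num :: "(complex \<Rightarrow> complex) \<Rightarrow> complex \<Rightarrow> complex" where
  "laplace_num l s = l s - Ln (s + 1) - s * zeta_logd s / (s + 1) + s / (s + 1)"

text \<open>Take l s = Ln s + log zeta (1 + s), where Ln s compensates the pole. Its reality on the
  positive axis is recorded to fix the branch in the limit at 0.\<close>

lemma log_zeta_reg_transform:
  obtains l :: "complex \<Rightarrow> complex" where
    "\<And>s. Re s > 0 \<Longrightarrow> (l has_field_derivative zeta_logd s) (at s)"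
    "\<And>s. Re s > 0 \<Longrightarrow> exp (l s) = zeta_reg (1 + s)"
    "\<And>x::real. x > 0 \<Longrightarrow> Im (l (of_real x)) = 0"
    "\<And>x::real. x > 0 \<Longrightarrow> laplace_conv mertens_error x"
    "\<And>x::real. x > 0 \<Longrightarrow> laplace mertens_error (of_real x) * (of_real x)\<^sup>2 = laplace_num l (of_real x)"
proof -
  obtain L L' where L:
    "\<And>s. Re s > 1 \<Longrightarrow> (\<lambda>n. of_real (mcoef n) * of_nat n powr (-s)) sums L s"
    "\<And>s. Re s > 1 \<Longrightarrow> (\<lambda>n. of_real (mangoldt n) * of_nat n powr (-s)) sums (- L' s)"
    "\<And>s. Re s > 1 \<Longrightarrow> (L has_field_derivative L' s) (at s)"
    "\<And>s. Re s > 1 \<Longrightarrow> zeta s = exp (L s)"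
    by (rule log_zeta) blast
  define l where "l = (\<lambda>s. Ln s + L (1 + s))"
  have Zexp: "zeta_reg w = (w - 1) * exp (L w)" if "Re w > 1" for w
  proof -
    have "w \<noteq> 1" using that by auto
    thus ?thesis using zeta_reg_eq_zeta L(4)[OF that] by simp
  qed
  have zeta_logd: "zeta_logd s = 1 / s + L' (1 + s)" if "Re s > 0" for s
  proof -
    have s0: "s \<noteq> 0" using that by auto
    have r: "Re (1 + s) > 1" using that by simp
    have "((\<lambda>w. (w - 1) * exp (L w)) has_field_derivative (exp (L (1 + s)) + s * (exp (L (1 + s)) * L' (1 + s)))) (at (1 + s))"
      by (auto intro!: derivative_eq_intros L(3)[OF r])
    hence "(zeta_reg has_field_derivative (exp (L (1 + s)) + s * (exp (L (1 + s)) * L' (1 + s)))) (at (1 + s))"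
      by (rule has_field_derivative_transform_within_open[OF _ open_halfspace_Re_gt[of 1]]) (use r Zexp in auto)
    hence "deriv zeta_reg (1 + s) = exp (L (1 + s)) + s * (exp (L (1 + s)) * L' (1 + s))" by (rule DERIV_imp_deriv)
    thus ?thesis using s0 Zexp[OF r] by (simp add: zeta_logd_def field_simps)
  qed
  have l_deriv: "(l has_field_derivative zeta_logd s) (at s)" if "Re s > 0" for s
  proof -
    have r: "Re (1 + s) > 1" and ns: "s \<notin> \<real>\<^sub>\<le>\<^sub>0" using that by (auto simp: complex_nonpos_Reals_iff)
    have "((\<lambda>s. L (1 + s)) has_field_derivative L' (1 + s)) (at s)"
      using DERIV_chain2[where f = L and g = "\<lambda>s. 1 + s" and x = s and Db = 1, OF L(3)[OF r], of UNIV]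
        DERIV_add[OF DERIV_const DERIV_ident, of 1 s UNIV] by simp
    thus ?thesis unfolding l_def zeta_logd[OF that] using ns
      by (auto intro!: derivative_eq_intros simp: divide_inverse)
  qed
  have l_exp: "exp (l s) = zeta_reg (1 + s)" if "Re s > 0" for s
  proof -
    have "s \<noteq> 0" using that by auto
    thus ?thesis using Zexp[of "1 + s"] that by (simp add: l_def exp_add)
  qed
  have real: "\<exists>lr G. L (1 + of_real x) = of_real lr \<and> L' (1 + of_real x) = - of_real G \<and>
      has_bochner_integral lborel (\<lambda>t. mertens_error t * exp (- x * t))
        ((ln x + lr - ln (x + 1) + (G * x + x - 1) / (x + 1)) / x\<^sup>2)"
    if x: "x > 0" for x :: real
  proof -
    have r: "Re (1 + complex_of_real x) > 1" using x by simp
    have e: "complex_of_nat n powr (-(1 + of_real x)) = of_real (real n powr (-(1 + x)))" for n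
      by (simp add: powr_Reals_eq)
    have "(\<lambda>n. complex_of_real (mcoef n * real n powr (-(1+x)))) sums L (1 + of_real x)"
      using L(1)[OF r] by (simp only: e of_real_mult)
    then obtain lr where lr: "(\<lambda>n. mcoef n * real n powr (-(1+x))) sums lr" "L (1 + of_real x) = of_real lr"
      by (rule sums_complex_of_realE)
    have "(\<lambda>n. complex_of_real (mangoldt n * real n powr (-(1+x)))) sums (- L' (1 + of_real x))"
      using L(2)[OF r] by (simp only: e of_real_mult)
    then obtain G where G: "(\<lambda>n. mangoldt n * real n powr (-(1+x))) sums G" "- L' (1 + of_real x) = of_real G"
      by (rule sums_complex_of_realE)
    show ?thesis using mertens_error_laplace[OF x lr(1) G(1)] lr(2) G(2) by (intro exI[of _ lr] exI[of _ G]) (simp add: minus_equation_iff[of "L' _"])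
  qed
  have im: "Im (l (of_real x)) = 0" if "x > 0" for x :: real
    using real[OF that] that by (auto simp: l_def Ln_of_real)
  have conv: "laplace_conv mertens_error x" if "x > 0" for x
    using real[OF that] unfolding laplace_conv_def by (auto simp: has_bochner_integral_iff)
  have form: "laplace mertens_error (of_real x) * (of_real x)\<^sup>2 = laplace_num l (of_real x)"
    if x: "x > 0" for x :: real
  proof -
    obtain lr G where lG: "L (1 + of_real x) = of_real lr" "L' (1 + of_real x) = - of_real G"
      "has_bochner_integral lborel (\<lambda>t. mertens_error t * exp (- x * t))
        ((ln x + lr - ln (x + 1) + (G * x + x - 1) / (x + 1)) / x\<^sup>2)"
      using real[OF x] by blast
    define I where "I = (\<integral>t. mertens_error t * exp (- x * t) \<partial>lborel)"
    have I: "I = (ln x + lr - ln (x + 1) + (G * x + x - 1) / (x + 1)) / x\<^sup>2"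
      unfolding I_def using lG(3) by (simp add: has_bochner_integral_iff)
    have "(G * x + x - 1) / (x + 1) = - x * (1 / x - G) / (x + 1) + x / (x + 1)"
      using x by (simp add: algebra_simps flip: add_divide_distrib)
    hence "I * x\<^sup>2 = (ln x + lr) - ln (x + 1) - x * (1 / x - G) / (x + 1) + x / (x + 1)"
      unfolding I using x by simp
    hence "complex_of_real (I * x\<^sup>2) = complex_of_real ((ln x + lr) - ln (x + 1) - x * (1 / x - G) / (x + 1) + x / (x + 1))"
      by (rule arg_cong)
    moreover have "Ln (of_real x + 1) = complex_of_real (ln (x + 1))"
      using x Ln_of_real[of "x + 1"] by simp
    moreover have "zeta_logd (of_real x) = complex_of_real (1 / x - G)" using zeta_logd[of "of_real x"] x lG(2) by simp
    moreover have "l (of_real x) = complex_of_real (ln x + lr)" using x lG(1) by (simp add: l_def Ln_of_real)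
    moreover have "laplace mertens_error (of_real x) = of_real I" unfolding I_def by (rule laplace_of_real)
    ultimately show ?thesis by (simp add: laplace_num_def)
  qed
  show ?thesis by (rule that[OF l_deriv l_exp im conv form])
qed

text \<open>Measurability is extracted from the integrability of the product with exp (- t).\<close>

lemma laplace_fun_mertens_error: "laplace_fun mertens_error"
proof
  have "\<And>x::real. x > 0 \<Longrightarrow> laplace_conv mertens_error x"
    by (rule log_zeta_reg_transform)
  hence "laplace_conv mertens_error 1" by simp
  hence "(\<lambda>t. mertens_error t * exp (- 1 * t)) \<in> borel_measurable lborel"
    unfolding laplace_conv_def by (rule borel_measurable_integrable)
  hence "(\<lambda>t. (mertens_error t * exp (- 1 * t)) * exp t) \<in> borel_measurable borel" by measurable
  thus "mertens_error \<in> borel_measurable borel" by (simp add: mult.assoc flip: exp_add)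
  show "mertens_error t = 0" if "t < 0" for t using that by (simp add: mertens_error_def)
qed

lemma zeta_logd_holomorphic:
  assumes "\<And>s. s \<in> S \<Longrightarrow> zeta_reg (1 + s) \<noteq> 0"
  shows "zeta_logd holomorphic_on S"
proof -
  have "(\<lambda>s. deriv zeta_reg (1 + s)) holomorphic_on S" "(\<lambda>s. zeta_reg (1 + s)) holomorphic_on S"
    by (rule holomorphic_on_compose_gen[of _ _ _ UNIV, unfolded o_def];
        auto intro!: holomorphic_intros holomorphic_deriv zeta_reg_holomorphic)+
  thus ?thesis unfolding zeta_logd_def by (intro holomorphic_on_divide) (use assms in auto)
qed

text \<open>On a convex neighbourhood of the segment without zeros the logarithmic derivative has a
  primitive, which continues \<open>l\<close>. At 0 the numerator has a double zero: the logarithm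
  is 0 as \<open>zeta_reg 1 = 1\<close>, and in the derivative the two contributions of
  \<open>zeta_logd 0\<close> cancel, as do those of Ln (s + 1) and s / (s + 1).\<close>

lemma laplace_mertens_error_continuation:
  fixes a s0 :: real
  assumes a: "-1 < a" "a < s0" "s0 < 0"
  obtains S V where "open S" "convex S" "of_real ` {s0..1} \<subseteq> S" "S \<subseteq> {s. Re s > a}" "V holomorphic_on S"
    "\<And>x::real. 0 < x \<Longrightarrow> x \<le> 1 \<Longrightarrow> V (of_real x) = laplace mertens_error (of_real x)"
proof -
  obtain l :: "complex \<Rightarrow> complex" where l:
    "\<And>s. Re s > 0 \<Longrightarrow> (l has_field_derivative zeta_logd s) (at s)"
    "\<And>s. Re s > 0 \<Longrightarrow> exp (l s) = zeta_reg (1 + s)"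
    "\<And>x::real. x > 0 \<Longrightarrow> Im (l (of_real x)) = 0"
    "\<And>x::real. x > 0 \<Longrightarrow> laplace mertens_error (of_real x) * (of_real x)\<^sup>2 = laplace_num l (of_real x)"
    by (rule log_zeta_reg_transform) blast
  define K where "K = (complex_of_real ` {s0..1})"
  have K: "K = closed_segment (of_real s0) (of_real 1)"
    unfolding K_def closed_segment_of_real using a by (subst closed_segment_eq_real_ivl) simp
  have contZ: "continuous_on UNIV (\<lambda>s. zeta_reg (1 + s))"
    by (intro continuous_on_compose2[OF holomorphic_on_imp_continuous_on[OF zeta_reg_holomorphic[of UNIV]]] continuous_intros) auto
  \<comment> \<open>The half-plane Re s \<le> a is avoided too: this keeps \<open>S\<close> away
    from -1 and, in the application, from the pole of the comparison function.\<close>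
  define Bad where "Bad = {s. zeta_reg (1 + s) = 0} \<union> {s. Re s \<le> a}"
  have "closed {s. zeta_reg (1 + s) = 0}"
    using continuous_closed_vimage[of "{0}" "\<lambda>s. zeta_reg (1 + s)"] contZ
    by (simp add: vimage_def continuous_on_eq_continuous_at)
  hence "closed Bad" unfolding Bad_def by (intro closed_Un closed_halfspace_Re_le)
  moreover have "compact K" unfolding K by (rule compact_segment)
  moreover have "K \<inter> Bad = {}"
  proof -
    have "complex_of_real x \<notin> Bad" if "x \<in> {s0..1}" for x
    proof -
      have "1 + x > 0" using that a by auto
      then obtain y where "zeta_reg (of_real (1 + x)) = of_real y" "y > 0" by (rule zeta_reg_real_pos)
      thus ?thesis using that a by (auto simp: Bad_def)
    qed
    thus ?thesis by (auto simp: K_def)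
  qed
  ultimately obtain d where d: "d > 0" "\<And>x y. x \<in> K \<Longrightarrow> y \<in> Bad \<Longrightarrow> d \<le> dist x y"
    using separate_compact_closed[of K Bad] by blast
  \<comment> \<open>The Minkowski sum of a segment and a ball, hence convex.\<close>
  define S where "S = (\<Union>x\<in>K. ball x d)"
  have opS: "open S" unfolding S_def by blast
  have "S = (\<Union>x\<in>K. \<Union>y\<in>ball 0 d. {x + y})"
  proof (intro equalityI subsetI)
    fix w assume "w \<in> S"
    then obtain x where "x \<in> K" "dist x w < d" by (auto simp: S_def)
    thus "w \<in> (\<Union>x\<in>K. \<Union>y\<in>ball 0 d. {x + y})"
      by (intro UN_I[of x] UN_I[of "w - x"]) (auto simp: dist_norm norm_minus_commute)
  next
    fix w assume "w \<in> (\<Union>x\<in>K. \<Union>y\<in>ball 0 d. {x + y})"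
    then obtain x y where "x \<in> K" "norm y < d" "w = x + y" by auto
    thus "w \<in> S" by (auto simp: S_def dist_norm intro!: bexI[of _ x])
  qed
  hence cvS: "convex S" using convex_sums[of K "ball 0 d"] K by simp
  have KS: "K \<subseteq> S" using d(1) by (auto simp: S_def)
  have SB: "s \<notin> Bad" if "s \<in> S" for s using that d(2) by (fastforce simp: S_def)
  have nz: "zeta_reg (1 + s) \<noteq> 0" and Re: "Re s > a" if "s \<in> S" for s using SB[OF that] by (auto simp: Bad_def)
  have in_S: "0 \<in> S" "1 \<in> S" using KS a by (auto simp: K_def image_iff subset_iff dest: bspec[of _ _ 0] bspec[of _ _ 1])
  have holD: "zeta_logd holomorphic_on S" by (rule zeta_logd_holomorphic[OF nz])
  obtain l0 where l0: "\<And>s. s \<in> S \<Longrightarrow> (l0 has_field_derivative zeta_logd s) (at s within S)"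
    using holomorphic_convex_primitive'[OF cvS opS holD] by blast
  \<comment> \<open>Normalised to agree with \<open>l\<close> at 1, and so on the whole part of
    \<open>S\<close> with Re s > 0.\<close>
  define m where "m = (\<lambda>s. l0 s - l0 1 + l 1)"
  have m_deriv: "(m has_field_derivative zeta_logd s) (at s)" if "s \<in> S" for s
    using l0[OF that] at_within_open[OF that opS] unfolding m_def by (auto intro!: derivative_eq_intros)
  have ml: "m s = l s" if s: "s \<in> S" "Re s > 0" for s
  proof -
    define U where "U = S \<inter> {s. Re s > 0}"
    have "\<exists>c. \<forall>s\<in>U. m s - l s = c"
    proof (rule has_field_derivative_zero_constant)
      show "convex U" unfolding U_def by (intro convex_Int cvS convex_halfspace_Re_gt)
      fix w assume "w \<in> U"
      hence "((\<lambda>s. m s - l s) has_field_derivative zeta_logd w - zeta_logd w) (at w)"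
        unfolding U_def by (intro DERIV_diff m_deriv l(1)) auto
      thus "((\<lambda>s. m s - l s) has_field_derivative 0) (at w within U)"
        by (simp add: has_field_derivative_at_within)
    qed
    then obtain c where c: "\<And>s. s \<in> U \<Longrightarrow> m s - l s = c" by blast
    have "c = 0" using c[of 1] in_S by (simp add: U_def m_def)
    thus ?thesis using c[of s] s by (simp add: U_def)
  qed
  \<comment> \<open>From exp (m 0) = 1 a multiple of 2 pi i remains possible; the reality of
    \<open>l\<close> on the positive axis excludes it.\<close>
  have m0: "m 0 = 0"
  proof -
    define x where "x = (\<lambda>n. 1 / (real n + 1))"
    have x0: "x n > 0" and x1: "x n \<le> 1" for n by (auto simp: x_def)
    have xS: "of_real (x n) \<in> S" for n using KS x0[of n] x1[of n] a by (auto simp: K_def)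
    have xl: "x \<longlonglongrightarrow> 0" unfolding x_def by real_asymp
    hence xlc: "(\<lambda>n. complex_of_real (x n)) \<longlonglongrightarrow> 0" by (metis of_real_0 tendsto_of_real)
    have mlim: "(\<lambda>n. m (of_real (x n))) \<longlonglongrightarrow> m 0"
      by (rule isCont_tendsto_compose[OF DERIV_isCont[OF m_deriv[OF in_S(1)]] xlc])
    have "(\<lambda>n. Im (m (of_real (x n)))) \<longlonglongrightarrow> Im (m 0)" by (intro tendsto_intros mlim)
    moreover have "Im (m (of_real (x n))) = 0" for n using ml[OF xS] l(3) x0 by simp
    ultimately have im: "Im (m 0) = 0" by (simp add: LIMSEQ_const_iff)
    have "(\<lambda>n. exp (m (of_real (x n)))) \<longlonglongrightarrow> exp (m 0)" by (intro tendsto_intros mlim)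
    moreover have "exp (m (of_real (x n))) = zeta_reg (1 + of_real (x n))" for n using ml[OF xS] l(2) x0 by simp
    moreover have "(\<lambda>n. zeta_reg (1 + of_real (x n))) \<longlonglongrightarrow> zeta_reg (1 + 0)"
      using contZ by (intro continuous_on_tendsto_compose[OF contZ xlc]) auto
    ultimately have "exp (m 0) = 1" using LIMSEQ_unique by fastforce
    moreover have "m 0 = of_real (Re (m 0))" using im by (simp add: complex_eq_iff)
    ultimately have "exp (Re (m 0)) = 1" by (metis norm_exp_eq_Re norm_one)
    thus ?thesis using im by (simp add: complex_eq_iff)
  qed
  define q where "q = (\<lambda>s. zeta_logd s / (s + 1))"
  have s1: "s + 1 \<noteq> 0" "s + 1 \<notin> \<real>\<^sub>\<le>\<^sub>0" if "s \<in> S" for s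
    using Re[OF that] a by (auto simp: complex_eq_iff complex_nonpos_Reals_iff)
  have holq: "q holomorphic_on S" unfolding q_def by (intro holomorphic_intros holD) (use s1 in auto)
  define N where "N = (\<lambda>s. m s - Ln (s + 1) - s * q s + s / (s + 1))"
  have holm: "m holomorphic_on S"
    using m_deriv opS by (auto simp: holomorphic_on_open)
  have holN: "N holomorphic_on S"
    unfolding N_def by (intro holomorphic_intros holm holq) (use s1 in auto)
  have N0: "N 0 = 0" by (simp add: N_def m0)
  have dN: "deriv N 0 = 0"
  proof -
    have dq: "(q has_field_derivative deriv q 0) (at 0)"
      by (rule holomorphic_derivI[OF holq opS in_S(1)])
    have "(N has_field_derivative (zeta_logd 0 - 1 - (1 * q 0 + deriv q 0 * 0) + 1)) (at 0)"
      unfolding N_def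
      by (intro DERIV_add DERIV_diff m_deriv in_S DERIV_mult dq DERIV_ident)
         (auto intro!: derivative_eq_intros)
    hence "deriv N 0 = zeta_logd 0 - 1 - (1 * q 0 + deriv q 0 * 0) + 1" by (rule DERIV_imp_deriv)
    thus ?thesis by (simp add: q_def)
  qed
  \<comment> \<open>The double zero is divided out by two difference quotients: away from 0, V1 is N
    s / s and V is N s / s^2, up to the vanishing values at 0.\<close>
  define V1 where "V1 = (\<lambda>s. if s = 0 then deriv N 0 else (N s - N 0) / (s - 0))"
  define V where "V = (\<lambda>s. if s = 0 then deriv V1 0 else (V1 s - V1 0) / (s - 0))"
  have "V1 holomorphic_on S" unfolding V1_def by (rule pole_lemma_open[OF holN opS])
  hence "V holomorphic_on S" unfolding V_def by (rule pole_lemma_open[OF _ opS])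
  moreover have "V (of_real x) = laplace mertens_error (of_real x)" if "0 < x" "x \<le> 1" for x :: real
  proof -
    have xS: "of_real x \<in> S" using KS that a by (auto simp: K_def)
    have "V (of_real x) * (of_real x)\<^sup>2 = N (of_real x)"
      using that N0 dN by (simp add: V_def V1_def power2_eq_square)
    also have "\<dots> = laplace mertens_error (of_real x) * (of_real x)\<^sup>2"
      using l(4)[OF that(1)] ml[OF xS] that by (simp add: N_def q_def laplace_num_def)
    finally show ?thesis using that by simp
  qed
  moreover have "of_real ` {s0..1} \<subseteq> S" using KS by (simp add: K_def)
  moreover have "S \<subseteq> {s. Re s > a}" using Re by auto
  ultimately show ?thesis using that opS cvS by blast
qed

section \<open>Oscillation of the error term\<close>

lemma has_field_derivative_entire_shift:
  assumes "f holomorphic_on UNIV"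
  shows "((\<lambda>s. f (c + s)) has_field_derivative deriv f (c + s)) (at (s::complex))"
  using DERIV_chain2[where f = f and g = "\<lambda>s. c + s" and x = s and Db = 1,
      OF holomorphic_derivI[OF assms open_UNIV UNIV_I], of UNIV]
    DERIV_add[OF DERIV_const DERIV_ident, of c s UNIV] by simp

lemma zeta_logd_deriv:
  assumes "zeta_reg (1 + s) \<noteq> 0"
  shows "(zeta_logd has_field_derivative (deriv (deriv zeta_reg) (1 + s) * zeta_reg (1 + s) - (deriv zeta_reg (1 + s))\<^sup>2) / (zeta_reg (1 + s))\<^sup>2) (at s)"
proof -
  have "deriv zeta_reg holomorphic_on UNIV" by (intro holomorphic_deriv zeta_reg_holomorphic open_UNIV)
  from DERIV_quotient[OF has_field_derivative_entire_shift[OF this] has_field_derivative_entire_shift[OF zeta_reg_holomorphic] assms]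
  show ?thesis unfolding zeta_logd_def by (simp add: power2_eq_square)
qed

text \<open>If the error term stayed below \<open>t * exp (- b * t)\<close>, its transform \<open>V\<close> would be holomorphic for
  \<open>Re s > - b\<close> by Landau's theorem; but \<open>(s\<^sup>2 * V s)'\<close> has a double pole at \<open>\<rho> - 1\<close>, coming
  from the derivative of \<open>\<zeta>' / \<zeta>\<close>.\<close>

lemma mertens_error_oscillation:
  assumes \<rho>: "zeta_reg \<rho> = 0" "1 - b < Re \<rho>" and b: "0 < b" "b < (1::real)"
  shows "\<exists>t\<ge>T. mertens_error t > t * exp (- b * t)"
proof (rule ccontr)
  assume "\<not> ?thesis"
  hence le: "mertens_error t \<le> t * exp (- b * t)" if "t \<ge> T" for t using that by force
  interpret M: laplace_fun mertens_error by (rule laplace_fun_mertens_error)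
  obtain l :: "complex \<Rightarrow> complex" where l:
    "\<And>s. Re s > 0 \<Longrightarrow> (l has_field_derivative zeta_logd s) (at s)"
    "\<And>s. Re s > 0 \<Longrightarrow> exp (l s) = zeta_reg (1 + s)"
    "\<And>x::real. x > 0 \<Longrightarrow> laplace_conv mertens_error x"
    "\<And>x::real. x > 0 \<Longrightarrow> laplace mertens_error (of_real x) * (of_real x)\<^sup>2 = laplace_num l (of_real x)"
    by (rule log_zeta_reg_transform) blast
  \<comment> \<open>The comparison function. Its transform 1 / (s + b)^2 is regular to the right of
    - b, so h - \<open>mertens_error\<close> is eventually nonnegative and has a transform that
    continues along the segment.\<close>
  define h where "h = (\<lambda>t::real. indicator {0..} t * t * exp (- b * t))"
  define g where "g = (\<lambda>t. h t - mertens_error t)"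
  have h: "has_bochner_integral lborel (\<lambda>t. h t * exp (- x * t)) (1 / (x + b)\<^sup>2)" if "x > - b" for x
  proof -
    have "(\<lambda>t. h t * exp (- x * t)) = (\<lambda>t. indicator {0..} t * t * exp (- (x + b) * t))"
      by (auto simp: h_def algebra_simps simp flip: exp_add)
    thus ?thesis using mult_exp_laplace[of "x + b"] that by simp
  qed
  have h_conv: "laplace_conv h x" if "x > - b" for x
    using h[OF that] by (simp add: laplace_conv_def has_bochner_integral_iff)
  have [measurable]: "h \<in> borel_measurable borel" unfolding h_def by measurable
  interpret G: laplace_fun g
    by unfold_locales (auto simp: g_def h_def M.supp)
  have g_conv_iff: "laplace_conv g x \<longleftrightarrow> laplace_conv mertens_error x" if "x > - b" for x
  proof
    assume "laplace_conv g x"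
    with h_conv[OF that] have "integrable lborel (\<lambda>t. h t * exp (- x * t) - g t * exp (- x * t))"
      unfolding laplace_conv_def by (rule Bochner_Integration.integrable_diff)
    thus "laplace_conv mertens_error x" unfolding laplace_conv_def g_def by (simp add: algebra_simps)
  next
    assume "laplace_conv mertens_error x"
    with h_conv[OF that] have "integrable lborel (\<lambda>t. h t * exp (- x * t) - mertens_error t * exp (- x * t))"
      unfolding laplace_conv_def by (rule Bochner_Integration.integrable_diff)
    thus "laplace_conv g x" unfolding laplace_conv_def g_def by (simp add: algebra_simps)
  qed
  have g_conv: "laplace_conv g x" if "x > 0" for x using g_conv_iff[of x] l(3)[OF that] that b by simp
  have conv_s0: "laplace_conv g s0" if s0: "- b < s0" "s0 < 0" for s0
  proof -
    \<comment> \<open>The midpoint of - b and s0: the neighbourhood from the continuation lemma then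
      misses the pole at - b.\<close>
    define a where "a = (s0 - b) / 2"
    have a: "-1 < a" "- b < a" "a < s0" using s0 b by (auto simp: a_def)
    obtain S V where S: "open S" "convex S" "of_real ` {s0..1} \<subseteq> S" "S \<subseteq> {s. Re s > a}" "V holomorphic_on S"
      and V: "\<And>x::real. 0 < x \<Longrightarrow> x \<le> 1 \<Longrightarrow> V (of_real x) = laplace mertens_error (of_real x)"
      using laplace_mertens_error_continuation[OF a(1,3) s0(2)] by blast
    show ?thesis
    proof (rule Landau_laplace[where T = "max T 0" and S = S and C = "\<lambda>s. 1 / (s + of_real b)\<^sup>2 - V s"])
      show "laplace_fun g" by (rule G.laplace_fun_axioms)
      show "g t \<ge> 0" if "t \<ge> max T 0" for t using le[of t] that by (simp add: g_def h_def)
      show "(\<lambda>s. 1 / (s + of_real b)\<^sup>2 - V s) holomorphic_on S"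
      proof (intro holomorphic_intros S)
        fix s assume "s \<in> S"
        hence "Re (s + of_real b) > 0" using S(4) a by auto
        hence "s + of_real b \<noteq> 0" by (metis less_irrefl zero_complex.sel(1))
        thus "(s + of_real b)\<^sup>2 \<noteq> 0" by simp
      qed
      show "1 / (of_real x + of_real b)\<^sup>2 - V (of_real x) = laplace g (of_real x)" if x: "0 < x" "x \<le> 1" for x :: real
      proof -
        have "(\<integral>t. g t * exp (- x * t) \<partial>lborel) = (\<integral>t. h t * exp (- x * t) - mertens_error t * exp (- x * t) \<partial>lborel)"
          by (simp add: g_def algebra_simps)
        also have "\<dots> = (\<integral>t. h t * exp (- x * t) \<partial>lborel) - (\<integral>t. mertens_error t * exp (- x * t) \<partial>lborel)"
          using h_conv[of x] l(3)[OF x(1)] x b unfolding laplace_conv_def by (intro Bochner_Integration.integral_diff) auto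
        also have "(\<integral>t. h t * exp (- x * t) \<partial>lborel) = 1 / (x + b)\<^sup>2"
          using h[of x] x b by (simp add: has_bochner_integral_iff)
        finally show ?thesis using V[OF x] by (simp add: laplace_of_real)
      qed
    qed (use S s0 g_conv in auto)
  qed
  have conv: "laplace_conv mertens_error x" if "x > - b" for x
  proof (cases "x < 0")
    case True
    thus ?thesis using conv_s0[of x] g_conv_iff[of x] that by simp
  next
    case False
    have "laplace_conv mertens_error (- b / 2)" using conv_s0[of "- b / 2"] g_conv_iff[of "- b / 2"] b by simp
    thus ?thesis by (rule M.laplace_conv_mono) (use False b in auto)
  qed
  define H where "H = {s. Re s > - b}"
  define V where "V = laplace mertens_error"
  have opH: "open H" and cvH: "convex H" unfolding H_def by (auto simp: open_halfspace_Re_gt convex_halfspace_Re_gt)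
  have holV: "V holomorphic_on H" unfolding V_def H_def by (rule M.laplace_holomorphic[OF conv])
  define P where "P = (\<lambda>s. V s * s\<^sup>2)"
  have holP: "P holomorphic_on H" unfolding P_def by (intro holomorphic_intros holV)
  \<comment> \<open>Differentiation turns the logarithm, which would branch at a zero, into
    \<open>zeta_logd\<close>, a quotient of entire functions.\<close>
  define W where "W = deriv P"
  have holW: "W holomorphic_on H" unfolding W_def by (intro holomorphic_deriv holP opH)
  have s1: "s + 1 \<noteq> 0" if "s \<in> H" for s using that b by (auto simp: H_def complex_eq_iff)
  define z z1 z2 where "z = (\<lambda>s. zeta_reg (1 + s))" and "z1 = (\<lambda>s. deriv zeta_reg (1 + s))" and "z2 = (\<lambda>s. deriv (deriv zeta_reg) (1 + s))"
  have hol_shift: "(\<lambda>s. f (1 + s)) holomorphic_on A" if "f holomorphic_on UNIV" for f :: "complex \<Rightarrow> complex" and A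
    using has_field_derivative_entire_shift[OF that] by (meson field_differentiable_at_within field_differentiable_def holomorphic_on_def)
  have holz: "z holomorphic_on A" "z1 holomorphic_on A" "z2 holomorphic_on A" for A
    unfolding z_def z1_def z2_def by (intro hol_shift holomorphic_deriv zeta_reg_holomorphic open_UNIV)+
  have dz: "(z has_field_derivative z1 s) (at s)" for s
    unfolding z_def z1_def by (rule has_field_derivative_entire_shift[OF zeta_reg_holomorphic])
  have dDZ: "(zeta_logd has_field_derivative (z2 s * z s - (z1 s)\<^sup>2) / (z s)\<^sup>2) (at s)" if "z s \<noteq> 0" for s
    using zeta_logd_deriv[of s] that unfolding z_def z1_def z2_def by simp
  define Q where "Q = laplace_num l"
  let ?q = "\<lambda>s. zeta_logd s - 1 / (s + 1) - (zeta_logd s / (s + 1)\<^sup>2 + s / (s + 1) * ((z2 s * z s - (z1 s)\<^sup>2) / (z s)\<^sup>2)) + 1 / (s + 1)\<^sup>2"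
  have z_pos: "z s \<noteq> 0" if "Re s > 0" for s using l(2)[OF that] exp_not_eq_zero[of "l s"] by (simp add: z_def)
  have dQ: "(Q has_field_derivative ?q s) (at s)"
    if s: "Re s > 0" for s
  proof -
    have ns: "s + 1 \<noteq> 0" "s + 1 \<notin> \<real>\<^sub>\<le>\<^sub>0" using s by (auto simp: complex_eq_iff complex_nonpos_Reals_iff)
    have 1: "((\<lambda>s. Ln (s + 1)) has_field_derivative 1 / (s + 1)) (at s)"
      using ns by (auto intro!: derivative_eq_intros simp: divide_inverse)
    have 2: "((\<lambda>s. s / (s + 1)) has_field_derivative 1 / (s + 1)\<^sup>2) (at s)"
      using ns by (auto intro!: derivative_eq_intros simp: field_simps power2_eq_square)
    have 3: "((\<lambda>s. s * zeta_logd s / (s + 1)) has_field_derivative (zeta_logd s / (s + 1)\<^sup>2 + s / (s + 1) * ((z2 s * z s - (z1 s)\<^sup>2) / (z s)\<^sup>2))) (at s)"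
      using DERIV_mult[OF dDZ[OF z_pos[OF s]] 2] by (simp add: mult_ac add_ac)
    show ?thesis unfolding Q_def laplace_num_def by (intro DERIV_add DERIV_diff 1 2 3 l(1) s)
  qed
  have PQ: "P s = Q s" if s: "Re s > 0" for s
  proof -
    have "P s - Q s = 0"
    proof (rule analytic_continuation[where f = "\<lambda>s. P s - Q s" and S = "{s. Re s > 0}" and \<xi> = 1 and U = "of_real ` {0<..1}"])
      have "Q holomorphic_on {s. Re s > 0}"
        by (rule holomorphic_onI, rule field_differentiable_at_within)
           (use dQ in \<open>auto simp: field_differentiable_def\<close>)
      thus "(\<lambda>s. P s - Q s) holomorphic_on {s. Re s > 0}"
        by (intro holomorphic_on_diff holomorphic_on_subset[OF holP]) (use b in \<open>auto simp: H_def\<close>)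
      show "P w - Q w = 0" if "w \<in> of_real ` {0<..1}" for w
        using that l(4) by (auto simp: P_def Q_def V_def)
      show "(1::complex) islimpt of_real ` {0<..1}" using of_real_Ioc_islimpt[of 0 1] by simp
    qed (use s in \<open>auto simp: open_halfspace_Re_gt convex_connected convex_halfspace_Re_gt\<close>)
    thus ?thesis by simp
  qed
  have W_pos: "W s = ?q s"
    if s: "Re s > 0" for s
    unfolding W_def
  proof (rule DERIV_imp_deriv, rule has_field_derivative_transform_within_open[OF dQ[OF s] open_halfspace_Re_gt[of 0]])
    show "Q w = P w" if "w \<in> {w. Re w > 0}" for w using PQ that by simp
  qed (use s in auto)
  \<comment> \<open>The derivative with its denominator, the square of \<open>z\<close>, cleared.
    Both sides are now holomorphic on all of \<open>H\<close>, so their identity extends from Re s >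
    0 across the zeros.\<close>
  define R where "R = (\<lambda>s. z1 s * z s * (1 - 1 / (s + 1)\<^sup>2) - s / (s + 1) * (z2 s * z s - (z1 s)\<^sup>2) + (z s)\<^sup>2 * (1 / (s + 1)\<^sup>2 - 1 / (s + 1)))"
  have WR: "W s * (z s)\<^sup>2 = R s" if "s \<in> H" for s
  proof (rule halfplane_identity[where f = "\<lambda>s. W s * (z s)\<^sup>2" and g = R and a = "-b" and c = 0])
    show "(\<lambda>s. W s * (z s)\<^sup>2) holomorphic_on {s. Re s > - b}"
      using holW unfolding H_def by (intro holomorphic_intros holz)
    show "R holomorphic_on {s. Re s > - b}"
      unfolding R_def by (intro holomorphic_intros holz) (use s1 in \<open>auto simp: H_def\<close>)
    show "W s * (z s)\<^sup>2 = R s" if s: "Re s > 0" for s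
    proof -
      have "z s \<noteq> 0" by (rule z_pos[OF s])
      moreover have "zeta_logd s * (z s)\<^sup>2 = z1 s * z s" using calculation by (simp add: zeta_logd_def z_def z1_def power2_eq_square)
      moreover have "W s * (z s)\<^sup>2 = (zeta_logd s * (z s)\<^sup>2) * (1 - 1 / (s + 1)\<^sup>2) - s / (s + 1) * ((z2 s * z s - (z1 s)\<^sup>2) / (z s)\<^sup>2 * (z s)\<^sup>2) + (z s)\<^sup>2 * (1 / (s + 1)\<^sup>2 - 1 / (s + 1))"
        unfolding W_pos[OF s] by (simp add: algebra_simps)
      ultimately show ?thesis by (simp add: R_def)
    qed
  qed (use that in \<open>simp add: H_def\<close>)
  define \<xi> where "\<xi> = \<rho> - 1"
  have \<xi>: "\<xi> \<in> H" "z \<xi> = 0" using \<rho> by (auto simp: \<xi>_def H_def z_def)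
  have z0: "z 0 = 1" "0 \<in> H" using b by (auto simp: z_def H_def)
  have \<xi>0: "\<xi> \<noteq> 0" using \<xi> z0 by auto
  \<comment> \<open>The values z 0 = 1 and z \<xi> = 0 differ, so the zero at \<xi> has a finite
    order \<open>n\<close>.\<close>
  have "\<not> z constant_on H"
  proof
    assume "z constant_on H"
    then obtain c where "\<And>s. s \<in> H \<Longrightarrow> z s = c" by (auto simp: constant_on_def)
    from this[OF \<xi>(1)] this[OF z0(2)] \<xi> z0 show False by simp
  qed
  then obtain k r n where k: "0 < n" "0 < r" "ball \<xi> r \<subseteq> H" "k holomorphic_on ball \<xi> r"
    "\<And>w. w \<in> ball \<xi> r \<Longrightarrow> z w = (w - \<xi>) ^ n * k w" "\<And>w. w \<in> ball \<xi> r \<Longrightarrow> k w \<noteq> 0"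
    using holomorphic_factor_zero_nonconstant[OF holz(1) opH convex_connected[OF cvH] \<xi>] by metis
  define E where "E = (\<lambda>s. deriv k s / k s)"
  have holE: "E holomorphic_on ball \<xi> r"
    unfolding E_def by (intro holomorphic_on_divide holomorphic_deriv k open_ball)
  have zeta_logd_eq: "zeta_logd s = of_nat n / (s - \<xi>) + E s" and z_ne: "z s \<noteq> 0" if s: "s \<in> ball \<xi> r - {\<xi>}" for s
  proof -
    have u: "s - \<xi> \<noteq> 0" and sb: "s \<in> ball \<xi> r" and ks: "k s \<noteq> 0" using s k(6) by auto
    have "((\<lambda>w. (w - \<xi>) ^ n * k w) has_field_derivative (of_nat n * (s - \<xi>) ^ (n - 1) * k s + deriv k s * (s - \<xi>) ^ n)) (at s)"
    proof -
      have "((\<lambda>w. w - \<xi>) has_field_derivative 1) (at s)" by (auto intro!: derivative_eq_intros)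
      from DERIV_mult[OF DERIV_power[OF this, of n] holomorphic_derivI[OF k(4) open_ball sb]]
      show ?thesis by (simp add: mult_ac)
    qed
    hence "(z has_field_derivative (of_nat n * (s - \<xi>) ^ (n - 1) * k s + deriv k s * (s - \<xi>) ^ n)) (at s)"
      by (rule has_field_derivative_transform_within_open[OF _ open_ball sb]) (use k(5) in auto)
    hence z1: "z1 s = of_nat n * (s - \<xi>) ^ (n - 1) * k s + deriv k s * (s - \<xi>) ^ n"
      using dz[of s] DERIV_unique by blast
    obtain m where m: "n = Suc m" using k(1) by (cases n) auto
    show zn: "z s \<noteq> 0" using k(5)[OF sb] u ks by simp
    have "zeta_logd s = z1 s / z s" by (simp add: zeta_logd_def z_def z1_def)
    also have "\<dots> = of_nat n / (s - \<xi>) + E s"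
      unfolding z1 k(5)[OF sb] E_def m using u ks by (simp add: field_simps)
    finally show "zeta_logd s = of_nat n / (s - \<xi>) + E s" .
  qed
  \<comment> \<open>Both sides of the identity times (s - \<xi>)^2. They are continuous at \<xi>,
    where the first is 0 and the second is n \<xi> / (\<xi> + 1), nonzero because \<xi> is.\<close>
  define f1 where "f1 = (\<lambda>s. (s - \<xi>)\<^sup>2 * W s)"
  define f2 where "f2 = (\<lambda>s. (s - \<xi>) * (of_nat n + (s - \<xi>) * E s) * (1 - 1 / (s + 1)\<^sup>2)
     - s / (s + 1) * (- of_nat n + (s - \<xi>)\<^sup>2 * deriv E s) + (s - \<xi>)\<^sup>2 * (1 / (s + 1)\<^sup>2 - 1 / (s + 1)))"
  have eq: "f1 s = f2 s" if s: "s \<in> ball \<xi> r - {\<xi>}" for s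
  proof -
    have u: "s - \<xi> \<noteq> 0" and sb: "s \<in> ball \<xi> r" and sH: "s \<in> H" using s k(3) by auto
    have zn: "z s \<noteq> 0" by (rule z_ne[OF s])
    have "((\<lambda>w. of_nat n / (w - \<xi>) + E w) has_field_derivative (- of_nat n / (s - \<xi>)\<^sup>2 + deriv E s)) (at s)"
      using u by (auto intro!: derivative_eq_intros holomorphic_derivI[OF holE open_ball sb] simp: power2_eq_square)
    hence "(zeta_logd has_field_derivative (- of_nat n / (s - \<xi>)\<^sup>2 + deriv E s)) (at s)"
      by (rule has_field_derivative_transform_within_open[OF _ _ s]) (use zeta_logd_eq in auto)
    hence d: "(z2 s * z s - (z1 s)\<^sup>2) / (z s)\<^sup>2 = - of_nat n / (s - \<xi>)\<^sup>2 + deriv E s"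
      using dDZ[OF zn] DERIV_unique by blast
    have "W s = R s / (z s)\<^sup>2" using WR[OF sH] zn by (simp add: field_simps)
    also have "\<dots> = z1 s / z s * (1 - 1 / (s + 1)\<^sup>2) - s / (s + 1) * ((z2 s * z s - (z1 s)\<^sup>2) / (z s)\<^sup>2) + (1 / (s + 1)\<^sup>2 - 1 / (s + 1))"
    proof -
      have aux: "(a * c - d * B + U * e) / U = a / U * c - d * (B / U) + e" if "U \<noteq> 0" for a c d B U e :: complex
        using that by (simp add: add_divide_distrib diff_divide_distrib)
      have "z1 s / z s = z1 s * z s / (z s)\<^sup>2" using zn by (simp add: power2_eq_square)
      thus ?thesis unfolding R_def using aux[OF power_not_zero[OF zn]] by (simp only:)
    qed
    also have "z1 s / z s = zeta_logd s" by (simp add: zeta_logd_def z_def z1_def)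
    finally have W: "W s = (of_nat n / (s - \<xi>) + E s) * (1 - 1 / (s + 1)\<^sup>2) - s / (s + 1) * (- of_nat n / (s - \<xi>)\<^sup>2 + deriv E s) + (1 / (s + 1)\<^sup>2 - 1 / (s + 1))"
      unfolding d zeta_logd_eq[OF s] .
    have e1: "(s - \<xi>)\<^sup>2 * (of_nat n / (s - \<xi>) + E s) = (s - \<xi>) * (of_nat n + (s - \<xi>) * E s)"
    proof -
      have "u\<^sup>2 * (c / u + e) = u * (c + u * e)" if "u \<noteq> 0" for u c e :: complex
        using that by (simp add: power2_eq_square algebra_simps)
      thus ?thesis using u by blast
    qed
    have e2: "(s - \<xi>)\<^sup>2 * (- of_nat n / (s - \<xi>)\<^sup>2 + deriv E s) = - of_nat n + (s - \<xi>)\<^sup>2 * deriv E s"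
      using u by (simp add: algebra_simps)
    have "f1 s = ((s - \<xi>)\<^sup>2 * (of_nat n / (s - \<xi>) + E s)) * (1 - 1 / (s + 1)\<^sup>2)
      - s / (s + 1) * ((s - \<xi>)\<^sup>2 * (- of_nat n / (s - \<xi>)\<^sup>2 + deriv E s)) + (s - \<xi>)\<^sup>2 * (1 / (s + 1)\<^sup>2 - 1 / (s + 1))"
    proof -
      have "U * (A * c - d * B + e) = (U * A) * c - d * (U * B) + U * e" for U A B c d e :: complex
        by (simp add: algebra_simps)
      thus ?thesis unfolding f1_def W .
    qed
    thus ?thesis unfolding e1 e2 f2_def .
  qed
  have "f1 holomorphic_on ball \<xi> r"
    unfolding f1_def by (intro holomorphic_intros holomorphic_on_subset[OF holW k(3)])
  moreover have "f2 holomorphic_on ball \<xi> r"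
    unfolding f2_def by (intro holomorphic_intros holE open_ball) (use s1 k(3) in auto)
  ultimately have "continuous_on (ball \<xi> r) f1" "continuous_on (ball \<xi> r) f2"
    by (simp_all add: holomorphic_on_imp_continuous_on)
  hence "isCont f1 \<xi>" "isCont f2 \<xi>" using k(2) by (auto simp: continuous_on_eq_continuous_at)
  hence "f1 \<midarrow>\<xi>\<rightarrow> f1 \<xi>" "f2 \<midarrow>\<xi>\<rightarrow> f2 \<xi>" by (auto simp: isCont_def)
  moreover have "\<forall>\<^sub>F s in at \<xi>. f1 s = f2 s"
    using eventually_at_in_open[OF open_ball[of \<xi> r], of \<xi>] k(2) by (auto elim!: eventually_mono intro: eq)
  ultimately have "f1 \<xi> = f2 \<xi>" by (metis tendsto_cong tendsto_unique trivial_limit_at)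
  thus False using \<xi>0 k(1) s1[OF \<xi>(1)] by (simp add: f1_def f2_def)
qed

section \<open>From oscillation to large values of sigma\<close>

lemma exp_growth_gap:
  assumes "a < (b::real)" "c > 0"
  shows "\<forall>\<^sub>F t in at_top. K * exp (- b * t) < c * exp (- a * t)"
proof -
  have "((\<lambda>t. exp (- (b - a) * t)) \<longlongrightarrow> 0) at_top" using assms by real_asymp
  hence "((\<lambda>t. K * exp (- (b - a) * t)) \<longlongrightarrow> 0) at_top" by (rule tendsto_mult_right_zero)
  hence "\<forall>\<^sub>F t in at_top. K * exp (- (b - a) * t) < c" using assms by (simp add: order_tendsto_iff)
  thus ?thesis
  proof eventually_elim
    case (elim t)
    hence "K * exp (- (b - a) * t) * exp (- a * t) < c * exp (- a * t)" by (intro mult_strict_right_mono) auto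
    moreover have "exp (- (b - a) * t) * exp (- a * t) = exp (- b * t)" by (simp add: algebra_simps flip: exp_add)
    ultimately show ?case by (metis mult.assoc)
  qed
qed

text \<open>Two applications of ln y \<le> y - 1, to p / exp t and to ln p / t: the concave function
  ln (ln p) lies below its tangent at p = exp t.\<close>

lemma ln_ln_tangent:
  assumes "t > (0::real)" "p > 1"
  shows "ln (ln p) \<le> ln t + (p - exp t) / (exp t * t)"
proof -
  have "ln (p / exp t) \<le> p / exp t - 1" by (rule ln_le_minus_one) (use assms in auto)
  hence 1: "ln p \<le> t + (p - exp t) / exp t" using assms by (simp add: ln_div diff_divide_distrib)
  have lp: "ln p > 0" using assms by simp
  have "ln (ln p / t) \<le> ln p / t - 1" by (rule ln_le_minus_one) (use assms lp in auto)
  also have "\<dots> \<le> (t + (p - exp t) / exp t) / t - 1" using 1 assms by (simp add: divide_right_mono)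
  also have "\<dots> = (p - exp t) / (exp t * t)" using assms by (simp add: add_divide_distrib)
  finally show ?thesis using assms lp by (simp add: ln_div)
qed

text \<open>Failure of Robin's inequality by the factor of the theorem with c = 1. It does not
  involve \<kappa>, whence the uniformity of c.\<close>

definition sigma_exceeds :: "real \<Rightarrow> nat \<Rightarrow> bool" where
  "sigma_exceeds b n \<longleftrightarrow>
     real (sigma n) > exp euler_mascheroni * real n * ln (ln (real n)) * (1 + 1 / ln (real n) powr b)"

lemma nat_floor_ge_half: "x \<ge> 8 \<Longrightarrow> real (nat \<lfloor>x\<rfloor>) \<ge> x / 2"
  by linarith

text \<open>The gain exp (- a t) is split in halves: one pays for the truncated prime powers
  (\<open>loss\<close>), the other exceeds (ln n) powr (- b) (\<open>gap\<close>). The 8 comes from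
  psi(N) \<ge> N / 4 and N \<ge> exp t / 2 with N the integer part of exp t.\<close>

lemma sigma_large_if_mertens_error_large:
  assumes t: "t > 0" "exp t > 8" and large: "mertens_error t > t * exp (- a * t)"
    and loss: "2 * (\<Sum>p\<in>primes_upto (nat \<lfloor>exp t\<rfloor>). (1 / real p) ^ Suc (prime_exp (nat \<lfloor>exp t\<rfloor>) p)) \<le> exp (- a * t) / 2"
    and gap: "8 powr b * exp (- b * t) < (1 / 2) * exp (- a * t)" and "b > 0"
  defines "n \<equiv> lcm_upto (nat \<lfloor>exp t\<rfloor>)"
  shows "ln (real n) \<ge> exp t / 8"
    "sigma_exceeds b n"
proof -
  define N where "N = nat \<lfloor>exp t\<rfloor>"
  define p where "p = psi N"
  have N2: "real N \<ge> exp t / 2" unfolding N_def by (rule nat_floor_ge_half) (use t in simp)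
  have N4: "N \<ge> 4" using N2 t(2) by linarith
  have lnn: "ln (real n) = p" unfolding n_def p_def N_def by (rule ln_lcm_upto)
  have "ln (real n) \<ge> real N / 4" unfolding n_def using ln_lcm_upto_ge[OF N4] by (simp add: N_def)
  thus pe: "ln (real n) \<ge> exp t / 8" using N2 by linarith
  have p1: "p > 1" using pe lnn t(2) by linarith
  have npos: "real n > 0" unfolding n_def using lcm_upto_pos by simp
  have spos: "real (sigma n) > 0" using npos sigma_pos[of n] by simp
  have "mertens_error t = t * (msum N - Ein t - (p - exp t + 1) / (exp t * t))"
    using t(1) by (simp add: mertens_error_def N_def p_def exp_minus field_simps)
  with large have "t * exp (- a * t) < t * (msum N - Ein t - (p - exp t + 1) / (exp t * t))" by simp
  hence "msum N > exp (- a * t) + Ein t + (p - exp t + 1) / (exp t * t)" using t(1) by simp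
  moreover have "(p - exp t + 1) / (exp t * t) \<ge> (p - exp t) / (exp t * t)"
    using t(1) by (intro divide_right_mono) auto
  moreover have "Ein t \<ge> ln t + euler_mascheroni" by (rule Ein_ge[OF t(1)])
  moreover have "ln (ln p) \<le> ln t + (p - exp t) / (exp t * t)" by (rule ln_ln_tangent[OF t(1) p1])
  moreover have "ln (real (sigma n)) - ln (real n) \<ge> msum N - exp (- a * t) / 2"
    using ln_sigma_lcm_upto[of N] loss unfolding n_def N_def by linarith
  ultimately have main: "ln (real (sigma n)) > ln (real n) + euler_mascheroni + ln (ln p) + exp (- a * t) / 2" by linarith
  have "p powr (- b) \<le> (exp t / 8) powr (- b)" using pe lnn \<open>b > 0\<close> by (intro powr_mono2') auto
  also have "\<dots> = 8 powr b * exp (- b * t)"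
    by (simp add: powr_divide powr_minus powr_def[of "exp t"] exp_minus field_simps)
  finally have "p powr (- b) < exp (- a * t) / 2" using gap by simp
  with main have "ln (real (sigma n)) > ln (real n) + euler_mascheroni + ln (ln p) + p powr (- b)" by linarith
  hence "exp (ln (real (sigma n))) > exp (ln (real n) + euler_mascheroni + ln (ln p) + p powr (- b))"
    by (simp only: exp_less_cancel_iff)
  hence "real (sigma n) > real n * exp euler_mascheroni * ln p * exp (p powr (- b))"
    using npos spos p1 by (simp add: exp_add)
  moreover have "real n * exp euler_mascheroni * ln p * exp (p powr (- b)) \<ge> real n * exp euler_mascheroni * ln p * (1 + p powr (- b))"
    using npos p1 by (intro mult_left_mono exp_ge_add_one_self) auto
  moreover have "p powr (- b) = 1 / p powr b" by (rule powr_minus_divide)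
  ultimately show "sigma_exceeds b n"
    unfolding sigma_exceeds_def lnn by (simp add: mult_ac)
qed

lemma sigma_large_infinitely_often:
  assumes \<rho>: "zeta_reg \<rho> = 0" "Re \<rho> \<le> 1" "1 - b < Re \<rho>" and b: "b < (1/2::real)"
  shows "\<exists>n>m. sigma_exceeds b n
    \<and> ln (real n) > 1"
proof -
  \<comment> \<open>The midpoint of 1 - Re \<rho> and b, positive since Re \<rho> \<le> 1 and b > 1
    - Re \<rho>; below, \<theta> is the midpoint of a and 1/2.\<close>
  define a where "a = (1 - Re \<rho> + b) / 2"
  have a: "0 < a" "a < b" "1 - a < Re \<rho>" "b > 0" using \<rho> by (auto simp: a_def field_simps)
  define \<theta> where "\<theta> = (a + 1/2) / 2"
  have \<theta>: "a < \<theta>" "0 < \<theta>" "\<theta> < 1/2" using a b by (auto simp: \<theta>_def)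
  obtain C where C: "C \<ge> 0" "\<And>x. x > 0 \<Longrightarrow>
    (\<Sum>p\<in>primes_upto x. (1 / real p) ^ Suc (prime_exp x p)) \<le> C * real x powr (-\<theta>)"
    using prime_power_loss[OF \<theta>(2,3)] by blast
  \<comment> \<open>The bound with m + 3 forces n > m + 3, which gives both n > m and n > exp
    1.\<close>
  have "\<forall>\<^sub>F t in at_top. t > 0 \<and> exp t > 8 \<and> exp t / 8 > ln (real m + 3) \<and>
      2 * C * 2 powr \<theta> * exp (- \<theta> * t) < (1 / 2) * exp (- a * t) \<and>
      8 powr b * exp (- b * t) < (1 / 2) * exp (- a * t)" (is "eventually ?P _")
  proof (intro eventually_conj)
    show "\<forall>\<^sub>F t::real in at_top. t > 0" by (rule eventually_gt_at_top)
    have ft: "filterlim (exp :: real \<Rightarrow> real) at_top at_top" by (rule exp_at_top)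
    show "\<forall>\<^sub>F t::real in at_top. exp t > 8" using ft by (simp add: filterlim_at_top_dense)
    have "\<forall>\<^sub>F t::real in at_top. exp t > 8 * ln (real m + 3)" using ft by (simp add: filterlim_at_top_dense)
    thus "\<forall>\<^sub>F t::real in at_top. exp t / 8 > ln (real m + 3)" by eventually_elim simp
  qed (intro exp_growth_gap a \<theta>; simp)+
  then obtain T where T: "\<And>t. t \<ge> T \<Longrightarrow> ?P t"
    by (auto simp: eventually_at_top_linorder)
  obtain t where t: "t \<ge> T" "mertens_error t > t * exp (- a * t)"
    using mertens_error_oscillation[OF \<rho>(1) a(3) a(1), of T] a(2) b by auto
  note Tt = T[OF t(1)]
  define N where "N = nat \<lfloor>exp t\<rfloor>"
  have N2: "real N \<ge> exp t / 2" unfolding N_def by (rule nat_floor_ge_half) (use Tt in simp)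
  hence N0: "N > 0" using exp_gt_zero[of t] by (intro Nat.gr0I) auto
  have "real N powr (-\<theta>) \<le> (exp t / 2) powr (-\<theta>)" using N2 \<theta> by (intro powr_mono2') auto
  also have "\<dots> = 2 powr \<theta> * exp (- \<theta> * t)"
    by (simp add: powr_divide powr_minus powr_def[of "exp t"] exp_minus field_simps)
  finally have "C * real N powr (-\<theta>) \<le> C * (2 powr \<theta> * exp (- \<theta> * t))" using C(1) by (rule mult_left_mono)
  with C(2)[OF N0] Tt have loss: "2 * (\<Sum>p\<in>primes_upto N. (1 / real p) ^ Suc (prime_exp N p)) \<le> exp (- a * t) / 2" by linarith
  define n where "n = lcm_upto N"
  have n: "ln (real n) \<ge> exp t / 8"
    "sigma_exceeds b n"
    using sigma_large_if_mertens_error_large[of t a b, OF _ _ t(2) loss[unfolded N_def] _ a(4)] Tt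
    unfolding n_def N_def by blast+
  have "ln (real n) > ln (real m + 3)" using n(1) Tt by linarith
  hence nm: "real n > real m + 3" unfolding n_def using lcm_upto_pos[of N] by (subst (asm) ln_less_cancel_iff) auto
  have "exp 1 < real n" using exp_le nm by linarith
  hence "ln (exp 1) < ln (real n)" using nm by (subst ln_less_cancel_iff) auto
  hence "ln (real n) > 1" by simp
  thus ?thesis using n(2) nm by (intro exI[of _ n]) auto
qed

theorem theorem5p2:
  fixes B b :: real
  assumes "\<not> Riemann_hypothesis"
    and "B = Sup (Re ` nontrivial_zeta_zeros)"
    and "1 - B < b" and "b < 1 / 2"
  shows "\<exists>c::real. c > 0 \<and> (\<forall>\<kappa>::real. \<kappa> > 1 \<longrightarrow>
    infinite {n::nat. n > 0 \<and>
      sigma_conv \<kappa> n >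
        (exp euler_mascheroni * real n * ln (ln (real n))) powr \<kappa> / Re (zeta (of_real \<kappa>))
          * (1 + c / ln (real n) powr b) powr \<kappa>})"
proof -
  \<comment> \<open>Failure of the hypothesis provides a zero, so the supremum is taken over a
    nonempty set and a zero near it can be picked.\<close>
  have "nontrivial_zeta_zeros \<noteq> {}" using assms(1) by (auto simp: Riemann_hypothesis_def)
  moreover have "1 - b < Sup (Re ` nontrivial_zeta_zeros)" using assms by simp
  ultimately obtain \<rho> where \<rho>: "\<rho> \<in> nontrivial_zeta_zeros" "1 - b < Re \<rho>"
    by (auto elim: less_cSupE)
  hence z: "\<rho> \<noteq> 1" "zeta \<rho> = 0" by (auto simp: nontrivial_zeta_zeros_def)
  have zeta_reg: "zeta_reg \<rho> = 0" using zeta_reg_eq_zeta[OF z(1)] z(2) by simp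
  have Re: "Re \<rho> \<le> 1"
  proof (rule ccontr)
    obtain L :: "complex \<Rightarrow> complex" where L: "\<And>s. Re s > 1 \<Longrightarrow> zeta s = exp (L s)"
      by (rule log_zeta) blast
    assume "\<not> Re \<rho> \<le> 1"
    thus False using L[of \<rho>] z(2) by simp
  qed
  show ?thesis
  proof (intro exI[of _ 1] conjI allI impI)
    fix \<kappa> :: real assume \<kappa>: "\<kappa> > 1"
    show "infinite {n::nat. n > 0 \<and>
      sigma_conv \<kappa> n >
        (exp euler_mascheroni * real n * ln (ln (real n))) powr \<kappa> / Re (zeta (of_real \<kappa>))
          * (1 + 1 / ln (real n) powr b) powr \<kappa>}" (is "infinite ?S")
      unfolding infinite_nat_iff_unbounded
    proof
      fix m
      obtain n where n: "n > m" "ln (real n) > 1"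
        "sigma_exceeds b n"
        using sigma_large_infinitely_often[OF zeta_reg Re \<rho>(2) assms(4)] by blast
      define A where "A = exp euler_mascheroni * real n * ln (ln (real n))"
      define D where "D = 1 + 1 / ln (real n) powr b"
      \<comment> \<open>From \<open>ln (real n) > 1\<close> the iterated logarithm is positive, as
        multiplicativity and monotonicity of \<open>powr\<close> require nonnegative bases.\<close>
      have A: "A \<ge> 0" unfolding A_def using n by (intro mult_nonneg_nonneg) auto
      have D: "D \<ge> 0" unfolding D_def by (intro add_nonneg_nonneg) auto
      have zp: "Re (zeta (of_real \<kappa>)) > 0" by (rule zeta_real_pos[OF \<kappa>])
      have "A powr \<kappa> / Re (zeta (of_real \<kappa>)) * D powr \<kappa> = (A * D) powr \<kappa> / Re (zeta (of_real \<kappa>))"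
        using A D by (simp add: powr_mult)
      also have "\<dots> < real (sigma n) powr \<kappa> / Re (zeta (of_real \<kappa>))"
        using n(3) A D \<kappa> zp unfolding sigma_exceeds_def A_def[symmetric] D_def[symmetric]
        by (intro divide_strict_right_mono powr_less_mono2) auto
      also have "\<dots> \<le> sigma_conv \<kappa> n" by (rule sigma_conv_ge[OF \<kappa>]) (use n in auto)
      finally show "\<exists>n>m. n \<in> ?S"
        using n(1) unfolding A_def D_def by (intro exI[of _ n]) auto
    qed
  qed simp
qed

end
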